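(* Let $d\ge 3$ be a fixed integer, and for even $n$ let $\Gamma_n$ be the sandpile group of the random $d$-regular graph $H_n$. Let $V$ be a finite abelian group. If $d$ is odd, then $$\lim_{n\to\infty}\mathbb{E}|\mathrm{Sur}(\Gamma_n,V)|=|\wedge^2V|,$$ and if $d$ is even, then $$\lim_{n\to\infty}\mathbb{E}|\mathrm{Sur}(\Gamma_n,V)|=2^{\mathrm{Rank}_2(V)}|\wedge^2V|,$$ where $\mathrm{Rank}_2(V)$ is the rank (minimum number of generators) of the $2$-Sylow subgroup of $V$. The limits are along even $n$.
   Context: Random $d$-regular graph $H_n$ ($n$ even): the union (with multiplicity) of $d$ independent uniform random perfect matchings of $\{1,\dots,n\}$. Its adjacency matrix is $C_n=M_1+\dots+M_d$, where the $M_i$ are independent uniform random $n\times n$ permutation matrices of fixed point free involutions. The reduced Laplacian $\Delta_n$ is obtained from $C_n-dI$ by deleting its last row and last column; the sandpile group is $\Gamma_n=\mathbb{Z}^{n-1}/\mathrm{RowSpace}(\Delta_n)$, where $\mathrm{RowSpace}(\Delta_n)$ is the subgroup of $\mathbb{Z}^{n-1}$ generated by the rows of $\Delta_n$. $\mathrm{Sur}(\Gamma,V)$ is the set of surjective homomorphisms $\Gamma\to V$. The exterior power $\wedge^2V$ is the quotient of $V\otimes V$ by the subgroup generated by the elements $v\otimes v$, $v\in V$. *)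

theory Defs
  imports
    "HOL-Probability.Product_PMF"
    "HOL-Algebra.Free_Abelian_Groups"
    "Jordan_Normal_Form.Determinant"
begin

(* The vertex set is {0..<n}, matching the zero-based indices of the matrix library.
   A perfect matching is encoded by the fixed point free involution swapping the
   endpoints of each edge (and fixing everything outside the vertex set). *)
definition perfect_matchings :: "nat \<Rightarrow> (nat \<Rightarrow> nat) set" where
  "perfect_matchings n =
     {\<pi>. \<pi> permutes {0..<n} \<and> (\<forall>i\<in>{0..<n}. \<pi> i \<noteq> i \<and> \<pi> (\<pi> i) = i)}"

definition permutation_matrix :: "nat \<Rightarrow> (nat \<Rightarrow> nat) \<Rightarrow> int Matrix.mat" where
  "permutation_matrix n \<pi> = Matrix.mat n n (\<lambda>(i, j). if \<pi> i = j then 1 else 0)"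

(* Only the components with index below d are random; the others are the dummy value id. *)
definition random_matchings :: "nat \<Rightarrow> nat \<Rightarrow> (nat \<Rightarrow> nat \<Rightarrow> nat) pmf" where
  "random_matchings d n = Pi_pmf {0..<d} id (\<lambda>_. pmf_of_set (perfect_matchings n))"

definition adjacency_matrix :: "nat \<Rightarrow> nat \<Rightarrow> (nat \<Rightarrow> nat \<Rightarrow> nat) \<Rightarrow> int Matrix.mat" where
  "adjacency_matrix d n M =
     Matrix.mat n n (\<lambda>(i, j). \<Sum>k\<in>{0..<d}. permutation_matrix n (M k) $$ (i, j))"

definition reduced_laplacian :: "nat \<Rightarrow> nat \<Rightarrow> (nat \<Rightarrow> nat \<Rightarrow> nat) \<Rightarrow> int Matrix.mat" where
  "reduced_laplacian d n M =
     mat_delete (adjacency_matrix d n M - int d \<cdot>\<^sub>m 1\<^sub>m n) (n - 1) (n - 1)"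

definition row_space :: "nat \<Rightarrow> int Matrix.mat \<Rightarrow> int Matrix.vec set" where
  "row_space m A = generate (monoid_vec TYPE(int) m) (set (Matrix.rows A))"

definition sandpile_group ::
    "nat \<Rightarrow> nat \<Rightarrow> (nat \<Rightarrow> nat \<Rightarrow> nat) \<Rightarrow> int Matrix.vec set monoid" where
  "sandpile_group d n M =
     monoid_vec TYPE(int) (n - 1) Mod row_space (n - 1) (reduced_laplacian d n M)"

(* Functions are made extensional so that distinct elements differ on the carrier of G;
   otherwise the cardinality would be meaningless. *)
definition Sur :: "('a, 'm) monoid_scheme \<Rightarrow> ('b, 'n) monoid_scheme \<Rightarrow> ('a \<Rightarrow> 'b) set" where
  "Sur G H = epi G H \<inter> extensional (carrier G)"

definition expected_sur :: "nat \<Rightarrow> nat \<Rightarrow> ('a, 'm) monoid_scheme \<Rightarrow> real" where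
  "expected_sur d n V =
     measure_pmf.expectation (random_matchings d n)
       (\<lambda>M. real (card (Sur (sandpile_group d n M) V)))"

(* The free abelian group is written additively, whereas V is written multiplicatively. *)
definition tensor_relations :: "('a, 'm) monoid_scheme \<Rightarrow> ('a \<times> 'a \<Rightarrow>\<^sub>0 int) set" where
  "tensor_relations V =
     {frag_of (x \<otimes>\<^bsub>V\<^esub> y, z) - frag_of (x, z) - frag_of (y, z) | x y z.
        x \<in> carrier V \<and> y \<in> carrier V \<and> z \<in> carrier V} \<union>
     {frag_of (x, y \<otimes>\<^bsub>V\<^esub> z) - frag_of (x, y) - frag_of (x, z) | x y z.
        x \<in> carrier V \<and> y \<in> carrier V \<and> z \<in> carrier V}"

definition tensor_square ::
    "('a, 'm) monoid_scheme \<Rightarrow> ('a \<times> 'a \<Rightarrow>\<^sub>0 int) set monoid" where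
  "tensor_square V =
     (let F = free_Abelian_group (carrier V \<times> carrier V)
      in F Mod generate F (tensor_relations V))"

definition pure_tensor ::
    "('a, 'm) monoid_scheme \<Rightarrow> 'a \<Rightarrow> 'a \<Rightarrow> ('a \<times> 'a \<Rightarrow>\<^sub>0 int) set" where
  "pure_tensor V x y =
     (let F = free_Abelian_group (carrier V \<times> carrier V)
      in generate F (tensor_relations V) #>\<^bsub>F\<^esub> frag_of (x, y))"

definition exterior_square ::
    "('a, 'm) monoid_scheme \<Rightarrow> ('a \<times> 'a \<Rightarrow>\<^sub>0 int) set set monoid" where
  "exterior_square V =
     tensor_square V Mod generate (tensor_square V) {pure_tensor V v v | v. v \<in> carrier V}"

(* Such a P exists and is unique when p is prime and G is a finite abelian group. *)
definition sylow_subgroup :: "nat \<Rightarrow> ('a, 'm) monoid_scheme \<Rightarrow> 'a set" where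
  "sylow_subgroup p G = (THE P. subgroup P G \<and> card P = p ^ multiplicity p (order G))"

definition min_generators :: "('a, 'm) monoid_scheme \<Rightarrow> nat" where
  "min_generators G =
     (LEAST r. \<exists>S. S \<subseteq> carrier G \<and> finite S \<and> card S = r \<and> generate G S = carrier G)"

definition rank_at :: "nat \<Rightarrow> ('a, 'm) monoid_scheme \<Rightarrow> nat" where
  "rank_at p G = min_generators (G\<lparr>carrier := sylow_subgroup p G\<rparr>)"

end

theory Submission
  imports Defs "HOL-Algebra.Multiplicative_Group" "HOL-Real_Asymp.Real_Asymp" "HOL-Algebra.Sylow"
begin

text \<open>
A surjection from the sandpile group onto \<open>V\<close> is the same as a labelling \<open>q\<close> of the vertices by
elements of \<open>V\<close> that is trivial at the last vertex, generates \<open>V\<close> and satisfies \<open>C q = d q\<close> for the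
adjacency matrix \<open>C\<close>. Both sides of this equation change equally under translation, so the expected
number of surjections is \<open>1 / |V|\<close> times the sum of the probabilities of \<open>C q = d q\<close> over all labellings
\<open>q\<close> whose differences generate \<open>V\<close> (\<open>expected_sur_eq\<close>).

Fourier inversion at each of the \<open>n\<close> vertices writes this probability as \<open>|V| ^ (- n)\<close> times a sum over
families \<open>h\<close> of characters of \<open>V\<close> (\<open>hit_prob_fourier\<close>). The independence of the matchings turns each term
into a phase times \<open>T ^ d\<close>, where \<open>T\<close> is the average, over a single perfect matching, of the product over
its edges of a symmetric nondegenerate bicharacter \<open>B\<close> on \<open>V \<times> V^\<close>, evaluated at the points \<open>(q i, h i)\<close>.

The terms that survive are those whose points lie in a coset of an isotropic subgroup. As the
differences of \<open>q\<close> generate, this subgroup is the graph of an antisymmetric bicharacter \<open>f\<close>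
(\<open>unstructured_unconfined\<close>), and the term is the product of the conjugates of \<open>f (q i) (q i) ^ d\<close>. The sum
over \<open>q\<close> is asymptotically a complete character sum, so \<open>f\<close> contributes 1 if \<open>f x x ^ d = 1\<close> for all \<open>x\<close>
and 0 otherwise (\<open>sum_hit_prob_tendsto\<close>). Since the values \<open>f x x\<close> are signs, the limit is the number
of alternating bicharacters for odd \<open>d\<close> and of all antisymmetric ones for even \<open>d\<close>. The alternating ones are
the characters of the exterior square (\<open>card_exterior_square\<close>). An antisymmetric bicharacter is an
alternating one twisted by the sign character on its diagonal (\<open>card_antisymmetric_forms\<close>), and the number of
sign characters is 2 to the rank of the Sylow 2-subgroup (\<open>card_signs\<close>).

The remaining terms are negligible (\<open>unconfined_tendsto_0\<close>). Because \<open>d \<ge> 3\<close>, it suffices to bound the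
sum of the cubes of \<open>|T|\<close> over the configurations in no isotropic coset, relative to \<open>|V| ^ n\<close>. Three
mechanisms do this. If a positive proportion of the points is outside every isotropic coset, then revealing the
edges at two vertices at a time shows that \<open>T\<close> is exponentially small (\<open>norm_T_far\<close>), while the sum of
\<open>|T|\<^sup>2\<close> exceeds \<open>|V| ^ n\<close> by no more than a polynomial factor, by Parseval
(\<open>second_moment_poly\<close>). If few points are outside a coset of an isotropic subgroup smaller than a Lagrangian
one, then there are too few such configurations. If \<open>k \<ge> 1\<close> points are outside a coset of a Lagrangian subgroup,
then averaging \<open>|T| ^ 4\<close> over the other points leaves only the quadruples of matchings in which each inner vertex
is linked to the outer ones never or at least twice (\<open>fourth_moment\<close>). These are so rare that the average of
\<open>|T| ^ 3\<close> is of order \<open>(k / n) powr (3 * k / 2)\<close>, up to a factor exponential in \<open>k\<close>, and this beats the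
roughly \<open>(n / k) ^ k\<close> choices of the outer points (\<open>near_lagrangian_bound\<close>).
\<close>

section \<open>Characters of finite abelian groups\<close>

text \<open>The unitary characters of a group. Extensionality makes the set finite for a finite group and
makes its cardinality the expected one.\<close>

definition characters :: "('a, 'm) monoid_scheme \<Rightarrow> ('a \<Rightarrow> complex) set" where
  "characters G = {\<eta> \<in> extensional (carrier G).
     (\<forall>x\<in>carrier G. \<forall>y\<in>carrier G. \<eta> (x \<otimes>\<^bsub>G\<^esub> y) = \<eta> x * \<eta> y) \<and> (\<forall>x\<in>carrier G. norm (\<eta> x) = 1)}"

definition dual_group :: "('a, 'm) monoid_scheme \<Rightarrow> ('a \<Rightarrow> complex) monoid" where
  "dual_group G = \<lparr>carrier = characters G,
     mult = (\<lambda>\<eta> \<psi>. \<lambda>x\<in>carrier G. \<eta> x * \<psi> x), one = (\<lambda>x\<in>carrier G. 1)\<rparr>"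

lemma dual_group_simps [simp]:
  "carrier (dual_group G) = characters G" "\<one>\<^bsub>dual_group G\<^esub> = (\<lambda>x\<in>carrier G. 1)"
  "\<eta> \<otimes>\<^bsub>dual_group G\<^esub> \<psi> = (\<lambda>x\<in>carrier G. \<eta> x * \<psi> x)"
  by (simp_all add: dual_group_def)

lemma charactersD:
  assumes "\<eta> \<in> characters G"
  shows "\<eta> \<in> extensional (carrier G)"
    "x \<in> carrier G \<Longrightarrow> y \<in> carrier G \<Longrightarrow> \<eta> (x \<otimes>\<^bsub>G\<^esub> y) = \<eta> x * \<eta> y"
    "x \<in> carrier G \<Longrightarrow> norm (\<eta> x) = 1" "x \<in> carrier G \<Longrightarrow> \<eta> x \<noteq> 0"
  using assms by (auto simp: characters_def)

lemma characters_eqI: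
  assumes "\<eta> \<in> characters G" "\<psi> \<in> characters G" "\<And>x. x \<in> carrier G \<Longrightarrow> \<eta> x = \<psi> x"
  shows "\<eta> = \<psi>"
  using assms by (intro extensionalityI[of _ "carrier G"]) (auto simp: characters_def)

context comm_group begin

lemma character_one: assumes "\<eta> \<in> characters G" shows "\<eta> \<one> = 1"
proof -
  have "\<eta> \<one> * \<eta> \<one> = \<eta> \<one>" using charactersD(2)[OF assms, of \<one> \<one>] by simp
  then show ?thesis using charactersD(4)[OF assms, of \<one>] by simp
qed

lemma character_inv: assumes "\<eta> \<in> characters G" "x \<in> carrier G"
  shows "\<eta> (inv x) = inverse (\<eta> x)" "\<eta> (inv x) = cnj (\<eta> x)"
proof -
  have "\<eta> (inv x) * \<eta> x = 1"
    using charactersD(2)[OF assms(1), of "inv x" x] character_one[OF assms(1)] assms(2) by simp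
  then show 1: "\<eta> (inv x) = inverse (\<eta> x)"
    using charactersD(4)[OF assms] by (simp add: field_simps)
  have "inverse (\<eta> x) = cnj (\<eta> x)"
    using charactersD(3)[OF assms] divide_conv_cnj[of "\<eta> x" 1] by (simp add: inverse_eq_divide)
  then show "\<eta> (inv x) = cnj (\<eta> x)" using 1 by simp
qed

lemma character_pow: assumes "\<eta> \<in> characters G" "x \<in> carrier G"
  shows "\<eta> (x [^] (n::nat)) = \<eta> x ^ n"
  by (induction n) (use assms in \<open>auto simp: character_one charactersD(2)\<close>)

lemma character_mult_closed:
  assumes "\<eta> \<in> characters G" "\<psi> \<in> characters G"
  shows "(\<lambda>x\<in>carrier G. \<eta> x * \<psi> x) \<in> characters G"
  using assms by (auto simp: characters_def norm_mult)

lemma trivial_character: "(\<lambda>x\<in>carrier G. 1) \<in> characters G"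
  by (auto simp: characters_def)

lemma cnj_character: assumes "\<eta> \<in> characters G" shows "(\<lambda>x\<in>carrier G. cnj (\<eta> x)) \<in> characters G"
  using assms by (auto simp: characters_def)

lemma comm_group_dual: "comm_group (dual_group G)"
proof (rule comm_groupI)
  fix \<eta> assume c: "\<eta> \<in> carrier (dual_group G)"
  show "\<exists>\<psi>\<in>carrier (dual_group G). \<psi> \<otimes>\<^bsub>dual_group G\<^esub> \<eta> = \<one>\<^bsub>dual_group G\<^esub>"
  proof (rule bexI[of _ "\<lambda>x\<in>carrier G. cnj (\<eta> x)"])
    have "cnj (\<eta> x) * \<eta> x = 1" if "x \<in> carrier G" for x
      using charactersD(3)[of \<eta> G x] c that by (simp add: mult.commute complex_norm_square[symmetric])
    then show "(\<lambda>x\<in>carrier G. cnj (\<eta> x)) \<otimes>\<^bsub>dual_group G\<^esub> \<eta> = \<one>\<^bsub>dual_group G\<^esub>"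
      by (auto simp: fun_eq_iff)
  qed (use c in \<open>auto simp: cnj_character\<close>)
next
  fix \<eta> assume "\<eta> \<in> carrier (dual_group G)"
  then show "\<one>\<^bsub>dual_group G\<^esub> \<otimes>\<^bsub>dual_group G\<^esub> \<eta> = \<eta>"
    using charactersD(1)[of \<eta> G] by (intro extensionalityI[of _ "carrier G"]) simp_all
qed (simp_all add: character_mult_closed trivial_character mult_ac cong: restrict_cong)

lemma sum_character:
  assumes "finite (carrier G)" "\<eta> \<in> characters G" "x \<in> carrier G" "\<eta> x \<noteq> 1"
  shows "(\<Sum>y\<in>carrier G. \<eta> y) = 0"
proof -
  have "(\<Sum>y\<in>carrier G. \<eta> y) = (\<Sum>y\<in>carrier G. \<eta> (x \<otimes> y))"
    by (rule sum.reindex_bij_witness[of _ "\<lambda>y. x \<otimes> y" "\<lambda>y. inv x \<otimes> y"])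
      (use assms(3) in \<open>auto simp: m_assoc[symmetric]\<close>)
  also have "\<dots> = \<eta> x * (\<Sum>y\<in>carrier G. \<eta> y)"
    using assms by (simp add: charactersD(2) sum_distrib_left)
  finally show ?thesis using assms(4) by (simp add: algebra_simps)
qed

lemma finite_characters: assumes "finite (carrier G)" shows "finite (characters G)"
proof -
  have pos: "order G > 0" using assms order_gt_0_iff_finite by blast
  have "characters G \<subseteq> PiE (carrier G) (\<lambda>_. {z. z ^ order G = 1})"
  proof
    fix \<eta> assume c: "\<eta> \<in> characters G"
    have "\<eta> x ^ order G = 1" if "x \<in> carrier G" for x
      using character_pow[OF c that, of "order G"] pow_order_eq_1[OF that] character_one[OF c] by simp
    then show "\<eta> \<in> PiE (carrier G) (\<lambda>_. {z. z ^ order G = 1})"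
      using charactersD(1)[OF c] by (auto simp: PiE_def)
  qed
  moreover have "finite (PiE (carrier G) (\<lambda>_. {z::complex. z ^ order G = 1}))"
    using assms pos by (intro finite_PiE finite_roots_unity) auto
  ultimately show ?thesis using finite_subset by blast
qed

text \<open>Every element of the subgroup generated by \<open>H\<close> and \<open>a\<close> is \<open>h \<otimes> a [^] i\<close>, and two such
representations differ by a power of \<open>a [^] m\<close>, because \<open>m\<close> is the least positive exponent with
\<open>a [^] m \<in> H\<close>. Hence \<open>h \<otimes> a [^] i \<mapsto> \<eta> h * w ^ i\<close> is well defined as soon as
\<open>w ^ m = \<eta> (a [^] m)\<close>. The value \<open>w\<close> is left open since characters that separate points need a
nontrivial choice.\<close>

lemma extend_character_step:
  assumes fin: "finite (carrier G)" and H: "subgroup H G" and a: "a \<in> carrier G"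
    and mult: "\<And>x y. x \<in> H \<Longrightarrow> y \<in> H \<Longrightarrow> \<eta> (x \<otimes> y) = \<eta> x * \<eta> y"
    and norm: "\<And>x. x \<in> H \<Longrightarrow> norm (\<eta> x) = (1::real)"
    and m: "m > 0" "a [^] (m::nat) \<in> H" and min: "\<And>i. 0 < i \<Longrightarrow> i < m \<Longrightarrow> a [^] i \<notin> H"
    and w: "w ^ m = (\<eta> (a [^] m) :: complex)"
  obtains K \<eta>' where "subgroup K G" "H \<subseteq> K" "a \<in> K"
    "\<And>x y. x \<in> K \<Longrightarrow> y \<in> K \<Longrightarrow> \<eta>' (x \<otimes> y) = \<eta>' x * \<eta>' y"
    "\<And>x. x \<in> K \<Longrightarrow> norm (\<eta>' x) = (1::real)" "\<And>x. x \<in> H \<Longrightarrow> \<eta>' x = \<eta> x" "\<eta>' a = w"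
proof -
  interpret H: subgroup H G by (rule H)
  have one: "\<eta> \<one> = 1"
  proof -
    have "\<eta> \<one> * \<eta> \<one> = \<eta> \<one>" using mult[of \<one> \<one>] by simp
    moreover have "\<eta> \<one> \<noteq> 0" using norm[of \<one>] by auto
    ultimately show ?thesis by simp
  qed
  have Hpc: "h [^] (n::nat) \<in> H" if "h \<in> H" for h n
    by (induction n) (use that in auto)
  have Hpow: "\<eta> (h [^] (n::nat)) = \<eta> h ^ n" if "h \<in> H" for h n
    by (induction n) (use that Hpc in \<open>auto simp: one mult\<close>)
  have nw: "norm w = 1"
  proof -
    have "norm w ^ m = 1" using w norm[OF m(2)] by (simp flip: norm_power)
    then show ?thesis using m(1) power_eq_imp_eq_base[of "norm w" m 1] by simp
  qed
  have wd: "\<eta> h * w ^ i = \<eta> h' * w ^ j"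
    if "h \<in> H" "h' \<in> H" "h \<otimes> a [^] i = h' \<otimes> a [^] j" and ji: "j \<le> i" for h h' and i j :: nat
  proof -
    obtain e where e: "i = e + j" using ji by (metis add.commute le_Suc_ex)
    have hc: "h \<in> carrier G" "h' \<in> carrier G" using that by auto
    have "h \<otimes> a [^] e \<otimes> a [^] j = h' \<otimes> a [^] j"
      using that(3) hc a by (simp add: e nat_pow_mult m_assoc)
    then have he: "h \<otimes> a [^] e = h'" using hc a by (simp add: right_cancel)
    then have ae: "a [^] e = inv h \<otimes> h'" using hc a by (metis inv_solve_left nat_pow_closed)
    then have aeH: "a [^] e \<in> H" using that by simp
    have split: "a [^] e = (a [^] m) [^] (e div m) \<otimes> a [^] (e mod m)"
      using a by (simp add: nat_pow_pow nat_pow_mult)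
    have "a [^] (e mod m) = inv ((a [^] m) [^] (e div m)) \<otimes> a [^] e"
      using split a by (metis inv_solve_left nat_pow_closed)
    then have "a [^] (e mod m) \<in> H" using aeH Hpc[OF m(2)] by simp
    then have e0: "e mod m = 0" using min[of "e mod m"] m(1) by (metis gr0I mod_less_divisor)
    then have "a [^] e = (a [^] m) [^] (e div m)" using split a by simp
    then have "\<eta> (a [^] e) = w ^ (m * (e div m))" using Hpow[OF m(2)] w by (simp add: power_mult)
    then have "\<eta> (a [^] e) = w ^ e" using e0 by (metis add.right_neutral mult_div_mod_eq)
    then have "\<eta> h' = \<eta> h * w ^ e" using he mult[OF that(1) aeH] by simp
    then show ?thesis by (simp add: e power_add)
  qed
  have wd': "\<eta> h * w ^ i = \<eta> h' * w ^ j"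
    if "h \<in> H" "h' \<in> H" "h \<otimes> a [^] i = h' \<otimes> a [^] j" for h h' and i j :: nat
    using wd[OF that] wd[OF that(2,1) that(3)[symmetric]] by (metis nat_le_linear)
  define K where "K = {h \<otimes> a [^] i | h (i::nat). h \<in> H}"
  define \<eta>' where "\<eta>' g = (THE z. \<exists>h i. h \<in> H \<and> g = h \<otimes> a [^] (i::nat) \<and> z = \<eta> h * w ^ i)" for g
  have val: "\<eta>' (h \<otimes> a [^] i) = \<eta> h * w ^ i" if "h \<in> H" for h and i :: nat
    unfolding \<eta>'_def
  proof (rule the_equality)
    show "\<exists>h' i'. h' \<in> H \<and> h \<otimes> a [^] i = h' \<otimes> a [^] (i'::nat) \<and> \<eta> h * w ^ i = \<eta> h' * w ^ i'"
      using that by blast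
    fix z assume "\<exists>h' i'. h' \<in> H \<and> h \<otimes> a [^] i = h' \<otimes> a [^] (i'::nat) \<and> z = \<eta> h' * w ^ i'"
    then obtain h' and i' :: nat where "h' \<in> H" "h \<otimes> a [^] i = h' \<otimes> a [^] i'" "z = \<eta> h' * w ^ i'"
      by (elim exE conjE)
    then show "z = \<eta> h * w ^ i" using wd'[of h h' i i'] \<open>h \<in> H\<close> by simp
  qed
  have KI: "h \<otimes> a [^] (i::nat) \<in> K" if "h \<in> H" for h i using that K_def by blast
  have Kc: "K \<subseteq> carrier G" using a by (auto simp: K_def)
  have prod: "(h \<otimes> a [^] i) \<otimes> (h' \<otimes> a [^] j) = (h \<otimes> h') \<otimes> a [^] (i + j)" 
    if "h \<in> H" "h' \<in> H" for h h' and i j :: nat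
  proof -
    have "h \<in> carrier G" "h' \<in> carrier G" using that by auto
    then show ?thesis using a by (simp add: nat_pow_mult[symmetric] m_ac)
  qed
  have Kmult: "x \<otimes> y \<in> K" if "x \<in> K" "y \<in> K" for x y
  proof -
    obtain h i h' j where "h \<in> H" "x = h \<otimes> a [^] (i::nat)" "h' \<in> H" "y = h' \<otimes> a [^] (j::nat)"
      using \<open>x \<in> K\<close> \<open>y \<in> K\<close> unfolding K_def by (elim CollectE exE conjE)
    then show ?thesis using KI[of "h \<otimes> h'" "i + j"] prod by simp
  qed
  have K: "subgroup K G"
  proof (rule subgroupI)
    show "K \<noteq> {}" using KI[OF H.one_closed] by blast
    fix x assume x: "x \<in> K"
    have pw: "x [^] n \<in> K" for n :: nat
    proof (induction n)
      case 0 show ?case using KI[OF H.one_closed, of 0] by simp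
    next
      case (Suc n) then show ?case using Kmult x by simp
    qed
    have "inv x = x [^] (order G - 1)"
    proof -
      have xc: "x \<in> carrier G" using x Kc by auto
      have "order G > 0" using fin order_gt_0_iff_finite by blast
      then have "x [^] (order G - 1) \<otimes> x = \<one>" 
        using pow_order_eq_1[OF xc] by (metis Suc_diff_1 nat_pow_Suc)
      then show ?thesis using xc by (simp add: inv_equality)
    qed
    then show "inv x \<in> K" using pw by simp
  qed (use Kc Kmult in auto)
  show thesis
  proof (rule that[of K \<eta>'])
    show "H \<subseteq> K"
    proof
      fix h assume "h \<in> H" then show "h \<in> K" using KI[of h 0] by (simp add: H.mem_carrier)
    qed
    show "a \<in> K" using KI[OF H.one_closed, of 1] a by simp
    show "\<eta>' (x \<otimes> y) = \<eta>' x * \<eta>' y" if "x \<in> K" "y \<in> K" for x y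
    proof -
      obtain h i h' j where *: "h \<in> H" "x = h \<otimes> a [^] (i::nat)" "h' \<in> H" "y = h' \<otimes> a [^] (j::nat)"
        using \<open>x \<in> K\<close> \<open>y \<in> K\<close> unfolding K_def by (elim CollectE exE conjE)
      then show ?thesis 
        using val[of "h \<otimes> h'" "i + j"] val[OF *(1), of i] val[OF *(3), of j] prod[OF *(1,3)] mult[OF *(1,3)]
        by (simp add: power_add)
    qed
    show "norm (\<eta>' x) = 1" if "x \<in> K" for x
    proof -
      obtain h i where *: "h \<in> H" "x = h \<otimes> a [^] (i::nat)"
        using \<open>x \<in> K\<close> unfolding K_def by (elim CollectE exE conjE)
      then show ?thesis using val[OF *(1), of i] norm[OF *(1)] nw by (simp add: norm_mult norm_power)
    qed
    show "\<eta>' h = \<eta> h" if "h \<in> H" for h using val[OF that, of 0] that by (simp add: H.mem_carrier)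
    show "\<eta>' a = w" using val[OF H.one_closed, of 1] a one by simp
  qed (rule K)
qed

lemma exists_root: 
  assumes "norm (z::complex) = 1" "m > 0" shows "\<exists>w. w ^ m = z"
proof -
  have "z = cis (Arg z)" using assms(1) by (metis cis_Arg norm_zero sgn_div_norm div_by_1 inverse_1 scaleR_one zero_neq_one)
  also have "\<dots> = cis (real m * (Arg z / m))" using assms(2) by simp
  also have "\<dots> = cis (Arg z / m) ^ m" by (rule Complex.DeMoivre[symmetric])
  finally show ?thesis by metis
qed

lemma least_power_in_subgroup:
  assumes fin: "finite (carrier G)" and H: "subgroup H G" and a: "a \<in> carrier G"
  obtains m :: nat where "m > 0" "a [^] m \<in> H" "\<And>i. 0 < i \<Longrightarrow> i < m \<Longrightarrow> a [^] i \<notin> H"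
proof -
  have "order G > 0" using fin order_gt_0_iff_finite by blast
  then have ex: "\<exists>m::nat. m > 0 \<and> a [^] m \<in> H" 
    using pow_order_eq_1[OF a] subgroup.one_closed[OF H] by metis
  define m where "m = (LEAST m::nat. m > 0 \<and> a [^] m \<in> H)"
  have "m > 0 \<and> a [^] m \<in> H" unfolding m_def by (rule LeastI_ex[OF ex])
  moreover have "a [^] i \<notin> H" if "0 < i" "i < m" for i
    using not_less_Least[of i "\<lambda>m. m > 0 \<and> a [^] m \<in> H"] that unfolding m_def by blast
  ultimately show thesis using that by blast
qed

text \<open>Induction on the index: adjoin one element at a time, with any root as its value.\<close>

lemma extend_character:
  assumes fin: "finite (carrier G)" and H: "subgroup H G"
    and mult: "\<And>x y. x \<in> H \<Longrightarrow> y \<in> H \<Longrightarrow> \<eta> (x \<otimes> y) = \<eta> x * \<eta> y"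
    and norm: "\<And>x. x \<in> H \<Longrightarrow> norm (\<eta> x) = (1::real)"
  shows "\<exists>\<eta>'\<in>characters G. \<forall>x\<in>H. \<eta>' x = (\<eta> x :: complex)"
  using H mult norm
proof (induction "card (carrier G - H)" arbitrary: H \<eta> rule: less_induct)
  case less
  show ?case
  proof (cases "H = carrier G")
    case True
    then have "restrict \<eta> (carrier G) \<in> characters G" using less.prems by (auto simp: characters_def)
    then show ?thesis using True by (intro bexI[of _ "restrict \<eta> (carrier G)"]) auto
  next
    case False
    then obtain a where a: "a \<in> carrier G" "a \<notin> H" using subgroup.subset[OF less.prems(1)] by blast
    obtain m :: nat where m: "m > 0" "a [^] m \<in> H" "\<And>i. 0 < i \<Longrightarrow> i < m \<Longrightarrow> a [^] i \<notin> H"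
      using least_power_in_subgroup[OF fin less.prems(1) a(1)] by blast
    obtain w where w: "w ^ m = \<eta> (a [^] m)" using exists_root[OF less.prems(3)[OF m(2)] m(1)] by blast
    obtain K \<eta>' where K: "subgroup K G" "H \<subseteq> K" "a \<in> K"
      "\<And>x y. x \<in> K \<Longrightarrow> y \<in> K \<Longrightarrow> \<eta>' (x \<otimes> y) = \<eta>' x * \<eta>' y"
      "\<And>x. x \<in> K \<Longrightarrow> norm (\<eta>' x) = (1::real)" "\<And>x. x \<in> H \<Longrightarrow> \<eta>' x = \<eta> x" "\<eta>' a = w"
      by (rule extend_character_step[OF fin less.prems(1) a(1) less.prems(2,3) m w]) (assumption | blast)+
    have "card (carrier G - K) < card (carrier G - H)"
      using fin a K by (intro psubset_card_mono) auto
    from less.hyps[OF this K(1) K(4,5)] K(2,6) show ?thesis by (metis subsetD)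
  qed
qed

lemma separating_character:
  assumes fin: "finite (carrier G)" and H: "subgroup H G" and a: "a \<in> carrier G" "a \<notin> H"
  obtains \<eta> where "\<eta> \<in> characters G" "\<And>x. x \<in> H \<Longrightarrow> \<eta> x = 1" "\<eta> a \<noteq> 1"
proof -
  obtain m :: nat where m: "m > 0" "a [^] m \<in> H" "\<And>i. 0 < i \<Longrightarrow> i < m \<Longrightarrow> a [^] i \<notin> H"
    using least_power_in_subgroup[OF fin H a(1)] by blast
  have m2: "m \<ge> 2" using m a by (cases "m = 1") auto
  (* The primitive \<open>m\<close>-th root of unity extends the trivial character of \<open>H\<close>, and it
     differs from 1 because \<open>a\<close> outside \<open>H\<close> forces \<open>m\<close> to be at least 2. *)
  define w where "w = cis (2 * pi / m)"
  have "w ^ m = cis (real m * (2 * pi / m))" unfolding w_def by (rule Complex.DeMoivre)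
  then have w: "w ^ m = 1" using m(1) by simp
  have w1: "w \<noteq> 1"
  proof
    assume "w = 1"
    then have "cos (2 * pi / m) = 1" by (simp add: w_def complex_eq_iff)
    then obtain k :: int where k: "2 * pi / m = k * 2 * pi" using cos_one_2pi_int[of "2 * pi / m"] by auto
    have "1 / real m = of_int k" using k m2 by (simp add: field_simps)
    moreover have "0 < 1 / real m" "1 / real m < 1" using m2 by auto
    ultimately have "k > 0" "k < 1" by simp_all
    then show False by simp
  qed
  obtain K \<eta>' where K: "subgroup K G" "H \<subseteq> K" "a \<in> K"
      "\<And>x y. x \<in> K \<Longrightarrow> y \<in> K \<Longrightarrow> \<eta>' (x \<otimes> y) = \<eta>' x * \<eta>' y"
      "\<And>x. x \<in> K \<Longrightarrow> norm (\<eta>' x) = (1::real)" "\<And>x. x \<in> H \<Longrightarrow> \<eta>' x = 1" "\<eta>' a = w"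
    by (rule extend_character_step[OF fin H a(1), of "\<lambda>_. 1" m w]) (use m w in auto)
  obtain \<eta> where c: "\<eta> \<in> characters G" "\<forall>x\<in>K. \<eta> x = \<eta>' x"
    using extend_character[OF fin K(1) K(4,5)] by blast
  show thesis
    by (rule that[OF c(1)]) (use c(2) K w1 in auto)
qed

lemma exists_character_neq_one:
  assumes "finite (carrier G)" "a \<in> carrier G" "a \<noteq> \<one>"
  obtains \<eta> where "\<eta> \<in> characters G" "\<eta> a \<noteq> 1"
  using separating_character[OF assms(1) triv_subgroup assms(2)] assms(3) by blast

text \<open>Orthogonality in the dual group, applied to evaluation at \<open>a\<close>.\<close>

lemma sum_characters_at:
  assumes fin: "finite (carrier G)" and a: "a \<in> carrier G" "a \<noteq> \<one>"
  shows "(\<Sum>\<eta>\<in>characters G. \<eta> a) = 0"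
proof -
  obtain \<psi> where p: "\<psi> \<in> characters G" "\<psi> a \<noteq> 1" using exists_character_neq_one assms by blast
  interpret D: comm_group "dual_group G" by (rule comm_group_dual)
  have "(\<lambda>\<eta>\<in>characters G. \<eta> a) \<in> characters (dual_group G)"
    unfolding characters_def[of "dual_group G"] using a
    by (auto simp: character_mult_closed charactersD(3))
  from D.sum_character[OF _ this, of \<psi>]
  have "(\<Sum>\<eta>\<in>carrier (dual_group G). (\<lambda>\<eta>\<in>characters G. \<eta> a) \<eta>) = 0"
    using p finite_characters[OF fin] by simp
  then show ?thesis by (simp cong: sum.cong)
qed

lemma card_characters:
  assumes fin: "finite (carrier G)"
  shows "card (characters G) = card (carrier G)"
proof -
  (* Both orders of summation of all character values are evaluated by orthogonality. *)
  let ?S = "\<Sum>\<eta>\<in>characters G. \<Sum>x\<in>carrier G. \<eta> x"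
  have "(\<Sum>x\<in>carrier G. \<eta> x) = (if \<eta> = (\<lambda>x\<in>carrier G. 1) then of_nat (card (carrier G)) else 0)"
    if \<eta>: "\<eta> \<in> characters G" for \<eta>
  proof (cases "\<forall>x\<in>carrier G. \<eta> x = 1")
    case True
    then have "\<eta> = (\<lambda>x\<in>carrier G. 1)" by (intro characters_eqI[OF \<eta> trivial_character]) simp
    then show ?thesis using True by simp
  next
    case False
    then obtain x where x: "x \<in> carrier G" "\<eta> x \<noteq> 1" by blast
    then have "\<eta> \<noteq> (\<lambda>x\<in>carrier G. 1)" by (metis restrict_apply')
    then show ?thesis using sum_character[OF fin \<eta> x] by simp
  qed
  then have "?S = of_nat (card (carrier G))"
    using finite_characters[OF fin] trivial_character by simp
  moreover have "?S = (\<Sum>x\<in>carrier G. \<Sum>\<eta>\<in>characters G. \<eta> x)" by (rule sum.swap)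
  moreover have "\<dots> = (\<Sum>x\<in>carrier G. if x = \<one> then of_nat (card (characters G)) else 0)"
    by (intro sum.cong) (auto simp: sum_characters_at[OF fin] character_one)
  ultimately show ?thesis using fin by simp
qed

end

section \<open>Perfect matchings and averages over them\<close>

definition matchings :: "'v set \<Rightarrow> ('v \<Rightarrow> 'v) set" where
  "matchings A = {\<pi>. \<pi> permutes A \<and> (\<forall>i\<in>A. \<pi> i \<noteq> i \<and> \<pi> (\<pi> i) = i)}"

lemma perfect_matchings_eq: "perfect_matchings n = matchings {0..<n}"
  by (simp add: perfect_matchings_def matchings_def)

lemma matchings_empty [simp]: "matchings {} = {id}"
  by (auto simp: matchings_def)

lemma finite_matchings: "finite A \<Longrightarrow> finite (matchings A)"
  using finite_permutations[of A] by (rule finite_subset[rotated]) (auto simp: matchings_def)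

lemma matching_extend:
  assumes "a \<in> A" "j \<in> A - {a}" "\<sigma> \<in> matchings (A - {a, j})"
  shows "\<sigma> \<circ> Transposition.transpose a j \<in> matchings A" "(\<sigma> \<circ> Transposition.transpose a j) a = j" "(\<sigma> \<circ> Transposition.transpose a j) j = a"
    "\<And>i. i \<notin> {a, j} \<Longrightarrow> (\<sigma> \<circ> Transposition.transpose a j) i = \<sigma> i"
proof -
  have p: "\<sigma> permutes A - {a, j}" using assms by (simp add: matchings_def)
  have fix_: "\<sigma> a = a" "\<sigma> j = j" using permutes_not_in[OF p] by auto
  show v: "(\<sigma> \<circ> Transposition.transpose a j) a = j" "(\<sigma> \<circ> Transposition.transpose a j) j = a" using fix_ by auto
  show w: "(\<sigma> \<circ> Transposition.transpose a j) i = \<sigma> i" if "i \<notin> {a, j}" for i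
    using that by (simp add: transpose_def)
  have "\<sigma> \<circ> Transposition.transpose a j permutes A"
  proof (rule permutes_compose)
    show "Transposition.transpose a j permutes A" using assms by (intro permutes_swap_id) auto
    show "\<sigma> permutes A" by (rule permutes_subset[OF p]) auto
  qed
  moreover have "(\<sigma> \<circ> Transposition.transpose a j) i \<noteq> i \<and> (\<sigma> \<circ> Transposition.transpose a j) ((\<sigma> \<circ> Transposition.transpose a j) i) = i" if "i \<in> A" for i
  proof (cases "i \<in> {a, j}")
    case True then show ?thesis using v assms(2) by auto
  next
    case False
    then have i: "i \<in> A - {a, j}" using that by auto
    then have "\<sigma> i \<in> A - {a, j}" using permutes_in_image[OF p] by blast
    then have "(\<sigma> \<circ> Transposition.transpose a j) (\<sigma> i) = \<sigma> (\<sigma> i)" by (intro w) auto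
    then show ?thesis using i w[OF False] assms(3) by (simp add: matchings_def)
  qed
  ultimately show "\<sigma> \<circ> Transposition.transpose a j \<in> matchings A" by (simp add: matchings_def)
qed

lemma matching_restrict:
  assumes "a \<in> A" "\<pi> \<in> matchings A"
  shows "\<pi> a \<in> A - {a}" "\<pi> \<circ> Transposition.transpose a (\<pi> a) \<in> matchings (A - {a, \<pi> a})"
proof -
  have p: "\<pi> permutes A" and inv: "\<And>i. i \<in> A \<Longrightarrow> \<pi> i \<noteq> i \<and> \<pi> (\<pi> i) = i"
    using assms by (auto simp: matchings_def)
  show j: "\<pi> a \<in> A - {a}" using permutes_in_image[OF p, of a] inv assms(1) by auto
  have "\<pi> \<circ> Transposition.transpose a (\<pi> a) permutes A"
    using assms(1) j p by (intro permutes_compose[OF permutes_swap_id]) auto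
  then have q: "\<pi> \<circ> Transposition.transpose a (\<pi> a) permutes A - {a, \<pi> a}"
    by (rule permutes_superset) (use inv assms(1) in auto)
  moreover have "(\<pi> \<circ> Transposition.transpose a (\<pi> a)) i \<noteq> i \<and> (\<pi> \<circ> Transposition.transpose a (\<pi> a)) ((\<pi> \<circ> Transposition.transpose a (\<pi> a)) i) = i"
    if "i \<in> A - {a, \<pi> a}" for i
  proof -
    have i: "i \<notin> {a, \<pi> a}" "i \<in> A" using that by auto
    then have "\<pi> i \<notin> {a, \<pi> a}" using inv assms(1) by (metis insertE insertCI emptyE)
    then show ?thesis using inv[OF i(2)] i by (simp add: transpose_def)
  qed
  ultimately show "\<pi> \<circ> Transposition.transpose a (\<pi> a) \<in> matchings (A - {a, \<pi> a})"
    by (simp add: matchings_def)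
qed

text \<open>A perfect matching is the choice of a partner for one vertex and a matching of the rest.\<close>

lemma sum_matchings:
  assumes "finite A" "a \<in> A"
  shows "(\<Sum>\<pi>\<in>matchings A. f \<pi>) = (\<Sum>j\<in>A - {a}. \<Sum>\<sigma>\<in>matchings (A - {a, j}). f (\<sigma> \<circ> Transposition.transpose a j))"
proof -
  have "(\<Sum>j\<in>A - {a}. \<Sum>\<sigma>\<in>matchings (A - {a, j}). f (\<sigma> \<circ> Transposition.transpose a j)) =
      (\<Sum>(j, \<sigma>)\<in>(SIGMA j:A - {a}. matchings (A - {a, j})). f (\<sigma> \<circ> Transposition.transpose a j))"
    using assms by (intro sum.Sigma) (auto simp: finite_matchings)
  also have "\<dots> = (\<Sum>\<pi>\<in>matchings A. f \<pi>)"
  proof (rule sum.reindex_bij_witness[of _ "\<lambda>\<pi>. (\<pi> a, \<pi> \<circ> Transposition.transpose a (\<pi> a))" "\<lambda>(j, \<sigma>). \<sigma> \<circ> Transposition.transpose a j"], goal_cases)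
    case (1 p)
    then obtain j \<sigma> where p: "p = (j, \<sigma>)" "j \<in> A - {a}" "\<sigma> \<in> matchings (A - {a, j})" by auto
    have "(\<sigma> \<circ> Transposition.transpose a j) \<circ> Transposition.transpose a j = \<sigma>" by (simp add: comp_assoc)
    then show ?case unfolding p(1) case_prod_conv matching_extend(2)[OF assms(2) p(2,3)] by simp
  next
    case (2 p) then show ?case using matching_extend(1)[OF assms(2)] by (auto simp del: o_apply)
  next
    case (3 \<pi>) then show ?case by (simp add: comp_assoc)
  next
    case (4 \<pi>) then show ?case using matching_restrict[OF assms(2)] by auto
  qed auto
  finally show ?thesis by simp
qed

lemma card_remove_pair:
  assumes "finite A" "a \<in> A" "j \<in> A - {a}"
  shows "card (A - {a, j}) = card A - 2"
proof -
  have "card {a, j} = 2" using assms by auto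
  then show ?thesis using assms by (subst card_Diff_subset) auto
qed

lemma card_matchings_cong:
  assumes "finite A" "finite B" "card A = card B"
  shows "card (matchings (A :: 'v set)) = card (matchings (B :: 'v set))"
  using assms
proof (induction "card A" arbitrary: A B rule: less_induct)
  case less
  show ?case
  proof (cases "A = {}")
    case True then show ?thesis using less.prems by simp
  next
    case False
    then obtain a b where ab: "a \<in> A" "b \<in> B" using less.prems by (metis card_eq_0_iff ex_in_conv)
    have c: "card (matchings X) = (\<Sum>j\<in>X - {x}. card (matchings (X - {x, j})))" if "finite X" "x \<in> X" for X :: "'v set" and x
      using sum_matchings[OF that, of "\<lambda>_. 1::nat"] by simp
    have d: "card (X - {x, j}) = card X - 2" if "finite X" "x \<in> X" "j \<in> X - {x}" for X :: "'v set" and x j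
      using that by (rule card_remove_pair)
    have pos: "card A > 0" using False less.prems(1) by (simp add: card_gt_0_iff)
    have *: "card (matchings (X - {x, j})) = card (matchings (Y - {y, k}))"
      if "X \<in> {A, B}" "Y \<in> {A, B}" "x \<in> X" "j \<in> X - {x}" "y \<in> Y" "k \<in> Y - {y}" for X Y x y j k
      using that less.prems pos d by (intro less.hyps) auto
    show ?thesis
    proof (cases "A = {a}")
      case True
      then have "card B = 1" using less.prems by simp
      then have "B = {b}" using ab(2) by (metis card_1_singletonE singletonD)
      then show ?thesis using True c[of "{a}" a] c[of "{b}" b] by simp
    next
      case False
      then obtain j0 where j0: "j0 \<in> A - {a}" using ab by blast
      let ?c = "card (matchings (A - {a, j0}))"
      have "card (matchings A) = (\<Sum>j\<in>A - {a}. ?c)"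
        unfolding c[OF less.prems(1) ab(1)] by (intro sum.cong refl *) (use ab j0 in auto)
      moreover have "card (matchings B) = (\<Sum>j\<in>B - {b}. ?c)"
        unfolding c[OF less.prems(2) ab(2)] by (intro sum.cong refl *) (use ab j0 in auto)
      ultimately show ?thesis using ab less.prems by simp
    qed
  qed
qed

lemma card_matchings_rec:
  assumes "finite A" "a \<in> A" "j \<in> A - {a}"
  shows "card (matchings A) = (card A - 1) * card (matchings (A - {a, j}))"
proof -
  have "card (matchings A) = (\<Sum>k\<in>A - {a}. card (matchings (A - {a, k})))"
    using sum_matchings[OF assms(1,2), of "\<lambda>_. 1::nat"] by simp
  also have "\<dots> = (\<Sum>k\<in>A - {a}. card (matchings (A - {a, j})))"
    using assms by (intro sum.cong refl card_matchings_cong) (auto simp: card_remove_pair)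
  finally show ?thesis using assms by simp
qed

lemma matchings_nonempty:
  assumes "finite A" "even (card A)" shows "matchings A \<noteq> {}"
  using assms
proof (induction "card A" arbitrary: A rule: less_induct)
  case less
  show ?case
  proof (cases "A = {}")
    case False
    then obtain a where a: "a \<in> A" by blast
    have "A \<noteq> {a}" using less.prems by auto
    then obtain j where j: "j \<in> A - {a}" using a by blast
    have "card A \<ge> 2" using less.prems False by (metis card_gt_0_iff dvd_imp_le)
    moreover have "card (A - {a, j}) = card A - 2" using less.prems(1) a j by (rule card_remove_pair)
    ultimately have "matchings (A - {a, j}) \<noteq> {}" using less.prems by (intro less.hyps) auto
    then show ?thesis using matching_extend(1)[OF a j] by blast
  qed simp
qed

definition matching_avg :: "'v set \<Rightarrow> (('v \<Rightarrow> 'v) \<Rightarrow> 'b::real_normed_field) \<Rightarrow> 'b" where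
  "matching_avg A f = (\<Sum>\<pi>\<in>matchings A. f \<pi>) / of_nat (card (matchings A))"

lemma matching_avg_rec:
  assumes "finite A" "a \<in> A"
  shows "matching_avg A f = 
    (\<Sum>j\<in>A - {a}. matching_avg (A - {a, j}) (\<lambda>\<sigma>. f (\<sigma> \<circ> Transposition.transpose a j))) / of_nat (card A - 1)"
proof -
  have "(\<Sum>\<sigma>\<in>matchings (A - {a, j}). f (\<sigma> \<circ> Transposition.transpose a j)) / of_nat (card (matchings A)) =
      matching_avg (A - {a, j}) (\<lambda>\<sigma>. f (\<sigma> \<circ> Transposition.transpose a j)) / of_nat (card A - 1)" 
    if "j \<in> A - {a}" for j
    unfolding matching_avg_def card_matchings_rec[OF assms that] by (simp add: mult.commute)
  then show ?thesis
    unfolding matching_avg_def[of A] sum_matchings[OF assms] sum_divide_distrib by (intro sum.cong) auto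
qed

lemma matching_avg_cong:
  "(\<And>\<pi>. \<pi> \<in> matchings A \<Longrightarrow> f \<pi> = g \<pi>) \<Longrightarrow> matching_avg A f = matching_avg A g"
  unfolding matching_avg_def by (simp cong: sum.cong)

lemma matching_avg_cmult: "matching_avg A (\<lambda>\<pi>. c * f \<pi>) = c * matching_avg A f"
  unfolding matching_avg_def by (simp add: sum_distrib_left[symmetric])

lemma norm_matching_avg_le_1:
  assumes "finite A" "\<And>\<pi>. \<pi> \<in> matchings A \<Longrightarrow> norm (f \<pi>) \<le> 1"
  shows "norm (matching_avg A f) \<le> 1"
proof -
  have "norm (\<Sum>\<pi>\<in>matchings A. f \<pi>) \<le> (\<Sum>\<pi>\<in>matchings A. 1)" by (intro sum_norm_le assms(2))
  then have "norm (matching_avg A f) \<le> real (card (matchings A)) / real (card (matchings A))"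
    unfolding matching_avg_def norm_divide by (simp add: divide_right_mono)
  also have "\<dots> \<le> 1" by simp
  finally show ?thesis .
qed

definition matching_weight :: "('g \<Rightarrow> 'g \<Rightarrow> complex) \<Rightarrow> 'v set \<Rightarrow> ('v \<Rightarrow> 'g) \<Rightarrow> ('v \<Rightarrow> 'v) \<Rightarrow> complex" where
  "matching_weight \<beta> A g \<pi> = (\<Prod>i\<in>A. \<beta> (g i) (g (\<pi> i)))"

text \<open>The average over all perfect matchings of the product of \<open>\<beta> (g i) (g j) * \<beta> (g j) (g i)\<close> over the
edges \<open>{i, j}\<close>. The product over vertices in \<open>matching_weight\<close> picks up each edge from both ends.\<close>

definition mean_weight :: "('g \<Rightarrow> 'g \<Rightarrow> complex) \<Rightarrow> 'v set \<Rightarrow> ('v \<Rightarrow> 'g) \<Rightarrow> complex" where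
  "mean_weight \<beta> A g = matching_avg A (matching_weight \<beta> A g)"

lemma matching_weight_split:
  assumes "finite A" "a \<in> A" "\<pi> \<in> matchings A"
  shows "matching_weight \<beta> A g \<pi> = \<beta> (g a) (g (\<pi> a)) * \<beta> (g (\<pi> a)) (g a) *
    (\<Prod>i\<in>A - {a, \<pi> a}. \<beta> (g i) (g (\<pi> i)))"
proof -
  have j: "\<pi> a \<in> A - {a}" by (rule matching_restrict[OF assms(2,3)])
  have "\<pi> (\<pi> a) = a" using assms by (auto simp: matchings_def)
  moreover have "A - {a} - {\<pi> a} = A - {a, \<pi> a}" by auto
  ultimately show ?thesis unfolding matching_weight_def
    using assms j by (simp add: prod.remove[of A a] prod.remove[of "A - {a}" "\<pi> a"])
qed

lemma mean_weight_rec: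
  assumes "finite A" "a \<in> A"
  shows "mean_weight \<beta> A g = 
    (\<Sum>j\<in>A - {a}. \<beta> (g a) (g j) * \<beta> (g j) (g a) * mean_weight \<beta> (A - {a, j}) g) / of_nat (card A - 1)"
proof -
  have "matching_avg (A - {a, j}) (\<lambda>\<sigma>. matching_weight \<beta> A g (\<sigma> \<circ> Transposition.transpose a j)) =
      \<beta> (g a) (g j) * \<beta> (g j) (g a) * mean_weight \<beta> (A - {a, j}) g" if j: "j \<in> A - {a}" for j
    unfolding mean_weight_def matching_avg_cmult[symmetric]
  proof (rule matching_avg_cong)
    fix \<sigma> assume s: "\<sigma> \<in> matchings (A - {a, j})"
    note e = matching_extend[OF assms(2) j s]
    have "(\<Prod>i\<in>A - {a, j}. \<beta> (g i) (g ((\<sigma> \<circ> Transposition.transpose a j) i))) = matching_weight \<beta> (A - {a, j}) g \<sigma>"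
      unfolding matching_weight_def by (intro prod.cong refl) (use e(4) in auto)
    then show "matching_weight \<beta> A g (\<sigma> \<circ> Transposition.transpose a j) = 
        \<beta> (g a) (g j) * \<beta> (g j) (g a) * matching_weight \<beta> (A - {a, j}) g \<sigma>"
      unfolding matching_weight_split[OF assms e(1)] e(2) by simp
  qed
  then show ?thesis
    unfolding mean_weight_def[of _ A] matching_avg_rec[OF assms] by (intro arg_cong2[of _ _ _ _ "(/)"] sum.cong refl)
qed

lemma mean_weight_empty [simp]: "mean_weight \<beta> {} g = 1"
  by (simp add: mean_weight_def matching_avg_def matching_weight_def)

lemma mean_weight_cong:
  assumes "\<And>i. i \<in> A \<Longrightarrow> g i = h i" shows "mean_weight \<beta> A g = mean_weight \<beta> A h"
  unfolding mean_weight_def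
proof (rule matching_avg_cong)
  fix \<pi> assume "\<pi> \<in> matchings A"
  then have "\<pi> i \<in> A" if "i \<in> A" for i using that permutes_in_image[of \<pi> A] by (auto simp: matchings_def)
  then show "matching_weight \<beta> A g \<pi> = matching_weight \<beta> A h \<pi>"
    using assms by (simp add: matching_weight_def)
qed

lemma sum_PiE_remove:
  assumes "a \<in> A"
  shows "(\<Sum>g\<in>PiE A (\<lambda>_. X). F g) = (\<Sum>g\<in>PiE (A - {a}) (\<lambda>_. X). \<Sum>x\<in>X. F (g(a := x)))"
  unfolding sum.cartesian_product
proof (rule sum.reindex_bij_witness[of _ "\<lambda>(g, x). g(a := x)" "\<lambda>g. (g(a := undefined), g a)"], goal_cases)
  case (2 g)
  then show ?case using assms by (auto simp: PiE_def Pi_def extensional_def)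
next
  case (3 p)
  then have "fst p a = undefined" by (auto simp: PiE_def extensional_def)
  then show ?case by (auto simp: case_prod_beta fun_upd_idem prod_eq_iff)
next
  case (4 p)
  then show ?case using assms by (auto simp: PiE_def Pi_def extensional_def case_prod_beta)
qed auto

section \<open>Second moment of the mean weight\<close>

text \<open>A finite abelian group with a unitary bicharacter \<open>\<beta>\<close> whose symmetrization \<open>B\<close> is nondegenerate.
Only \<open>B\<close> enters into \<open>T\<close>, but the unsymmetrized \<open>\<beta>\<close> is what the Fourier expansion produces.\<close>

locale pairing = comm_group G for G (structure) +
  fixes \<beta> :: "'a \<Rightarrow> 'a \<Rightarrow> complex"
  assumes fin: "finite (carrier G)"
    and \<beta>_left: "\<lbrakk>x \<in> carrier G; y \<in> carrier G; z \<in> carrier G\<rbrakk> \<Longrightarrow> \<beta> (x \<otimes> y) z = \<beta> x z * \<beta> y z"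
    and \<beta>_right: "\<lbrakk>x \<in> carrier G; y \<in> carrier G; z \<in> carrier G\<rbrakk> \<Longrightarrow> \<beta> x (y \<otimes> z) = \<beta> x y * \<beta> x z"
    and norm_\<beta>: "\<lbrakk>x \<in> carrier G; y \<in> carrier G\<rbrakk> \<Longrightarrow> norm (\<beta> x y) = 1"
    and nondegenerate: "\<lbrakk>x \<in> carrier G; \<And>y. y \<in> carrier G \<Longrightarrow> \<beta> x y * \<beta> y x = 1\<rbrakk> \<Longrightarrow> x = \<one>"
begin

definition B where "B x y = \<beta> x y * \<beta> y x"

abbreviation T where "T \<equiv> mean_weight \<beta>"

abbreviation N where "N \<equiv> card (carrier G)"

lemma N_pos: "N > 0" using fin by (simp add: card_gt_0_iff) blast

lemma B_sym: "B x y = B y x" by (simp add: B_def)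

lemma B_left: "\<lbrakk>x \<in> carrier G; y \<in> carrier G; z \<in> carrier G\<rbrakk> \<Longrightarrow> B (x \<otimes> y) z = B x z * B y z"
  by (simp add: B_def \<beta>_left \<beta>_right)

lemma B_right: "\<lbrakk>x \<in> carrier G; y \<in> carrier G; z \<in> carrier G\<rbrakk> \<Longrightarrow> B z (x \<otimes> y) = B z x * B z y"
  by (simp add: B_def \<beta>_left \<beta>_right)

lemma norm_B: "\<lbrakk>x \<in> carrier G; y \<in> carrier G\<rbrakk> \<Longrightarrow> norm (B x y) = 1"
  by (simp add: B_def norm_\<beta> norm_mult)

lemma B_character: "y \<in> carrier G \<Longrightarrow> (\<lambda>x\<in>carrier G. B x y) \<in> characters G"
  by (auto simp: characters_def B_left norm_B)

lemma B_one: "y \<in> carrier G \<Longrightarrow> B \<one> y = 1" "y \<in> carrier G \<Longrightarrow> B y \<one> = 1"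
  using character_one[OF B_character, of y] B_sym[of y \<one>] by auto

lemma B_inv: 
  assumes "x \<in> carrier G" "y \<in> carrier G"
  shows "B (inv x) y = cnj (B x y)" "B y (inv x) = cnj (B y x)"
  using character_inv(2)[OF B_character[OF assms(2)] assms(1)] assms B_sym[of y x] B_sym[of y "inv x"] by auto

lemma sum_B:
  assumes "y \<in> carrier G"
  shows "(\<Sum>x\<in>carrier G. B x y) = (if y = \<one> then of_nat N else 0)"
proof (cases "y = \<one>")
  case False
  then obtain x where x: "x \<in> carrier G" "B y x \<noteq> 1" using nondegenerate[OF assms] unfolding B_def by blast
  have "(\<Sum>x\<in>carrier G. (\<lambda>x\<in>carrier G. B x y) x) = 0"
    by (rule sum_character[OF fin B_character[OF assms] x(1)]) (use x B_sym[of x y] in simp)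
  then show ?thesis using False by (simp cong: sum.cong)
qed (simp add: B_one cong: sum.cong)

lemma norm_T_le_1:
  assumes "finite A" "g \<in> A \<rightarrow> carrier G"
  shows "norm (T A g) \<le> 1"
  unfolding mean_weight_def
proof (rule norm_matching_avg_le_1[OF assms(1)])
  fix \<pi> assume "\<pi> \<in> matchings A"
  then have "\<pi> i \<in> A" if "i \<in> A" for i using that permutes_in_image[of \<pi> A] by (auto simp: matchings_def)
  then show "norm (matching_weight \<beta> A g \<pi>) \<le> 1"
    unfolding matching_weight_def prod_norm[symmetric]
    using assms(2) by (intro prod_le_1) (auto simp: norm_\<beta> Pi_iff)
qed

lemma T_rec:
  assumes "finite A" "a \<in> A"
  shows "T A g = (\<Sum>j\<in>A - {a}. B (g a) (g j) * T (A - {a, j}) g) / of_nat (card A - 1)"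
  unfolding B_def by (rule mean_weight_rec[OF assms])

text \<open>Translating all values by \<open>c\<close> multiplies the weight of each matching by the same phase, since a
matching permutes the vertices.\<close>

lemma norm_T_translate:
  assumes "finite A" "g \<in> A \<rightarrow> carrier G" "c \<in> carrier G"
  shows "norm (T A (\<lambda>i. c \<otimes> g i)) = norm (T A g)"
proof -
  let ?p = "\<Prod>i\<in>A. \<beta> c c * \<beta> c (g i) * \<beta> (g i) c"
  have "matching_weight \<beta> A (\<lambda>i. c \<otimes> g i) \<pi> = ?p * matching_weight \<beta> A g \<pi>" if "\<pi> \<in> matchings A" for \<pi>
  proof -
    have p: "\<pi> permutes A" using that by (simp add: matchings_def)
    then have cl: "\<pi> i \<in> A" if "i \<in> A" for i using that permutes_in_image[of \<pi> A] by auto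
    have "matching_weight \<beta> A (\<lambda>i. c \<otimes> g i) \<pi> = 
      (\<Prod>i\<in>A. (\<beta> c c * \<beta> (g i) c) * \<beta> c (g (\<pi> i)) * \<beta> (g i) (g (\<pi> i)))"
      unfolding matching_weight_def
      using assms cl by (intro prod.cong refl) (auto simp: Pi_iff \<beta>_left \<beta>_right)
    also have "\<dots> = (\<Prod>i\<in>A. \<beta> c c * \<beta> (g i) c) * (\<Prod>i\<in>A. \<beta> c (g (\<pi> i))) * matching_weight \<beta> A g \<pi>"
      by (simp add: prod.distrib matching_weight_def)
    also have "(\<Prod>i\<in>A. \<beta> c (g (\<pi> i))) = (\<Prod>i\<in>A. \<beta> c (g i))"
      using prod.permute[OF p, of "\<lambda>i. \<beta> c (g i)"] by (simp add: o_def)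
    finally show ?thesis by (simp add: prod.distrib mult_ac)
  qed
  then have "T A (\<lambda>i. c \<otimes> g i) = ?p * T A g"
    unfolding mean_weight_def matching_avg_cmult[symmetric] by (rule matching_avg_cong)
  moreover have "norm ?p = 1"
    unfolding prod_norm[symmetric] using assms by (intro prod.neutral) (auto simp: norm_mult norm_\<beta> Pi_iff)
  ultimately show ?thesis by (simp add: norm_mult)
qed

text \<open>Parseval for the characters \<open>B _ (h j)\<close>. Indices with equal \<open>h j\<close> interfere, and the
Cauchy-Schwarz inequality bounds their interference by their number.\<close>

lemma parseval_bound:
  assumes J: "finite J" and h: "h \<in> J \<rightarrow> carrier G"
  shows "(\<Sum>x\<in>carrier G. (norm (\<Sum>j\<in>J. B x (h j) * t j))\<^sup>2) \<le>
     real N * (\<Sum>j\<in>J. real (card {k\<in>J. h k = h j}) * (norm (t j))\<^sup>2)" (is "?L \<le> ?R")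
proof -
  have cl: "h j \<in> carrier G" if "j \<in> J" for j using h that by auto
  have "of_real ?L = (\<Sum>x\<in>carrier G. (\<Sum>j\<in>J. B x (h j) * t j) * cnj (\<Sum>k\<in>J. B x (h k) * t k))"
    by (simp only: of_real_sum complex_norm_square)
  also have "\<dots> = (\<Sum>x\<in>carrier G. \<Sum>j\<in>J. \<Sum>k\<in>J. t j * cnj (t k) * B x (h j \<otimes> inv (h k)))"
    using cl by (intro sum.cong refl) (simp add: sum_product B_right B_inv mult_ac)
  also have "\<dots> = (\<Sum>j\<in>J. \<Sum>k\<in>J. t j * cnj (t k) * (\<Sum>x\<in>carrier G. B x (h j \<otimes> inv (h k))))"
    unfolding sum_distrib_left by (subst sum.swap, rule sum.cong[OF refl], rule sum.swap)
  also have "\<dots> = (\<Sum>j\<in>J. \<Sum>k\<in>J. t j * cnj (t k) * of_nat (if h k = h j then N else 0))"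
  proof (intro sum.cong refl arg_cong2[of _ _ _ _ "(*)"])
    fix j k assume "j \<in> J" "k \<in> J"
    then have "h j \<otimes> inv (h k) = \<one> \<longleftrightarrow> h k = h j"
      using cl by (metis inv_closed inv_equality inv_inv r_inv)
    then show "(\<Sum>x\<in>carrier G. B x (h j \<otimes> inv (h k))) = of_nat (if h k = h j then N else 0)"
      using cl \<open>j \<in> J\<close> \<open>k \<in> J\<close> by (subst sum_B) auto
  qed
  finally have eq: "of_real ?L = (\<Sum>j\<in>J. \<Sum>k\<in>J. t j * cnj (t k) * of_nat (if h k = h j then N else 0))" .
  have "\<bar>?L\<bar> = norm (complex_of_real ?L)" by (rule norm_of_real[symmetric])
  also have "\<dots> = norm (\<Sum>j\<in>J. \<Sum>k\<in>J. t j * cnj (t k) * of_nat (if h k = h j then N else 0))"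
    by (simp only: eq)
  also have "\<dots> \<le> (\<Sum>j\<in>J. \<Sum>k\<in>J. norm (t j) * norm (t k) * real (if h k = h j then N else 0))"
    by (rule order.trans[OF norm_sum] sum_mono)+ (simp add: norm_mult)
  also have "\<dots> \<le> (\<Sum>j\<in>J. \<Sum>k\<in>J. ((norm (t j))\<^sup>2 + (norm (t k))\<^sup>2) / 2 * real (if h k = h j then N else 0))"
  proof (intro sum_mono mult_right_mono)
    fix j k show "norm (t j) * norm (t k) \<le> ((norm (t j))\<^sup>2 + (norm (t k))\<^sup>2) / 2"
      using sum_squares_bound[of "norm (t j)" "norm (t k)"] by simp
  qed auto
  also have "\<dots> = (\<Sum>j\<in>J. \<Sum>k\<in>J. (norm (t j))\<^sup>2 / 2 * real (if h k = h j then N else 0)) +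
      (\<Sum>j\<in>J. \<Sum>k\<in>J. (norm (t k))\<^sup>2 / 2 * real (if h k = h j then N else 0))"
    unfolding sum.distrib[symmetric] by (intro sum.cong refl) (simp add: field_simps)
  also have "(\<Sum>j\<in>J. \<Sum>k\<in>J. (norm (t k))\<^sup>2 / 2 * real (if h k = h j then N else 0)) =
      (\<Sum>j\<in>J. \<Sum>k\<in>J. (norm (t j))\<^sup>2 / 2 * real (if h k = h j then N else 0))"
    by (subst sum.swap) (intro sum.cong refl, auto)
  also have "(\<Sum>j\<in>J. \<Sum>k\<in>J. (norm (t j))\<^sup>2 / 2 * real (if h k = h j then N else 0)) =
      (\<Sum>j\<in>J. (norm (t j))\<^sup>2 / 2 * (real (card {k\<in>J. h k = h j}) * real N))"
  proof (intro sum.cong refl)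
    fix j
    have "(\<Sum>k\<in>J. real (if h k = h j then N else 0)) = (\<Sum>k\<in>{k\<in>J. h k = h j}. real N)"
      using J by (subst sum.inter_filter) (auto intro!: sum.cong)
    then show "(\<Sum>k\<in>J. (norm (t j))\<^sup>2 / 2 * real (if h k = h j then N else 0)) =
       (norm (t j))\<^sup>2 / 2 * (real (card {k\<in>J. h k = h j}) * real N)"
      unfolding sum_distrib_left[symmetric] by simp
  qed
  also have "(\<Sum>j\<in>J. (norm (t j))\<^sup>2 / 2 * (real (card {k\<in>J. h k = h j}) * real N)) +
      (\<Sum>j\<in>J. (norm (t j))\<^sup>2 / 2 * (real (card {k\<in>J. h k = h j}) * real N)) = ?R"
    unfolding sum_distrib_left sum.distrib[symmetric] by (intro sum.cong refl) simp
  finally show ?thesis by simp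
qed

text \<open>Pair off one vertex \<open>a\<close>. As a function of the value at \<open>a\<close>, \<open>T\<close> is a combination of the
characters given by the values of the possible partners \<open>j\<close>, so Parseval bounds the sum over the
value at \<open>a\<close>. Summing over the value at \<open>j\<close> next, the multiplicities add up to
\<open>N + 2 * m\<close>, and the induction hypothesis applies to the vertices other than \<open>a\<close> and \<open>j\<close>.\<close>

lemma second_moment:
  assumes "finite A" "card A = 2 * m"
  shows "(\<Sum>g\<in>PiE A (\<lambda>_. carrier G). (norm (T A g))\<^sup>2) \<le>
    real N ^ m * (\<Prod>i<m. (real N + 2 * real i) / (2 * real i + 1))"
  using assms
proof (induction m arbitrary: A)
  case 0
  then show ?case by simp
next
  case (Suc m)
  then obtain a where a: "a \<in> A" by fastforce
  let ?A = "A - {a}"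
  let ?P = "real N ^ m * (\<Prod>i<m. (real N + 2 * real i) / (2 * real i + 1))"
  have cA: "card ?A = 2 * m + 1" and fA: "finite ?A" using Suc.prems a by auto
  have 1: "(\<Sum>x\<in>carrier G. (norm (T A (g(a := x))))\<^sup>2) \<le>
     real N / (2 * real m + 1)\<^sup>2 * (\<Sum>j\<in>?A. real (card {k\<in>?A. g k = g j}) * (norm (T (?A - {j}) g))\<^sup>2)"
    if g: "g \<in> PiE ?A (\<lambda>_. carrier G)" for g
  proof -
    have "T A (g(a := x)) = (\<Sum>j\<in>?A. B x (g j) * T (?A - {j}) g) / of_nat (2 * m + 1)" for x
    proof -
      have "T (A - {a, j}) (g(a := x)) = T (?A - {j}) g" for j
        by (subst Diff_insert2[symmetric]) (rule mean_weight_cong, auto)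
      then show ?thesis
        unfolding T_rec[OF Suc.prems(1) a] using Suc.prems(2)
        by (intro arg_cong2[of _ _ _ _ "(/)"] sum.cong) auto
    qed
    then have "(norm (T A (g(a := x))))\<^sup>2 = (norm (\<Sum>j\<in>?A. B x (g j) * T (?A - {j}) g))\<^sup>2 / (2 * real m + 1)\<^sup>2" for x
      by (simp add: norm_divide power_divide flip: of_nat_Suc of_nat_mult)
    then have "(\<Sum>x\<in>carrier G. (norm (T A (g(a := x))))\<^sup>2) =
       (\<Sum>x\<in>carrier G. (norm (\<Sum>j\<in>?A. B x (g j) * T (?A - {j}) g))\<^sup>2) / (2 * real m + 1)\<^sup>2"
      by (simp add: sum_divide_distrib)
    also have "\<dots> \<le> (real N * (\<Sum>j\<in>?A. real (card {k\<in>?A. g k = g j}) * (norm (T (?A - {j}) g))\<^sup>2)) / (2 * real m + 1)\<^sup>2"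
      using g by (intro divide_right_mono parseval_bound[OF fA]) auto
    finally show ?thesis by simp
  qed
  have 2: "(\<Sum>g\<in>PiE ?A (\<lambda>_. carrier G). real (card {k\<in>?A. g k = g j}) * (norm (T (?A - {j}) g))\<^sup>2) \<le>
     (real N + 2 * real m) * ?P" if j: "j \<in> ?A" for j
  proof -
    let ?J = "?A - {j}"
    have cJ: "card ?J = 2 * m" and fJ: "finite ?J" using cA j fA by auto
    have "(\<Sum>y\<in>carrier G. real (card {k\<in>?A. (g(j := y)) k = (g(j := y)) j}) * (norm (T ?J (g(j := y))))\<^sup>2) =
       (real N + 2 * real m) * (norm (T ?J g))\<^sup>2" if g: "g \<in> PiE ?J (\<lambda>_. carrier G)" for g
    proof -
      have t: "T ?J (g(j := y)) = T ?J g" for y by (rule mean_weight_cong) auto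
      have c: "card {k\<in>?A. (g(j := y)) k = (g(j := y)) j} = 1 + card {k\<in>?J. g k = y}" for y
      proof -
        have "{k\<in>?A. (g(j := y)) k = (g(j := y)) j} = insert j {k\<in>?J. g k = y}" using j by auto
        then show ?thesis using fJ by simp
      qed
      have "(\<Sum>y\<in>carrier G. card {k\<in>?J. g k = y}) = card ?J"
        using sum_fun_comp[of ?J "carrier G" g "\<lambda>_. 1::nat"] fJ fin g by (simp add: image_subset_iff PiE_iff)
      then have "(\<Sum>y\<in>carrier G. real (1 + card {k\<in>?J. g k = y})) = real N + 2 * real m"
        unfolding of_nat_sum[symmetric] sum.distrib using cJ by simp
      then show ?thesis unfolding t c by (simp only: sum_distrib_right[symmetric])
    qed
    then have "(\<Sum>g\<in>PiE ?A (\<lambda>_. carrier G). real (card {k\<in>?A. g k = g j}) * (norm (T ?J g))\<^sup>2) =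
       (real N + 2 * real m) * (\<Sum>g\<in>PiE ?J (\<lambda>_. carrier G). (norm (T ?J g))\<^sup>2)"
      unfolding sum_PiE_remove[OF j] sum_distrib_left by (intro sum.cong refl)
    also have "\<dots> \<le> (real N + 2 * real m) * ?P"
      by (intro mult_left_mono Suc.IH fJ cJ) auto
    finally show ?thesis .
  qed
  have "(\<Sum>g\<in>PiE A (\<lambda>_. carrier G). (norm (T A g))\<^sup>2) \<le>
     (\<Sum>g\<in>PiE ?A (\<lambda>_. carrier G). real N / (2 * real m + 1)\<^sup>2 *
        (\<Sum>j\<in>?A. real (card {k\<in>?A. g k = g j}) * (norm (T (?A - {j}) g))\<^sup>2))"
    unfolding sum_PiE_remove[OF a] by (intro sum_mono 1)
  also have "\<dots> = real N / (2 * real m + 1)\<^sup>2 * (\<Sum>j\<in>?A. \<Sum>g\<in>PiE ?A (\<lambda>_. carrier G).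
        real (card {k\<in>?A. g k = g j}) * (norm (T (?A - {j}) g))\<^sup>2)"
    unfolding sum_distrib_left[symmetric] by (subst sum.swap) (rule refl)
  also have "\<dots> \<le> real N / (2 * real m + 1)\<^sup>2 * (\<Sum>j\<in>?A. (real N + 2 * real m) * ?P)"
    by (intro mult_left_mono sum_mono 2) auto
  also have "\<dots> = real N * ((real N + 2 * real m) / (2 * real m + 1)) * ?P"
  proof -
    have "x / q\<^sup>2 * (q * (c * p)) = x * (c / q) * p" if "q \<noteq> 0" for x q c p :: real
      using that by (simp add: power2_eq_square)
    from this[of "2 * real m + 1"] show ?thesis using cA by (simp add: add.commute)
  qed
  also have "\<dots> = real N ^ Suc m * (\<Prod>i<Suc m. (real N + 2 * real i) / (2 * real i + 1))"
    by (simp add: field_simps)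
  finally show ?case .
qed

text \<open>On average the square of \<open>T\<close> is as small as \<open>N powr (- card A / 2)\<close> up to a polynomial factor.
Any exponential gain in the size of \<open>T\<close> therefore beats the number of assignments.\<close>

lemma second_moment_poly:
  assumes "finite A" "card A = 2 * m"
  shows "(\<Sum>g\<in>PiE A (\<lambda>_. carrier G). (norm (T A g))\<^sup>2) \<le> real N ^ m * real (m + 1) ^ N"
proof -
  (* The right-hand product telescopes; the factors compare by Bernoulli's inequality. *)
  have "(\<Prod>i<m. (real N + 2 * real i) / (2 * real i + 1)) \<le> (\<Prod>i<m. (real (i + 2) / real (i + 1)) ^ N)"
  proof (intro prod_mono conjI)
    fix i
    have "(real N + 2 * real i) / (2 * real i + 1) = 1 + (real N - 1) / (2 * real i + 1)"
      by (simp add: field_simps)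
    also have "\<dots> \<le> 1 + real N * (1 / real (i + 1))"
      using N_pos by (simp add: frac_le)
    also have "\<dots> \<le> (1 + 1 / real (i + 1)) ^ N"
      by (rule Bernoulli_inequality) (simp add: field_simps)
    also have "1 + 1 / real (i + 1) = real (i + 2) / real (i + 1)" by (simp add: field_simps)
    finally show "(real N + 2 * real i) / (2 * real i + 1) \<le> (real (i + 2) / real (i + 1)) ^ N" .
  qed auto
  also have "\<dots> = (\<Prod>i<m. real (i + 2) / real (i + 1)) ^ N" by (simp add: prod_power_distrib)
  also have "(\<Prod>i<m. real (i + 2) / real (i + 1)) = real (m + 1)"
    by (induction m) (auto simp: field_simps)
  finally show ?thesis
    using second_moment[OF assms] mult_left_mono[of _ _ "real N ^ m"] order.trans by fastforce
qed

section \<open>Exponential decay by exposing two partners\<close>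

text \<open>Choose the partners \<open>y\<close> of \<open>i\<close> and \<open>z\<close> of \<open>i'\<close>. Exchanging \<open>y\<close> and \<open>z\<close> leaves the same
remaining vertices, so the two phases can be averaged before absolute values are taken.\<close>

lemma T_two_step:
  assumes A: "finite A" and i: "i \<in> A" "i' \<in> A" "i \<noteq> i'" and g: "g \<in> A \<rightarrow> carrier G" and n: "card A \<ge> 4"
  defines "A2 \<equiv> A - {i, i'}"
  shows "norm (T A g) \<le> (norm (T A2 g) + (\<Sum>y\<in>A2. \<Sum>z\<in>A2 - {y}.
      norm (B (g i) (g y) * B (g i') (g z) + B (g i) (g z) * B (g i') (g y)) / 2 * norm (T (A2 - {y, z}) g)) /
      (real (card A) - 3)) / (real (card A) - 1)"
proof -
  let ?F = "\<lambda>y z. B (g i) (g y) * B (g i') (g z) * T (A2 - {y, z}) g"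
  let ?w = "\<lambda>y z. (B (g i) (g y) * B (g i') (g z) + B (g i) (g z) * B (g i') (g y)) / 2"
  have fA2: "finite A2" using A by (simp add: A2_def)
  have Ai: "A - {i} = insert i' A2" "i' \<notin> A2" using i by (auto simp: A2_def)
  have 1: "T (A - {i, y}) g = (\<Sum>z\<in>A2 - {y}. B (g i') (g z) * T (A2 - {y, z}) g) / of_nat (card A - 3)"
    if y: "y \<in> A2" for y
  proof -
    have c: "card (A - {i, y}) = card A - 2" using A i y by (intro card_remove_pair) (auto simp: A2_def)
    have s: "A - {i, y} - {i'} = A2 - {y}" "A - {i, y} - {i', z} = A2 - {y, z}" for z by (auto simp: A2_def)
    have "i' \<in> A - {i, y}" using i y by (auto simp: A2_def)
    from T_rec[OF _ this, of g] show ?thesis using A n unfolding s c by simp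
  qed
  have "(\<Sum>y\<in>A2. B (g i) (g y) * T (A - {i, y}) g) = (\<Sum>y\<in>A2. \<Sum>z\<in>A2 - {y}. ?F y z) / of_nat (card A - 3)"
    unfolding sum_divide_distrib by (intro sum.cong refl) (simp add: 1 sum_distrib_left mult_ac sum_divide_distrib)
  moreover have sw: "(\<Sum>y\<in>A2. \<Sum>z\<in>A2 - {y}. ?F y z) = (\<Sum>y\<in>A2. \<Sum>z\<in>A2 - {y}. ?F z y)"
    unfolding sum.Sigma[OF fA2 ballI[OF finite_Diff[OF fA2]]]
    by (rule sum.reindex_bij_witness[of _ "\<lambda>(y, z). (z, y)" "\<lambda>(y, z). (z, y)"]) auto
  moreover have "(\<Sum>y\<in>A2. \<Sum>z\<in>A2 - {y}. ?F y z) = (\<Sum>y\<in>A2. \<Sum>z\<in>A2 - {y}. ?w y z * T (A2 - {y, z}) g)"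
  proof -
    have "(\<Sum>y\<in>A2. \<Sum>z\<in>A2 - {y}. ?w y z * T (A2 - {y, z}) g) = 
      ((\<Sum>y\<in>A2. \<Sum>z\<in>A2 - {y}. ?F y z) + (\<Sum>y\<in>A2. \<Sum>z\<in>A2 - {y}. ?F z y)) / 2"
      unfolding sum.distrib[symmetric] sum_divide_distrib
      by (intro sum.cong refl) (simp add: field_simps insert_commute)
    then show ?thesis using sw by simp
  qed
  ultimately have TA: "T A g = (B (g i) (g i') * T A2 g + (\<Sum>y\<in>A2. \<Sum>z\<in>A2 - {y}. ?w y z * T (A2 - {y, z}) g) /
      of_nat (card A - 3)) / of_nat (card A - 1)"
    unfolding T_rec[OF A i(1)] Ai(1) using Ai(2) fA2 by (simp add: A2_def)
  have "norm (T A g) = norm (B (g i) (g i') * T A2 g + (\<Sum>y\<in>A2. \<Sum>z\<in>A2 - {y}. ?w y z * T (A2 - {y, z}) g) /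
      of_nat (card A - 3)) / (real (card A) - 1)"
    unfolding TA norm_divide norm_of_nat using n by (simp add: of_nat_diff)
  also have "\<dots> \<le> (norm (T A2 g) + (\<Sum>y\<in>A2. \<Sum>z\<in>A2 - {y}. norm (?w y z) * norm (T (A2 - {y, z}) g)) /
      (real (card A) - 3)) / (real (card A) - 1)"
  proof -
    have s1: "norm (B (g i) (g i') * T A2 g) \<le> norm (T A2 g)"
    proof -
      have "norm (B (g i) (g i')) = 1" using g i by (intro norm_B) auto
      then show ?thesis by (simp only: norm_mult mult_1_left order_refl)
    qed
    have "norm (\<Sum>y\<in>A2. \<Sum>z\<in>A2 - {y}. ?w y z * T (A2 - {y, z}) g) \<le>
       (\<Sum>y\<in>A2. \<Sum>z\<in>A2 - {y}. norm (?w y z) * norm (T (A2 - {y, z}) g))"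
      by (intro sum_norm_le) (simp add: norm_mult)
    then have s2: "norm ((\<Sum>y\<in>A2. \<Sum>z\<in>A2 - {y}. ?w y z * T (A2 - {y, z}) g) / of_nat (card A - 3)) \<le>
      (\<Sum>y\<in>A2. \<Sum>z\<in>A2 - {y}. norm (?w y z) * norm (T (A2 - {y, z}) g)) / (real (card A) - 3)"
      unfolding norm_divide norm_of_nat using n by (simp add: of_nat_diff divide_right_mono)
    show ?thesis
      by (rule divide_right_mono[OF order.trans[OF norm_triangle_ineq add_mono[OF s1 s2]]]) (use n in simp)
  qed
  finally show ?thesis by (simp add: norm_divide)
qed

text \<open>If four values \<open>a\<close>, \<open>b\<close>, \<open>c\<close>, \<open>d\<close> occur often and the differences of \<open>a, b\<close> and of \<open>c, d\<close> do not
annihilate each other, then exposing the partners of one vertex of value \<open>a\<close> and one of value \<open>b\<close>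
meets \<open>c\<close> and \<open>d\<close> with positive probability, where the average in \<open>T_two_step\<close> is smaller than 1.
Each round of exposure gains the same factor.\<close>

lemma norm_T_far:
  assumes abcd: "{a, b, c, d} \<subseteq> carrier G" and \<rho>: "norm (1 + B (a \<otimes> inv b) (c \<otimes> inv d)) \<le> 2 * \<rho>" "\<rho> < 1"
    and s: "0 \<le> s" "s \<le> n0"
  assumes "finite A" "even (card A)" "real (card A) \<le> n0" "g \<in> A \<rightarrow> carrier G"
    "\<And>v. v \<in> {a, b, c, d} \<Longrightarrow> real (card {i\<in>A. g i = v}) \<ge> 4 * real j + s"
  shows "norm (T A g) \<le> (1 - (1 - \<rho>) * (s / n0)\<^sup>2) ^ j"
  using assms(6-)
proof (induction j arbitrary: A)
  case 0
  then show ?case using norm_T_le_1[of A g] by simp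
next
  case (Suc j)
  let ?\<kappa> = "1 - (1 - \<rho>) * (s / n0)\<^sup>2"
  define m where "m v = card {i\<in>A. g i = v}" for v
  have m: "real (m v) \<ge> 4 * real j + 4 + s" if "v \<in> {a, b, c, d}" for v
    using Suc.prems(5)[OF that] by (simp add: m_def)
  have \<rho>0: "\<rho> \<ge> 0" using \<rho>(1) norm_ge_zero[of "1 + B (a \<otimes> inv b) (c \<otimes> inv d)"] by linarith
  have n0: "n0 > 0"
  proof -
    have "0 < real (m a)" using m[of a] s by simp
    moreover have "m a \<le> card A" unfolding m_def using Suc.prems by (intro card_mono) auto
    ultimately show ?thesis using Suc.prems(3) by linarith
  qed
  have \<kappa>0: "0 \<le> ?\<kappa>"
  proof -
    have "(s / n0)\<^sup>2 \<le> 1" using s n0 by (simp add: power_le_one)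
    then have "(1 - \<rho>) * (s / n0)\<^sup>2 \<le> 1 * 1" using \<rho> \<rho>0 by (intro mult_mono) auto
    then show ?thesis by simp
  qed
  have ne: "a \<noteq> b" "c \<noteq> d"
    using \<rho> abcd by (auto simp: B_one)
  have ex: "\<exists>i\<in>A. g i = v" if "v \<in> {a, b, c, d}" for v
  proof -
    have "m v \<noteq> 0" using m[OF that] s by linarith
    then show ?thesis unfolding m_def by (metis (mono_tags, lifting) card.empty empty_Collect_eq)
  qed
  obtain i i' where i: "i \<in> A" "g i = a" "i' \<in> A" "g i' = b" using ex[of a] ex[of b] by auto
  have ii: "i \<noteq> i'" using i ne by auto
  define A2 where "A2 = A - {i, i'}"
  have fA: "finite A" and fA2: "finite A2" using Suc.prems by (auto simp: A2_def)
  let ?n = "real (card A)"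
  have n4: "card A \<ge> 4"
  proof -
    have "m a \<le> card A" unfolding m_def using Suc.prems by (intro card_mono) auto
    moreover have "real (m a) \<ge> 4" using m[of a] s by simp
    ultimately show ?thesis by linarith
  qed
  have cA2: "card A2 = card A - 2" unfolding A2_def using fA i ii by (intro card_remove_pair) auto
  (* Two rounds of the exposure remove at most four vertices, and this costs each of the four values
     at most the four occurrences by which the hypothesis for \<open>Suc j\<close> exceeds that for \<open>j\<close>. *)
  have sub: "norm (T X g) \<le> ?\<kappa> ^ j" if "X \<subseteq> A" "even (card X)" "card (A - X) \<le> 4" for X
  proof (rule Suc.IH)
    have "card X \<le> card A" using that fA by (intro card_mono)
    then show "real (card X) \<le> n0" using Suc.prems(3) by linarith
    fix v assume v: "v \<in> {a, b, c, d}"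
    have "{i\<in>A. g i = v} \<subseteq> {i\<in>X. g i = v} \<union> (A - X)" by auto
    then have "m v \<le> card ({i\<in>X. g i = v} \<union> (A - X))" unfolding m_def using that fA
      by (intro card_mono) (auto intro: finite_subset)
    also have "\<dots> \<le> card {i\<in>X. g i = v} + card (A - X)" by (rule card_Un_le)
    finally show "4 * real j + s \<le> real (card {i\<in>X. g i = v})" using that(3) m[OF v] by linarith
  qed (use that fA Suc.prems in \<open>auto intro: finite_subset\<close>)
  have 1: "norm (T A2 g) \<le> ?\<kappa> ^ j"
  proof (rule sub)
    show "even (card A2)" using cA2 Suc.prems n4 by simp
    have "A - A2 \<subseteq> {i, i'}" by (auto simp: A2_def)
    then have "card (A - A2) \<le> card {i, i'}" by (intro card_mono) auto
    then show "card (A - A2) \<le> 4" using card_insert_le_m1[of 2 "{i'}" i] by simp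
  qed (auto simp: A2_def)
  have 2: "norm (T (A2 - {y, z}) g) \<le> ?\<kappa> ^ j" if yz: "y \<in> A2" "z \<in> A2 - {y}" for y z
  proof (rule sub)
    have c: "card (A2 - {y, z}) = card A - 4" using card_remove_pair[OF fA2 yz] cA2 by simp
    then show "even (card (A2 - {y, z}))" using Suc.prems n4 by simp
    show "card (A - (A2 - {y, z})) \<le> 4" using c fA n4
      by (subst card_Diff_subset) (auto simp: A2_def)
  qed (auto simp: A2_def)
  define w where "w y z = norm (B (g i) (g y) * B (g i') (g z) + B (g i) (g z) * B (g i') (g y)) / 2" for y z
  have gA: "g y \<in> carrier G" if "y \<in> A" for y using that Suc.prems by auto
  (* The cancellation: for partners of values \<open>c\<close> and \<open>d\<close> the two orders of pairing contribute phases
     whose ratio is \<open>B (a \<otimes> inv b) (c \<otimes> inv d)\<close>. *)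
  have w1: "w y z \<le> 1 - (1 - \<rho>) * (if g y = c \<and> g z = d then 1 else 0)" if "y \<in> A2" "z \<in> A2" for y z
  proof (cases "g y = c \<and> g z = d")
    case True
    have cl: "a \<in> carrier G" "b \<in> carrier G" "c \<in> carrier G" "d \<in> carrier G" using abcd by auto
    let ?u = "B a d * B b c"
    have "norm ?u = 1" using cl by (simp add: norm_mult norm_B)
    have u: "cnj (B a d) * B a d = 1" "cnj (B b c) * B b c = 1"
      using norm_B[OF cl(1,4)] norm_B[OF cl(2,3)] by (simp_all add: mult.commute flip: complex_norm_square)
    have "B (a \<otimes> inv b) (c \<otimes> inv d) * ?u = B a c * B b d * (cnj (B a d) * B a d) * (cnj (B b c) * B b c)"
      using cl by (simp add: B_left B_right B_inv mult_ac)
    then have "B (a \<otimes> inv b) (c \<otimes> inv d) * ?u = B a c * B b d" using u by simp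
    then have "w y z = norm ((1 + B (a \<otimes> inv b) (c \<otimes> inv d)) * ?u) / 2"
      using True i by (simp add: w_def algebra_simps)
    also have "\<dots> \<le> \<rho>" using \<rho>(1) \<open>norm ?u = 1\<close> by (simp only: norm_mult)
    finally show ?thesis using True by simp
  next
    case False
    have "norm (B (g i) (g y) * B (g i') (g z) + B (g i) (g z) * B (g i') (g y)) \<le>
       norm (B (g i) (g y) * B (g i') (g z)) + norm (B (g i) (g z) * B (g i') (g y))"
      by (rule norm_triangle_ineq)
    also have "\<dots> = 2" using that i gA by (auto simp: norm_mult norm_B A2_def)
    finally show ?thesis using False by (auto simp: w_def)
  qed
  have m2: "real (card {y\<in>A2. g y = v}) \<ge> s" if v: "v \<in> {c, d}" for v
  proof -
    have "{i\<in>A. g i = v} \<subseteq> {y\<in>A2. g y = v} \<union> {i, i'}" by (auto simp: A2_def)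
    then have "m v \<le> card ({y\<in>A2. g y = v} \<union> {i, i'})" unfolding m_def using fA2
      by (intro card_mono) auto
    also have "\<dots> \<le> card {y\<in>A2. g y = v} + card {i, i'}" by (rule card_Un_le)
    finally have "m v \<le> card {y\<in>A2. g y = v} + 2" using ii by simp
    then show ?thesis using m[of v] v by auto
  qed
  have "(\<Sum>y\<in>A2. \<Sum>z\<in>A2 - {y}. w y z) \<le> (?n - 2) * (?n - 3) - (1 - \<rho>) * s\<^sup>2"
  proof -
    have "(\<Sum>y\<in>A2. \<Sum>z\<in>A2 - {y}. w y z) \<le>
       (\<Sum>y\<in>A2. \<Sum>z\<in>A2 - {y}. 1 - (1 - \<rho>) * (if g y = c \<and> g z = d then 1 else 0))"
      by (intro sum_mono w1) auto
    also have "\<dots> = (\<Sum>y\<in>A2. \<Sum>z\<in>A2 - {y}. 1) - (1 - \<rho>) * (\<Sum>y\<in>A2. \<Sum>z\<in>A2 - {y}. (if g y = c \<and> g z = d then 1 else 0))"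
      by (simp only: sum_subtractf sum_distrib_left)
    also have "(\<Sum>y\<in>A2. \<Sum>z\<in>A2 - {y}. (1::real)) = (?n - 2) * (?n - 3)"
      using cA2 n4 fA2 by (simp add: of_nat_diff)
    also have "(\<Sum>y\<in>A2. \<Sum>z\<in>A2 - {y}. (if g y = c \<and> g z = d then 1 else 0)) =
       (\<Sum>y\<in>A2. \<Sum>z\<in>A2. (if g y = c then 1 else 0) * (if g z = d then 1 else (0::real)))"
      using fA2 ne by (intro sum.cong refl sum.mono_neutral_cong_left) auto
    also have "\<dots> = (\<Sum>y\<in>A2. if g y = c then 1 else 0) * (\<Sum>z\<in>A2. if g z = d then 1 else 0)"
      by (simp only: sum_product)
    also have "\<dots> = real (card {y\<in>A2. g y = c}) * real (card {y\<in>A2. g y = d})"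
      using fA2 by (simp flip: sum.inter_filter)
    also have "(?n - 2) * (?n - 3) - (1 - \<rho>) * (real (card {y\<in>A2. g y = c}) * real (card {y\<in>A2. g y = d})) \<le>
        (?n - 2) * (?n - 3) - (1 - \<rho>) * s\<^sup>2"
      unfolding power2_eq_square using s \<rho> m2[of c] m2[of d]
      by (intro diff_left_mono mult_left_mono mult_mono) auto
    finally show ?thesis .
  qed
  then have 3: "1 + (\<Sum>y\<in>A2. \<Sum>z\<in>A2 - {y}. w y z) / (?n - 3) \<le> 1 + ((?n - 2) * (?n - 3) - (1 - \<rho>) * s\<^sup>2) / (?n - 3)"
    using n4 by (intro add_left_mono divide_right_mono) auto
  have "norm (T A g) \<le> (norm (T A2 g) + (\<Sum>y\<in>A2. \<Sum>z\<in>A2 - {y}. w y z * norm (T (A2 - {y, z}) g)) / (?n - 3)) / (?n - 1)"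
    unfolding w_def A2_def using T_two_step[OF fA i(1,3) ii Suc.prems(4) n4] .
  also have "\<dots> \<le> (?\<kappa> ^ j + (\<Sum>y\<in>A2. \<Sum>z\<in>A2 - {y}. w y z * ?\<kappa> ^ j) / (?n - 3)) / (?n - 1)"
    using n4 1 2 by (intro divide_right_mono add_mono sum_mono mult_left_mono) (auto simp: w_def)
  also have "\<dots> = ?\<kappa> ^ j * (1 + (\<Sum>y\<in>A2. \<Sum>z\<in>A2 - {y}. w y z) / (?n - 3)) / (?n - 1)"
    unfolding sum_distrib_right[symmetric] by (simp add: field_simps)
  also have "\<dots> \<le> ?\<kappa> ^ j * (1 + ((?n - 2) * (?n - 3) - (1 - \<rho>) * s\<^sup>2) / (?n - 3)) / (?n - 1)"
    using 3 n4 \<kappa>0 by (intro divide_right_mono mult_left_mono) auto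
  also have "\<dots> = ?\<kappa> ^ j * (1 - (1 - \<rho>) * (s\<^sup>2 / ((?n - 1) * (?n - 3))))"
  proof -
    have "1 + ((x - 2) * (x - 3) - e) / (x - 3) = (x - 1) * (1 - e / ((x - 1) * (x - 3)))" if "x > 3" for x e :: real
    proof -
      have "((x - 2) * (x - 3) - e) / (x - 3) = (x - 2) - e / (x - 3)" using that by (simp add: diff_divide_distrib)
      moreover have "(x - 1) * (e / ((x - 1) * (x - 3))) = e / (x - 3)" using that by simp
      ultimately show ?thesis by (simp add: right_diff_distrib)
    qed
    from this[of ?n "(1 - \<rho>) * s\<^sup>2"] show ?thesis using n4 by simp
  qed
  also have "\<dots> \<le> ?\<kappa> ^ j * ?\<kappa>"
  proof (intro mult_left_mono diff_left_mono)
    have "(?n - 1) * (?n - 3) \<le> n0 * n0" using n4 Suc.prems(3) by (intro mult_mono) auto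
    then show "(s / n0)\<^sup>2 \<le> s\<^sup>2 / ((?n - 1) * (?n - 3))"
      using n4 s unfolding power_divide by (intro divide_left_mono) (auto simp: power2_eq_square n0)
  qed (use \<rho> \<kappa>0 in auto)
  finally show ?case by (simp add: mult.commute)
qed

end

section \<open>Quadruples of matchings and the edges leaving a small set\<close>

definition exposed :: "'v set \<Rightarrow> ('v \<Rightarrow> 'v) \<Rightarrow> 'v set" where
  "exposed S \<pi> = \<pi> ` S - S"

lemma exposed_extend:
  assumes S: "S \<subseteq> A" "a \<in> S" and j: "j \<in> A - {a}" and \<sigma>: "\<sigma> \<in> matchings (A - {a, j})"
  shows "exposed S (\<sigma> \<circ> Transposition.transpose a j) =
    (if j \<in> S then exposed (S - {a, j}) \<sigma> else insert j (exposed (S - {a, j}) \<sigma>))"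
    and "exposed (S - {a, j}) \<sigma> \<subseteq> A - {a, j}"
proof -
  have a: "a \<in> A" using S by auto
  note e = matching_extend[OF a j \<sigma>]
  let ?\<pi> = "\<sigma> \<circ> Transposition.transpose a j"
  have p: "\<sigma> permutes A - {a, j}" using \<sigma> by (simp add: matchings_def)
  have im: "\<sigma> ` (S - {a, j}) \<subseteq> A - {a, j}" using S permutes_in_image[OF p] by auto
  then show "exposed (S - {a, j}) \<sigma> \<subseteq> A - {a, j}" by (auto simp: exposed_def)
  have eq: "?\<pi> ` (S - {a, j}) = \<sigma> ` (S - {a, j})" by (intro image_cong refl e(4)) auto
  show "exposed S ?\<pi> = (if j \<in> S then exposed (S - {a, j}) \<sigma> else insert j (exposed (S - {a, j}) \<sigma>))"
  proof (cases "j \<in> S")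
    case True
    then have "S = insert a (insert j (S - {a, j}))" using S by auto
    then have "?\<pi> ` S = insert (?\<pi> a) (insert (?\<pi> j) (?\<pi> ` (S - {a, j})))" by (metis image_insert)
    then have "?\<pi> ` S = insert j (insert a (\<sigma> ` (S - {a, j})))" unfolding eq e(2,3) .
    then show ?thesis using True S im by (auto simp: exposed_def)
  next
    case False
    then have "S = insert a (S - {a, j})" using S by auto
    then have "?\<pi> ` S = insert (?\<pi> a) (?\<pi> ` (S - {a, j}))" by (metis image_insert)
    then have "?\<pi> ` S = insert j (\<sigma> ` (S - {a, j}))" unfolding eq e(2,3) .
    then show ?thesis using False S im by (auto simp: exposed_def)
  qed
qed

text \<open>Exponential moment of the number of exposed vertices on the event that they lie in a prescribed
set \<open>U\<close>. The hypothesis on \<open>y\<close> is the inequality that closes the induction when the partners of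
the vertices of \<open>S\<close> are revealed one after the other: at most \<open>k\<close> partners lie in \<open>S\<close> itself and
at most \<open>u\<close> in \<open>U\<close>, among at least \<open>D\<close> remaining ones.\<close>

lemma exposed_moment:
  fixes z y D u :: real
  assumes z: "0 < z" and y: "0 < y" and u: "0 \<le> u" and k: "real k + u / z * y \<le> y\<^sup>2 * D"
  assumes "finite A" "S \<subseteq> A" "card S \<le> k" "U \<subseteq> A - S" "real (card U) \<le> u" "D + 2 * real (card S) \<le> real (card A)" "0 < D"
  shows "matching_avg A (\<lambda>\<pi>. if exposed S \<pi> \<subseteq> U then (1 / z) ^ card (exposed S \<pi>) else 0) \<le> y ^ card S"
  using assms(5-)
proof (induction "card S" arbitrary: A S U rule: less_induct)
  case less
  note A = less.prems(1) note S = less.prems(2)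
  have fS: "finite S" using A S by (rule finite_subset[rotated])
  let ?f = "\<lambda>S U \<pi>. if exposed S \<pi> \<subseteq> U then (1 / z) ^ card (exposed S \<pi>) else 0"
  show ?case
  proof (cases "S = {}")
    case True
    have "norm (matching_avg A (\<lambda>\<pi>. 1::real)) \<le> 1" by (rule norm_matching_avg_le_1[OF A]) auto
    then show ?thesis using True by (simp add: exposed_def)
  next
    case False
    then obtain a where a: "a \<in> S" by blast
    then have aA: "a \<in> A" using S by auto
    let ?c = "card S"
    have c1: "?c \<ge> 1" using a fS card_0_eq[of S] by (cases "card S") auto
    have cA: "real (card A) - 1 \<ge> D" "card A \<ge> 1" using less.prems(6) c1 less.prems(7) by linarith+
    have IH: "matching_avg (A - {a, j}) (?f (S - {a, j}) V) \<le> y ^ card (S - {a, j})"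
      if j: "j \<in> A - {a}" and V: "V \<subseteq> A - {a, j} - (S - {a, j})" "real (card V) \<le> u" for j V
    proof (rule less.hyps[OF _ _ _ _ V(1) V(2) _ less.prems(7)])
      have le: "card (S - {a, j}) \<le> card S - 1"
        using a fS by (metis card_Diff_singleton card_mono finite_Diff Diff_mono insert_mono empty_subsetI order_refl)
      then show "card (S - {a, j}) < card S" "card (S - {a, j}) \<le> k" using c1 less.prems(3) by linarith+
      show "D + 2 * real (card (S - {a, j})) \<le> real (card (A - {a, j}))"
        unfolding card_remove_pair[OF A aA j] using le c1 less.prems(6) by linarith
    qed (use A S in auto)
    (* Reveal the partner \<open>j\<close> of one vertex \<open>a\<close> of \<open>S\<close>: it is another vertex of \<open>S\<close>, or a newly exposed
       vertex, which must lie in \<open>U\<close> and costs a factor \<open>1 / z\<close>. *)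
    have 1: "matching_avg (A - {a, j}) (\<lambda>\<sigma>. ?f S U (\<sigma> \<circ> Transposition.transpose a j)) \<le>
        (if j \<in> S then y ^ (?c - 2) else if j \<in> U then y ^ (?c - 1) / z else 0)" if j: "j \<in> A - {a}" for j
    proof -
      note ee = exposed_extend[OF S a j]
      show ?thesis
      proof (cases "j \<in> S")
        case True
        have "matching_avg (A - {a, j}) (\<lambda>\<sigma>. ?f S U (\<sigma> \<circ> Transposition.transpose a j)) =
           matching_avg (A - {a, j}) (?f (S - {a, j}) U)"
          by (rule matching_avg_cong) (use True ee(1) in simp)
        also have "\<dots> \<le> y ^ card (S - {a, j})"
          using less.prems True a j by (intro IH) auto
        also have "card (S - {a, j}) = ?c - 2" using True a j fS by (intro card_remove_pair) auto
        finally show ?thesis by (simp only: True if_True)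
      next
        case False
        then have cS: "card (S - {a, j}) = ?c - 1" using a fS
          by (metis card_Diff_singleton Diff_insert0 insert_commute)
        show ?thesis
        proof (cases "j \<in> U")
          case True
          have "matching_avg (A - {a, j}) (\<lambda>\<sigma>. ?f S U (\<sigma> \<circ> Transposition.transpose a j)) =
             matching_avg (A - {a, j}) (\<lambda>\<sigma>. 1 / z * ?f (S - {a, j}) (U - {j}) \<sigma>)"
          proof (rule matching_avg_cong)
            fix \<sigma> assume s: "\<sigma> \<in> matchings (A - {a, j})"
            have ni: "j \<notin> exposed (S - {a, j}) \<sigma>" and fi: "finite (exposed (S - {a, j}) \<sigma>)" 
              using ee(2)[OF s] A by (auto intro: finite_subset)
            have "exposed S (\<sigma> \<circ> Transposition.transpose a j) = insert j (exposed (S - {a, j}) \<sigma>)"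
              using ee(1)[OF s] False by simp
            then show "?f S U (\<sigma> \<circ> Transposition.transpose a j) = 1 / z * ?f (S - {a, j}) (U - {j}) \<sigma>"
              using ni fi True by auto
          qed
          also have "\<dots> = 1 / z * matching_avg (A - {a, j}) (?f (S - {a, j}) (U - {j}))"
            by (rule matching_avg_cmult)
          also have "\<dots> \<le> 1 / z * y ^ card (S - {a, j})"
          proof (intro mult_left_mono IH j)
            have "finite U" using A less.prems by (meson finite_Diff finite_subset)
            then have "card (U - {j}) \<le> card U" by (intro card_mono) auto
            then show "real (card (U - {j})) \<le> u" using less.prems(5) by linarith
          qed (use less.prems a z in auto)
          finally show ?thesis
            by (simp only: False True cS if_True if_False times_divide_eq_left mult_1)
        next
          case F: False
          have "matching_avg (A - {a, j}) (\<lambda>\<sigma>. ?f S U (\<sigma> \<circ> Transposition.transpose a j)) =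
             matching_avg (A - {a, j}) (\<lambda>\<sigma>. 0 * 1)"
            by (rule matching_avg_cong) (use F False ee(1) in auto)
          also have "\<dots> = 0" unfolding matching_avg_cmult by simp
          finally show ?thesis by (simp only: F False if_False order_refl)
        qed
      qed
    qed
    have "matching_avg A (?f S U) \<le>
       (\<Sum>j\<in>A - {a}. if j \<in> S then y ^ (?c - 2) else if j \<in> U then y ^ (?c - 1) / z else 0) / real (card A - 1)"
      unfolding matching_avg_rec[OF A aA] by (intro divide_right_mono sum_mono 1) auto
    also have "(\<Sum>j\<in>A - {a}. if j \<in> S then y ^ (?c - 2) else if j \<in> U then y ^ (?c - 1) / z else 0) =
       (\<Sum>j\<in>A - {a}. (if j \<in> S then y ^ (?c - 2) else 0) + (if j \<in> U then y ^ (?c - 1) / z else 0))"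
      using less.prems(4) by (intro sum.cong) auto
    also have "\<dots> = (\<Sum>j\<in>S - {a}. y ^ (?c - 2)) + (\<Sum>j\<in>U. y ^ (?c - 1) / z)"
      unfolding sum.distrib using A S less.prems(4) a
      by (intro arg_cong2[of _ _ _ _ "(+)"] sum.mono_neutral_cong_right) auto
    also have "\<dots> = (real ?c - 1) * y ^ (?c - 2) + real (card U) * (y ^ (?c - 1) / z)"
      using a fS c1 by (simp add: of_nat_diff)
    also have "\<dots> \<le> (real ?c - 1) * y ^ (?c - 2) + u * (y ^ (?c - 1) / z)"
      using less.prems(5) y z by (intro add_left_mono mult_right_mono) auto
    also have "\<dots> \<le> y ^ ?c * D"
    proof (cases "?c = 1")
      case True
      have "u / z * y \<le> y\<^sup>2 * D" using k by linarith
      then have "u / z \<le> y * D"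
        using mult_le_cancel_left_pos[OF y, of "u / z" "y * D"] by (simp add: power2_eq_square mult_ac)
      then show ?thesis using True by simp
    next
      case False
      then obtain c where c: "?c = c + 2" using c1 by (metis add.commute le_add_diff_inverse2 le_neq_implies_less Suc_leI one_add_one plus_1_eq_Suc)
      have "(real ?c - 1) + u / z * y \<le> y\<^sup>2 * D" using k less.prems(3) by linarith
      then have "y ^ c * ((real ?c - 1) + u / z * y) \<le> y ^ c * (y\<^sup>2 * D)" using y by (intro mult_left_mono) auto
      then show ?thesis unfolding c by (simp add: algebra_simps power2_eq_square)
    qed
    finally have "matching_avg A (?f S U) \<le> y ^ ?c * D / real (card A - 1)"
      by (simp add: divide_right_mono)
    also have "\<dots> \<le> y ^ ?c * (real (card A) - 1) / real (card A - 1)"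
      using cA y by (intro divide_right_mono mult_left_mono) auto
    also have "\<dots> = y ^ ?c" using cA less.prems(7) by (simp add: of_nat_diff)
    finally show ?thesis .
  qed
qed

lemma sum_Pow_power_card:
  "finite I \<Longrightarrow> (\<Sum>U\<in>Pow I. x ^ card U) = (1 + x :: real) ^ card I"
proof (induction I rule: finite_induct)
  case (insert a I)
  have "(\<Sum>U\<in>insert a ` Pow I. x ^ card U) = (\<Sum>U\<in>Pow I. x ^ card (insert a U))"
    by (rule sum.reindex_cong[of "insert a"]) (use insert in \<open>auto simp: inj_on_def\<close>)
  also have "\<dots> = (\<Sum>U\<in>Pow I. x * x ^ card U)"
    using insert by (intro sum.cong refl) (metis PowD card_insert_disjoint finite_subset in_mono power_Suc)
  finally have "(\<Sum>U\<in>insert a ` Pow I. x ^ card U) = x * (1 + x) ^ card I" 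
    using insert.IH by (simp add: sum_distrib_left[symmetric])
  moreover have "(\<Sum>U\<in>Pow (insert a I). x ^ card U) = (\<Sum>U\<in>Pow I. x ^ card U) + (\<Sum>U\<in>insert a ` Pow I. x ^ card U)"
    unfolding Pow_insert using insert by (intro sum.union_disjoint) auto
  ultimately show ?case using insert by (simp add: algebra_simps)
qed simp

text \<open>The quadruples of matchings that survive in the expansion of a fourth moment when the values outside
\<open>S\<close> are averaged.\<close>

definition no_lone_link :: "'v set \<Rightarrow> 'v set \<Rightarrow> (nat \<Rightarrow> 'v \<Rightarrow> 'v) set" where
  "no_lone_link A S = {p \<in> PiE {..<4} (\<lambda>_. matchings A). \<forall>i\<in>A - S. \<not> (\<exists>!t. t < 4 \<and> p t i \<in> S)}"

text \<open>Heuristically the \<open>4 * card S\<close> links leaving \<open>S\<close> have to hit only \<open>2 * card S\<close> vertices, and each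
coincidence costs \<open>card S / card A\<close>. A union bound over the set \<open>U\<close> of vertices hit, with weights
\<open>z\<close>, decouples the four matchings, so that the moment bound for a single matching can be used.\<close>

lemma card_no_lone_link:
  assumes A: "finite A" and S: "S \<subseteq> A" "S \<noteq> {}" and n: "8 * card S \<le> card A"
  shows "real (card (no_lone_link A S)) \<le>
    real (card (matchings A)) ^ 4 * (200 * real (card S) / real (card A)) ^ (2 * card S)"
proof -
  define k n where "k = card S" and "n = real (card A)"
  have fS: "finite S" using A S by (auto intro: finite_subset)
  have k1: "k \<ge> 1" using S fS by (simp add: k_def Suc_leI card_gt_0_iff)
  have n0: "n > 0" and kn: "8 * real k \<le> n" using k1 n by (auto simp: k_def n_def)
  (* With \<open>z\<^sup>2 = k / n\<close> the sum of \<open>z\<^sup>2 ^ card U\<close> over all \<open>U\<close> is at most \<open>exp k\<close>; the factor 10 in \<open>y\<close> is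
     large enough for the hypothesis of the exposed moment bound. *)
  define z where "z = sqrt (real k / n)"
  define y where "y = 10 * z"
  define D where "D = n - 2 * real k"
  have z0: "0 < z" "z\<^sup>2 = real k / n" "z \<le> 1" using k1 n0 kn by (auto simp: z_def)
  have y0: "0 < y" using z0 by (simp add: y_def)
  have fM: "finite (matchings A)" by (rule finite_matchings[OF A])
  let ?f = "\<lambda>U \<pi>. if exposed S \<pi> \<subseteq> U then (1 / z) ^ card (exposed S \<pi>) else 0"
  let ?\<U> = "{U. U \<subseteq> A - S \<and> card U \<le> 4 * k}"
  have f\<U>: "finite ?\<U>" by (rule finite_subset[of _ "Pow A"]) (use A in auto)
  have f0: "?f U \<pi> \<ge> 0" for U \<pi> using z0 by simp
  have tm: "(\<Sum>\<pi>\<in>matchings A. ?f U \<pi>) \<le> real (card (matchings A)) * y ^ k" if U: "U \<in> ?\<U>" for U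
  proof -
    have "matching_avg A (?f U) \<le> y ^ card S"
    proof (rule exposed_moment[where u = "4 * real k" and D = D and k = k])
      have "real k + 4 * real k / z * y = 41 * real k" using z0 by (simp add: y_def)
      also have "\<dots> \<le> 100 * (real k / n) * D"
      proof -
        have "41 * n \<le> 100 * D" using kn by (simp add: D_def)
        then have "real k / n * (41 * n) \<le> real k / n * (100 * D)" using n0 by (intro mult_left_mono) auto
        then show ?thesis using n0 by (simp add: mult_ac)
      qed
      also have "100 * (real k / n) = y\<^sup>2" using z0 by (simp add: y_def power_mult_distrib)
      finally show "real k + 4 * real k / z * y \<le> y\<^sup>2 * D" .
      show "0 < D" using kn n0 by (simp add: D_def)
    qed (use A S U y0 z0 in \<open>auto simp: k_def D_def n_def\<close>)
    then have "(\<Sum>\<pi>\<in>matchings A. ?f U \<pi>) / real (card (matchings A)) \<le> y ^ k"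
      unfolding matching_avg_def k_def .
    then show ?thesis
      by (cases "matchings A = {}") (use fM in \<open>auto simp: field_simps card_gt_0_iff\<close>)
  qed
  (* A vertex exposed by one of the four matchings is exposed by a second one. For the union \<open>U\<close> of the
     four exposed sets this gives 2 card U \<le> sum of their sizes, so the weight of \<open>U\<close> is at least 1. *)
  have ge1: "1 \<le> (\<Sum>U\<in>?\<U>. (z\<^sup>2) ^ card U * (\<Prod>t<4. ?f U (p t)))" if p: "p \<in> no_lone_link A S" for p
  proof -
    have pm: "p t \<in> matchings A" if "t < 4" for t using p that by (auto simp: no_lone_link_def)
    define U where "U = (\<Union>t<4. exposed S (p t))"
    have eA: "exposed S (p t) \<subseteq> A - S" if "t < 4" for t
      using pm[OF that] S permutes_in_image[of "p t" A] by (auto simp: exposed_def matchings_def)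
    have ec: "card (exposed S (p t)) \<le> k" for t
      unfolding exposed_def k_def by (meson Diff_subset card_image_le card_mono fS finite_imageI le_trans)
    have UA: "U \<subseteq> A - S" unfolding U_def using eA by auto
    then have fU: "finite U" using A by (auto intro: finite_subset)
    have "card U \<le> (\<Sum>t<4. card (exposed S (p t)))" unfolding U_def by (rule card_UN_le) simp
    also have "\<dots> \<le> (\<Sum>t<4::nat. k)" by (intro sum_mono ec)
    finally have UU: "U \<in> ?\<U>" using UA by simp
    have two: "2 \<le> card {t\<in>{..<4}. i \<in> exposed S (p t)}" if i: "i \<in> U" for i
    proof -
      have iA: "i \<in> A - S" using UA i by auto
      have eq: "i \<in> exposed S (p t) \<longleftrightarrow> p t i \<in> S" if t: "t < 4" for t
      proof
        assume "i \<in> exposed S (p t)"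
        then obtain s where "s \<in> S" "i = p t s" by (auto simp: exposed_def)
        then show "p t i \<in> S" using pm[OF t] S by (auto simp: matchings_def)
      next
        assume "p t i \<in> S"
        moreover have "p t (p t i) = i" using pm[OF t] iA by (auto simp: matchings_def)
        ultimately show "i \<in> exposed S (p t)" using iA unfolding exposed_def by (metis DiffI DiffD2 image_eqI)
      qed
      obtain t where t: "t < 4" "i \<in> exposed S (p t)" using i by (auto simp: U_def)
      have "\<not> (\<exists>!t. t < 4 \<and> p t i \<in> S)" using p iA by (auto simp: no_lone_link_def)
      moreover have "\<exists>!t. t < 4 \<and> p t i \<in> S" if "\<And>t'. t' \<noteq> t \<Longrightarrow> t' < 4 \<Longrightarrow> p t' i \<notin> S"
        using t eq[OF t(1)] that by (intro ex1I[of _ t]) auto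
      ultimately obtain t' where "t' \<noteq> t" "t' < 4" "p t' i \<in> S" by blast
      then have t': "t' \<noteq> t" "t' < 4" "i \<in> exposed S (p t')" using eq by auto
      have "card {t, t'} \<le> card {t\<in>{..<4}. i \<in> exposed S (p t)}" using t t' by (intro card_mono) auto
      then show ?thesis using t' by simp
    qed
    have "2 * card U = (\<Sum>i\<in>U. 2)" by simp
    also have "\<dots> \<le> (\<Sum>i\<in>U. card {t\<in>{..<4}. i \<in> exposed S (p t)})" by (intro sum_mono two)
    also have "\<dots> = (\<Sum>i\<in>U. \<Sum>t<4. if i \<in> exposed S (p t) then 1 else 0)"
      by (simp flip: sum.inter_filter)
    also have "\<dots> = (\<Sum>t<4. \<Sum>i\<in>U. if i \<in> exposed S (p t) then 1 else 0)" by (rule sum.swap)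
    also have "\<dots> = (\<Sum>t<4. card (exposed S (p t)))"
    proof (intro sum.cong refl)
      fix t :: nat assume "t \<in> {..<4}"
      then have "{i\<in>U. i \<in> exposed S (p t)} = exposed S (p t)" by (auto simp: U_def)
      then show "(\<Sum>i\<in>U. if i \<in> exposed S (p t) then 1 else 0) = card (exposed S (p t))"
        using fU by (simp flip: sum.inter_filter)
    qed
    finally have c: "2 * card U \<le> (\<Sum>t<4. card (exposed S (p t)))" .
    have "(\<Prod>t<4. ?f U (p t)) = (\<Prod>t<4. (1 / z) ^ card (exposed S (p t)))"
      by (intro prod.cong refl) (auto simp: U_def)
    also have "\<dots> = (1 / z) ^ (\<Sum>t<4. card (exposed S (p t)))" by (simp only: power_sum)
    also have "\<dots> \<ge> (1 / z) ^ (2 * card U)" using z0 c by (intro power_increasing) auto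
    finally have "(z\<^sup>2) ^ card U * (1 / z) ^ (2 * card U) \<le> (z\<^sup>2) ^ card U * (\<Prod>t<4. ?f U (p t))"
      by (rule mult_left_mono) simp
    moreover have "(z\<^sup>2) ^ card U * (1 / z) ^ (2 * card U) = 1"
      using z0(1) by (simp add: power_mult[symmetric] power_one_over)
    moreover have "(z\<^sup>2) ^ card U * (\<Prod>t<4. ?f U (p t)) \<le> (\<Sum>U\<in>?\<U>. (z\<^sup>2) ^ card U * (\<Prod>t<4. ?f U (p t)))"
      by (intro member_le_sum UU f\<U> mult_nonneg_nonneg prod_nonneg f0) simp_all
    ultimately show ?thesis by linarith
  qed
  have fP: "finite (PiE {..<4::nat} (\<lambda>_. matchings A))" using fM by (intro finite_PiE) auto
  have "real (card (no_lone_link A S)) = (\<Sum>p\<in>no_lone_link A S. 1)" by simp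
  also have "\<dots> \<le> (\<Sum>p\<in>no_lone_link A S. \<Sum>U\<in>?\<U>. (z\<^sup>2) ^ card U * (\<Prod>t<4. ?f U (p t)))"
    by (intro sum_mono ge1)
  also have "\<dots> \<le> (\<Sum>p\<in>PiE {..<4::nat} (\<lambda>_. matchings A). \<Sum>U\<in>?\<U>. (z\<^sup>2) ^ card U * (\<Prod>t<4. ?f U (p t)))"
    by (intro sum_mono2 fP sum_nonneg mult_nonneg_nonneg prod_nonneg f0) (auto simp: no_lone_link_def)
  also have "\<dots> = (\<Sum>U\<in>?\<U>. (z\<^sup>2) ^ card U * (\<Prod>t<4::nat. \<Sum>\<pi>\<in>matchings A. ?f U \<pi>))"
    unfolding prod_sum_PiE[OF finite_lessThan fM] sum_distrib_left by (rule sum.swap)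
  also have "\<dots> \<le> (\<Sum>U\<in>?\<U>. (z\<^sup>2) ^ card U * (\<Prod>t<4::nat. real (card (matchings A)) * y ^ k))"
    by (intro sum_mono mult_left_mono prod_mono conjI tm sum_nonneg f0) auto
  also have "\<dots> = (\<Sum>U\<in>?\<U>. (z\<^sup>2) ^ card U) * (real (card (matchings A)) * y ^ k) ^ 4"
    by (simp add: sum_distrib_right)
  also have "\<dots> \<le> exp (real k) * (real (card (matchings A)) * y ^ k) ^ 4"
  proof (rule mult_right_mono)
    have "(\<Sum>U\<in>?\<U>. (z\<^sup>2) ^ card U) \<le> (\<Sum>U\<in>Pow (A - S). (z\<^sup>2) ^ card U)"
      using A by (intro sum_mono2) auto
    also have "\<dots> = (1 + z\<^sup>2) ^ card (A - S)" using A by (intro sum_Pow_power_card) auto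
    also have "\<dots> \<le> (1 + z\<^sup>2) ^ card A" using A by (intro power_increasing card_mono) auto
    also have "\<dots> \<le> exp (z\<^sup>2) ^ card A" by (intro power_mono) auto
    also have "\<dots> = exp (real k)" using z0 n0 by (simp add: exp_of_nat_mult[symmetric] n_def)
    finally show "(\<Sum>U\<in>?\<U>. (z\<^sup>2) ^ card U) \<le> exp (real k)" .
  qed simp
  also have "\<dots> \<le> real (card (matchings A)) ^ 4 * (200 * real k / n) ^ (2 * k)"
  proof -
    have "exp (real k) = exp 1 ^ k" by (simp add: exp_of_nat_mult[symmetric])
    also have "\<dots> \<le> 3 ^ k" using e_less_272 by (intro power_mono) auto
    finally have "exp (real k) * (y ^ k) ^ 4 \<le> 3 ^ k * (y ^ k) ^ 4" by (rule mult_right_mono) (simp add: zero_le_even_power)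
    also have "\<dots> = (3 * y ^ 4) ^ k" by (simp add: power_mult_distrib power_mult[symmetric] mult.commute)
    also have "\<dots> \<le> ((200 * real k / n)\<^sup>2) ^ k"
    proof (rule power_mono)
      have "y ^ 4 = 10000 * (z\<^sup>2)\<^sup>2" by (simp add: y_def power_mult_distrib)
      then show "3 * y ^ 4 \<le> (200 * real k / n)\<^sup>2" unfolding z0(2)
        by (simp add: power_divide power_mult_distrib divide_right_mono mult_right_mono)
    qed (use y0 in simp)
    finally have "exp (real k) * (y ^ k) ^ 4 \<le> (200 * real k / n) ^ (2 * k)" by (simp add: power_mult)
    then have "real (card (matchings A)) ^ 4 * (exp (real k) * (y ^ k) ^ 4) \<le> 
      real (card (matchings A)) ^ 4 * (200 * real k / n) ^ (2 * k)" by (intro mult_left_mono) auto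
    then show ?thesis by (simp add: power_mult_distrib mult_ac)
  qed
  finally show ?thesis unfolding k_def n_def .
qed

section \<open>Fourth moment near a Lagrangian subgroup\<close>

context pairing begin

text \<open>Isotropic subgroups are those on which \<open>T\<close> does not decay: all weights of edges are 1.\<close>

definition isotropic :: "'a set \<Rightarrow> bool" where
  "isotropic L \<longleftrightarrow> subgroup L G \<and> (\<forall>x\<in>L. \<forall>y\<in>L. B x y = 1)"

definition lagrangian :: "'a set \<Rightarrow> bool" where
  "lagrangian L \<longleftrightarrow> isotropic L \<and> (\<forall>x\<in>carrier G. (\<forall>y\<in>L. B x y = 1) \<longrightarrow> x \<in> L)"

lemma sum_B_subgroup:
  assumes L: "subgroup L G" and o: "w \<in> carrier G" and y: "y \<in> L" "B y w \<noteq> 1"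
  shows "(\<Sum>x\<in>L. B x w) = 0"
proof -
  interpret L: subgroup L G by (rule L)
  have yc: "y \<in> carrier G" using y by auto
  have "(\<Sum>x\<in>L. B x w) = (\<Sum>x\<in>L. B (y \<otimes> x) w)"
    by (rule sum.reindex_bij_witness[of _ "\<lambda>x. y \<otimes> x" "\<lambda>x. inv y \<otimes> x"])
      (use y yc in \<open>auto simp: m_assoc[symmetric] L.mem_carrier\<close>)
  also have "\<dots> = B y w * (\<Sum>x\<in>L. B x w)"
    unfolding sum_distrib_left using o yc by (intro sum.cong refl B_left) auto
  finally show ?thesis using y(2) by (simp add: algebra_simps)
qed

text \<open>Isolates the dependence on the value at one vertex.\<close>

lemma matching_weight_update:
  assumes A: "finite A" "i \<in> A" and \<pi>: "\<pi> \<in> matchings A"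
  shows "matching_weight \<beta> A (g(i := x)) \<pi> =
    B x (g (\<pi> i)) * (\<Prod>k\<in>A - {i, \<pi> i}. \<beta> (g k) (g (\<pi> k)))"
proof -
  have \<pi>i: "\<pi> i \<in> A - {i}" by (rule matching_restrict[OF A(2) \<pi>])
  have inv: "\<pi> (\<pi> k) = k" if "k \<in> A" for k using \<pi> that by (auto simp: matchings_def)
  have "(\<Prod>k\<in>A - {i, \<pi> i}. \<beta> ((g(i := x)) k) ((g(i := x)) (\<pi> k))) = (\<Prod>k\<in>A - {i, \<pi> i}. \<beta> (g k) (g (\<pi> k)))"
  proof (intro prod.cong refl)
    fix k assume k: "k \<in> A - {i, \<pi> i}"
    then have "\<pi> k \<noteq> i" using inv by (metis DiffD1 DiffD2 insertCI)
    then show "\<beta> ((g(i := x)) k) ((g(i := x)) (\<pi> k)) = \<beta> (g k) (g (\<pi> k))" using k by simp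
  qed
  then show ?thesis
    unfolding matching_weight_split[OF A \<pi>] using \<pi>i by (simp add: B_def)
qed

lemma norm_matching_weight:
  assumes "\<pi> \<in> matchings A" "g \<in> A \<rightarrow> carrier G"
  shows "norm (matching_weight \<beta> A g \<pi>) = 1"
proof -
  have "\<pi> i \<in> A" if "i \<in> A" for i using assms(1) that permutes_in_image[of \<pi> A] by (auto simp: matchings_def)
  then show ?thesis
    unfolding matching_weight_def prod_norm[symmetric]
    using assms(2) by (intro prod.neutral) (auto simp: norm_\<beta> Pi_iff)
qed

text \<open>Used to write \<open>norm w ^ 4\<close> as the product of \<open>w\<close>, \<open>cnj w\<close>, \<open>w\<close>, \<open>cnj w\<close>.\<close>

definition conj_if :: "nat \<Rightarrow> complex \<Rightarrow> complex" where
  "conj_if t w = (if even t then w else cnj w)"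

lemma conj_if_simps: "conj_if t (u * w) = conj_if t u * conj_if t w" "conj_if t 1 = 1"
   "conj_if t 0 = 0" "norm (conj_if t w) = norm w" "conj_if t (\<Sum>i\<in>X. h i) = (\<Sum>i\<in>X. conj_if t (h i))"
  by (auto simp: conj_if_def)

lemma norm_power4_sum:
  "finite X \<Longrightarrow> of_real (norm (\<Sum>i\<in>X. h i) ^ 4) = (\<Sum>p\<in>PiE {..<4::nat} (\<lambda>_. X). \<Prod>t<4. conj_if t (h (p t)))"
proof -
  assume X: "finite X"
  let ?s = "\<Sum>i\<in>X. h i"
  have "of_real (norm ?s ^ 4) = (complex_of_real ((norm ?s)\<^sup>2))\<^sup>2" by (simp flip: of_real_power)
  also have "\<dots> = (?s * cnj ?s)\<^sup>2" by (simp only: complex_norm_square)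
  also have "\<dots> = (\<Prod>t<4::nat. conj_if t ?s)"
  proof -
    have "{..<4::nat} = {0, 1, 2, 3}" by auto
    then show ?thesis by (simp add: conj_if_def power2_eq_square mult_ac)
  qed
  also have "\<dots> = (\<Prod>t<4::nat. \<Sum>i\<in>X. conj_if t (h i))" by (simp only: conj_if_simps)
  also have "\<dots> = (\<Sum>p\<in>PiE {..<4::nat} (\<lambda>_. X). \<Prod>t<4. conj_if t (h (p t)))"
    using X by (intro prod_sum_PiE) auto
  finally show ?thesis .
qed

text \<open>Fix the values outside \<open>L\<close> on a small set \<open>S\<close> and average over the values in \<open>L\<close> elsewhere.
Expanding the fourth power gives a sum over quadruples of matchings. Since \<open>L\<close> equals its own
annihilator, an element \<open>w j\<close> outside \<open>L\<close> induces a nontrivial character of \<open>L\<close>, and only the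
quadruples without lone links survive.\<close>

lemma fourth_moment:
  assumes A: "finite A" "even (card A)" and S: "S \<subseteq> A" "S \<noteq> {}" "8 * card S \<le> card A"
    and L: "lagrangian L" and w: "w \<in> S \<rightarrow> carrier G - L"
  shows "(\<Sum>l\<in>PiE (A - S) (\<lambda>_. L). norm (T A (\<lambda>i. if i \<in> S then w i else l i)) ^ 4) \<le>
    real (card L) ^ card (A - S) * (200 * real (card S) / real (card A)) ^ (2 * card S)"
proof -
  have subL: "subgroup L G" using L by (simp add: lagrangian_def isotropic_def)
  have Lc: "L \<subseteq> carrier G" using subgroup.subset[OF subL] .
  have fL: "finite L" using Lc fin finite_subset by blast
  let ?M = "matchings A" let ?P = "PiE {..<4::nat} (\<lambda>_. matchings A)"
  let ?m = "real (card ?M)"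
  have fM: "finite ?M" and M0: "?m > 0"
    using finite_matchings[OF A(1)] matchings_nonempty[OF A] by (auto simp: card_gt_0_iff)
  have fP: "finite ?P" using fM by (intro finite_PiE) auto
  define g where "g l = (\<lambda>i. if i \<in> S then w i else l i)" for l
  have gc: "g l \<in> A \<rightarrow> carrier G" if "l \<in> PiE (A - S) (\<lambda>_. L)" for l
    using that w Lc unfolding g_def by (auto simp: Pi_iff PiE_iff subset_iff)
  let ?E = "\<lambda>p. \<Sum>l\<in>PiE (A - S) (\<lambda>_. L). \<Prod>t<4. conj_if t (matching_weight \<beta> A (g l) (p t))"
  have pm: "p t \<in> ?M" if "p \<in> ?P" "t < 4" for p t using that by auto
  have bound: "norm (?E p) \<le> real (card L) ^ card (A - S)" if p: "p \<in> ?P" for p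
  proof -
    have "norm (?E p) \<le> (\<Sum>l\<in>PiE (A - S) (\<lambda>_. L). 1)"
      by (intro sum_norm_le) (simp add: prod_norm[symmetric] conj_if_simps norm_matching_weight pm[OF p] gc)
    also have "\<dots> = real (card L) ^ card (A - S)" using A(1) by (simp add: card_PiE)
    finally show ?thesis .
  qed
  (* If \<open>i\<close> is linked to \<open>S\<close> in exactly one of the four matchings, then only that factor depends on the
     value at \<open>i\<close>, through a nontrivial character of \<open>L\<close>, and the sum over that value vanishes. *)
  have zero: "?E p = 0" if p: "p \<in> ?P" "p \<notin> no_lone_link A S" for p
  proof -
    obtain i where i: "i \<in> A - S" "\<exists>!t. t < 4 \<and> p t i \<in> S"
      using p by (auto simp: no_lone_link_def)
    then obtain s where s: "s < 4" "p s i \<in> S" and uniq: "\<And>t. t < 4 \<Longrightarrow> p t i \<in> S \<Longrightarrow> t = s" by blast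
    have iA: "i \<in> A" using i by auto
    have ws: "w (p s i) \<in> carrier G" "w (p s i) \<notin> L" using w s by auto
    then obtain y where y: "y \<in> L" "B (w (p s i)) y \<noteq> 1" using L by (auto simp: lagrangian_def)
    have B0: "(\<Sum>x\<in>L. B x (w (p s i))) = 0"
      using sum_B_subgroup[OF subL ws(1) y(1)] y(2) B_sym by metis
    have "(\<Sum>x\<in>L. \<Prod>t<4. conj_if t (matching_weight \<beta> A (g (l(i := x))) (p t))) = 0"
      if l: "l \<in> PiE (A - S - {i}) (\<lambda>_. L)" for l
    proof -
      let ?R = "\<Prod>t<4. conj_if t (\<Prod>k\<in>A - {i, p t i}. \<beta> (g l k) (g l (p t k)))"
      have "(\<Prod>t<4. conj_if t (matching_weight \<beta> A (g (l(i := x))) (p t))) = conj_if s (B x (w (p s i))) * ?R"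
        if x: "x \<in> L" for x
      proof -
        have gu: "g (l(i := x)) = (g l)(i := x)" using i by (auto simp: g_def)
        have "(\<Prod>t<4. conj_if t (matching_weight \<beta> A (g (l(i := x))) (p t))) =
          (\<Prod>t<4. conj_if t (B x (g l (p t i)))) * ?R"
          unfolding gu prod.distrib[symmetric] conj_if_simps(1)[symmetric]
          by (intro prod.cong refl arg_cong[of _ _ "conj_if _"] matching_weight_update A(1) iA pm[OF p(1)]) simp
        also have "(\<Prod>t<4. conj_if t (B x (g l (p t i)))) = (\<Prod>t<4. if t = s then conj_if s (B x (w (p s i))) else 1)"
        proof (intro prod.cong refl)
          fix t :: nat assume t: "t \<in> {..<4}"
          show "conj_if t (B x (g l (p t i))) = (if t = s then conj_if s (B x (w (p s i))) else 1)"
          proof (cases "t = s")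
            case True then show ?thesis using s by (simp add: g_def)
          next
            case False
            then have "p t i \<notin> S" using uniq t by auto
            moreover have "p t i \<in> A - {i}" using matching_restrict(1)[OF iA pm[OF p(1)]] t by auto
            ultimately have "g l (p t i) \<in> L" using l by (auto simp: g_def PiE_iff)
            then have "B x (g l (p t i)) = 1" using x L by (auto simp: lagrangian_def isotropic_def)
            then show ?thesis using False by (simp add: conj_if_simps)
          qed
        qed
        also have "\<dots> = conj_if s (B x (w (p s i)))" using s(1) by (simp add: prod.delta)
        finally show ?thesis .
      qed
      then have "(\<Sum>x\<in>L. \<Prod>t<4. conj_if t (matching_weight \<beta> A (g (l(i := x))) (p t))) =
         conj_if s (\<Sum>x\<in>L. B x (w (p s i))) * ?R"
        unfolding conj_if_simps(5) sum_distrib_right by (intro sum.cong refl)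
      then show ?thesis unfolding B0 by (simp add: conj_if_simps)
    qed
    note inner = this
    show ?thesis unfolding sum_PiE_remove[OF i(1)] by (rule sum.neutral) (intro ballI inner)
  qed
  have "complex_of_real (\<Sum>l\<in>PiE (A - S) (\<lambda>_. L). norm (T A (g l)) ^ 4) =
     (\<Sum>l\<in>PiE (A - S) (\<lambda>_. L). of_real (norm (\<Sum>\<pi>\<in>?M. matching_weight \<beta> A (g l) \<pi>) ^ 4) / of_real (?m ^ 4))"
    unfolding of_real_sum
    by (intro sum.cong refl) (simp add: mean_weight_def matching_avg_def norm_divide power_divide)
  also have "\<dots> = (\<Sum>p\<in>?P. ?E p) / of_real (?m ^ 4)"
    unfolding norm_power4_sum[OF fM] sum_divide_distrib[symmetric] by (subst sum.swap) (rule refl)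
  also have "(\<Sum>p\<in>?P. ?E p) = (\<Sum>p\<in>no_lone_link A S. ?E p)"
    by (rule sum.mono_neutral_right[OF fP]) (use zero in \<open>auto simp: no_lone_link_def\<close>)
  finally have eq: "complex_of_real (\<Sum>l\<in>PiE (A - S) (\<lambda>_. L). norm (T A (g l)) ^ 4) =
    (\<Sum>p\<in>no_lone_link A S. ?E p) / of_real (?m ^ 4)" .
  have "(\<Sum>l\<in>PiE (A - S) (\<lambda>_. L). norm (T A (g l)) ^ 4) =
    norm (complex_of_real (\<Sum>l\<in>PiE (A - S) (\<lambda>_. L). norm (T A (g l)) ^ 4))"
    unfolding norm_of_real by (intro abs_of_nonneg[symmetric] sum_nonneg) simp
  also have "\<dots> = norm (\<Sum>p\<in>no_lone_link A S. ?E p) / ?m ^ 4"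
    unfolding eq norm_divide norm_of_real by simp
  also have "\<dots> \<le> (\<Sum>p\<in>no_lone_link A S. real (card L) ^ card (A - S)) / ?m ^ 4"
    by (intro divide_right_mono sum_norm_le bound) (auto simp: no_lone_link_def)
  also have "\<dots> = real (card L) ^ card (A - S) * (real (card (no_lone_link A S)) / ?m ^ 4)" by simp
  also have "\<dots> \<le> real (card L) ^ card (A - S) * (200 * real (card S) / real (card A)) ^ (2 * card S)"
    using card_no_lone_link[OF A(1) S] M0 by (intro mult_left_mono) (auto simp: field_simps)
  finally show ?thesis unfolding g_def .
qed

text \<open>The fourth moment is of order \<open>(card S / card A) ^ (2 * card S)\<close>, which makes the typical size of
\<open>T\<close> of order \<open>(card S / card A) powr (card S / 2)\<close>. The third moment follows by interpolation.\<close>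

lemma third_moment:
  assumes A: "finite A" "even (card A)" and S: "S \<subseteq> A" "S \<noteq> {}" "8 * card S \<le> card A"
    and L: "lagrangian L" and w: "w \<in> S \<rightarrow> carrier G - L"
  shows "(\<Sum>l\<in>PiE (A - S) (\<lambda>_. L). norm (T A (\<lambda>i. if i \<in> S then w i else l i)) ^ 3) \<le>
    real (card L) ^ card (A - S) * (2 * sqrt (200 * real (card S) / real (card A)) ^ (3 * card S))"
proof -
  let ?q = "200 * real (card S) / real (card A)" 
  (* The fourth root of the bound for the average of the fourth powers. *)
  define \<mu> where "\<mu> = sqrt ?q ^ card S"
  have fS: "finite S" using A S by (auto intro: finite_subset)
  have "card S > 0" using S fS by (simp add: card_gt_0_iff)
  then have q: "?q > 0" using S by simp
  then have \<mu>: "\<mu> > 0" by (simp add: \<mu>_def)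
  have pw: "x ^ 3 \<le> \<mu> ^ 3 + x ^ 4 / \<mu>" if "x \<ge> 0" for x
  proof (cases "x \<le> \<mu>")
    case True
    then have "x ^ 3 \<le> \<mu> ^ 3" using that by (rule power_mono)
    then show ?thesis using \<mu> by (simp add: add_increasing2)
  next
    case False
    then have "x ^ 3 * \<mu> \<le> x ^ 3 * x" using that by (intro mult_left_mono) auto
    then have "x ^ 3 \<le> x ^ 4 / \<mu>" using \<mu> by (simp add: field_simps eval_nat_numeral)
    then show ?thesis using \<mu> by (simp add: add_increasing)
  qed
  let ?f = "\<lambda>l. norm (T A (\<lambda>i. if i \<in> S then w i else l i))"
  have "(\<Sum>l\<in>PiE (A - S) (\<lambda>_. L). ?f l ^ 3) \<le> (\<Sum>l\<in>PiE (A - S) (\<lambda>_. L). \<mu> ^ 3 + ?f l ^ 4 / \<mu>)"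
    by (intro sum_mono pw) simp
  also have "\<dots> = real (card L) ^ card (A - S) * \<mu> ^ 3 + (\<Sum>l\<in>PiE (A - S) (\<lambda>_. L). ?f l ^ 4) / \<mu>"
    using A(1) by (simp add: sum.distrib sum_divide_distrib card_PiE)
  also have "\<dots> \<le> real (card L) ^ card (A - S) * \<mu> ^ 3 + (real (card L) ^ card (A - S) * ?q ^ (2 * card S)) / \<mu>"
    using \<mu> by (intro add_left_mono divide_right_mono fourth_moment assms) auto
  also have "?q ^ (2 * card S) = \<mu> ^ 4"
  proof -
    have "?q ^ (2 * card S) = ((sqrt ?q)\<^sup>2) ^ (2 * card S)" using q by simp
    also have "\<dots> = \<mu> ^ 4" unfolding \<mu>_def power_mult[symmetric] by (simp add: mult_ac)
    finally show ?thesis .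
  qed
  also have "real (card L) ^ card (A - S) * \<mu> ^ 3 + real (card L) ^ card (A - S) * \<mu> ^ 4 / \<mu> =
     real (card L) ^ card (A - S) * (2 * \<mu> ^ 3)"
    using \<mu> by (simp add: eval_nat_numeral)
  also have "\<mu> ^ 3 = sqrt ?q ^ (3 * card S)" by (simp add: \<mu>_def power_mult[symmetric] mult.commute)
  finally show ?thesis .
qed

end

section \<open>Summation over the positions of the outliers\<close>

lemma binomial_le_exp: "k \<le> n \<Longrightarrow> 0 < k \<Longrightarrow> real (n choose k) \<le> (exp 1 * real n / real k) ^ k"
proof -
  assume k: "k \<le> n" "0 < k"
  let ?x = "real k / real n"
  have "real (n choose k) * ?x ^ k \<le> (\<Sum>i\<le>n. real (n choose i) * ?x ^ i)"
    using k by (intro member_le_sum) auto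
  also have "\<dots> = (?x + 1) ^ n" by (subst binomial_ring) simp
  also have "\<dots> \<le> exp ?x ^ n" by (intro power_mono) (auto simp: add.commute)
  also have "\<dots> = exp 1 ^ k" using k by (simp add: exp_of_nat_mult[symmetric])
  finally show ?thesis using k by (simp add: power_divide power_mult_distrib field_simps)
qed

lemma sum_subsets_by_card:
  assumes "finite A" "finite K"
  shows "(\<Sum>S\<in>{S. S \<subseteq> A \<and> card S \<in> K}. f (card S) :: real) = (\<Sum>k\<in>K. real (card A choose k) * f k)"
proof -
  have fin: "finite {S. S \<subseteq> A \<and> card S \<in> K}" by (rule finite_subset[of _ "Pow A"]) (use assms in auto)
  have "(\<Sum>S\<in>{S. S \<subseteq> A \<and> card S \<in> K}. f (card S)) =
     (\<Sum>k\<in>K. \<Sum>S\<in>{S \<in> {S. S \<subseteq> A \<and> card S \<in> K}. card S = k}. f (card S))"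
    by (rule sum.group[symmetric]) (use assms fin in auto)
  also have "\<dots> = (\<Sum>k\<in>K. real (card A choose k) * f k)"
  proof (intro sum.cong refl)
    fix k assume "k \<in> K"
    then have "{S \<in> {S. S \<subseteq> A \<and> card S \<in> K}. card S = k} = {S. S \<subseteq> A \<and> card S = k}" by auto
    then have "(\<Sum>S\<in>{S \<in> {S. S \<subseteq> A \<and> card S \<in> K}. card S = k}. f (card S)) = (\<Sum>S\<in>{S. S \<subseteq> A \<and> card S = k}. f k)"
      by simp
    then show "(\<Sum>S\<in>{S \<in> {S. S \<subseteq> A \<and> card S \<in> K}. card S = k}. f (card S)) = real (card A choose k) * f k"
      using n_subsets[OF assms(1)] by simp
  qed
  finally show ?thesis .
qed

lemma power_times_poly_tendsto_0:
  assumes "0 < \<theta>" "\<theta> < (1::real)"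
  shows "(\<lambda>m. \<theta> ^ m * real (m + 1) ^ N) \<longlonglongrightarrow> 0"
proof -
  define a where "a = - ln \<theta>"
  have a: "a > 0" using assms by (simp add: a_def)
  have "filterlim (\<lambda>m. a * real (m + 1)) at_top sequentially"
    using a by real_asymp
  from filterlim_compose[OF tendsto_power_div_exp_0[of N] this]
  have "(\<lambda>m. (a * real (m + 1)) ^ N / exp (a * real (m + 1)) * (exp a / a ^ N)) \<longlonglongrightarrow> 0 * (exp a / a ^ N)"
    by (intro tendsto_mult tendsto_const)
  moreover have "(a * real (m + 1)) ^ N / exp (a * real (m + 1)) * (exp a / a ^ N) = \<theta> ^ m * real (m + 1) ^ N" for m
  proof -
    have "exp (a * real (m + 1)) = exp a * exp a ^ m"
      by (simp add: exp_of_nat_mult[symmetric] exp_add[symmetric] algebra_simps)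
    moreover have "exp a = 1 / \<theta>" using assms by (simp add: a_def exp_minus inverse_eq_divide)
    moreover from this have "\<theta> ^ m = 1 / exp a ^ m" using assms by (simp add: power_one_over)
    moreover have "(a * x) ^ N / (E * F) * (E / a ^ N) = 1 / F * x ^ N" if "E \<noteq> 0" for x E F :: real
      using a that by (simp add: power_mult_distrib)
    ultimately show ?thesis by (metis exp_not_eq_zero)
  qed
  ultimately show ?thesis by simp
qed

context pairing begin

text \<open>The annihilator of \<open>L\<close> has \<open>N / card L\<close> elements and contains \<open>L\<close>.\<close>

lemma isotropic_card:
  assumes "isotropic L"
  shows "(card L)\<^sup>2 \<le> N" "(card L)\<^sup>2 = N \<Longrightarrow> lagrangian L"
proof -
  have L: "subgroup L G" using assms by (simp add: isotropic_def)
  have Lc: "L \<subseteq> carrier G" by (rule subgroup.subset[OF L])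
  have fL: "finite L" using Lc fin finite_subset by blast
  (* \<open>P\<close> is the annihilator of \<open>L\<close>. Double counting gives card L * card P = N, and \<open>L \<subseteq> P\<close>. *)
  define P where "P = {x\<in>carrier G. \<forall>y\<in>L. B x y = 1}"
  have fP: "finite P" using fin by (simp add: P_def)
  have LP: "L \<subseteq> P" using assms Lc by (auto simp: isotropic_def P_def)
  have "(\<Sum>x\<in>carrier G. \<Sum>y\<in>L. B y x) = (\<Sum>x\<in>carrier G. if x \<in> P then of_nat (card L) else 0)"
  proof (intro sum.cong refl)
    fix x assume x: "x \<in> carrier G"
    show "(\<Sum>y\<in>L. B y x) = (if x \<in> P then of_nat (card L) else 0)"
    proof (cases "x \<in> P")
      case True
      then have "(\<Sum>y\<in>L. B y x) = (\<Sum>y\<in>L. 1)" by (intro sum.cong refl) (auto simp: P_def B_sym)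
      then show ?thesis using True by simp
    next
      case False
      then obtain y where "y \<in> L" "B y x \<noteq> 1" using x B_sym by (auto simp: P_def)
      then show ?thesis using sum_B_subgroup[OF L x] False by simp
    qed
  qed
  also have "\<dots> = of_nat (card L * card P)"
  proof -
    have "carrier G \<inter> P = P" by (auto simp: P_def)
    then show ?thesis using fin by (simp add: sum.If_cases mult.commute)
  qed
  finally have 1: "(\<Sum>x\<in>carrier G. \<Sum>y\<in>L. B y x) = of_nat (card L * card P)" .
  have "(\<Sum>x\<in>carrier G. \<Sum>y\<in>L. B y x) = (\<Sum>y\<in>L. \<Sum>x\<in>carrier G. B x y)"
    by (subst sum.swap) (simp add: B_sym)
  also have "\<dots> = (\<Sum>y\<in>L. if y = \<one> then of_nat N else 0)"
    using Lc by (intro sum.cong refl sum_B) auto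
  also have "\<dots> = of_nat N" using fL subgroup.one_closed[OF L] by simp
  finally have "complex_of_nat (card L * card P) = of_nat N" using 1 by simp
  then have e: "card L * card P = N" by (simp only: of_nat_eq_iff)
  have le: "card L \<le> card P" using LP fP by (rule card_mono[rotated])
  show "(card L)\<^sup>2 \<le> N" using e le by (metis mult_le_mono2 power2_eq_square)
  assume "(card L)\<^sup>2 = N"
  moreover have "card L > 0" using fL subgroup.one_closed[OF L] by (auto simp: card_gt_0_iff)
  moreover from calculation have "card L * card L = card L * card P" using e by (simp add: power2_eq_square)
  ultimately have "card L = card P" using nat_mult_eq_cancel1 by blast
  then have "L = P" using card_subset_eq[OF fP LP] by simp
  then show "lagrangian L" using assms by (auto simp: lagrangian_def P_def)
qed

definition outliers :: "nat set \<Rightarrow> 'a set \<Rightarrow> 'a \<Rightarrow> (nat \<Rightarrow> 'a) \<Rightarrow> nat set" where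
  "outliers A L c g = {i\<in>A. inv c \<otimes> g i \<notin> L}"

text \<open>Assignments near a coset are parametrized by the set \<open>S\<close> of outliers, the values outside the coset
on \<open>S\<close>, and the values inside the coset elsewhere.\<close>

lemma sum_near_le:
  assumes A: "finite A" and c: "c \<in> carrier G" and L: "L \<subseteq> carrier G" and F: "\<And>g. F g \<ge> (0::real)"
  shows "(\<Sum>g\<in>{g\<in>PiE A (\<lambda>_. carrier G). card (outliers A L c g) \<in> K}. F g) \<le>
    (\<Sum>S\<in>{S. S \<subseteq> A \<and> card S \<in> K}. \<Sum>w\<in>PiE S (\<lambda>_. carrier G - L). \<Sum>l\<in>PiE (A - S) (\<lambda>_. L).
      F (\<lambda>i\<in>A. c \<otimes> (if i \<in> S then w i else l i)))" (is "sum F ?X \<le> _")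
proof -
  let ?\<S> = "{S. S \<subseteq> A \<and> card S \<in> K}"
  let ?Y = "\<lambda>S. PiE S (\<lambda>_. carrier G - L)" let ?Z = "\<lambda>S. PiE (A - S) (\<lambda>_. L)"
  let ?D = "SIGMA S:?\<S>. ?Y S \<times> ?Z S"
  let ?h = "\<lambda>(S, w, l). \<lambda>i\<in>A. c \<otimes> (if i \<in> S then w i else l i)"
  have f\<S>: "finite ?\<S>" by (rule finite_subset[of _ "Pow A"]) (use A in auto)
  have fL: "finite L" using L fin finite_subset by blast
  have fS: "finite S" if "S \<in> ?\<S>" for S using that A by (auto intro: finite_subset)
  have fYZ: "finite (?Y S \<times> ?Z S)" if "S \<in> ?\<S>" for S
    using fS[OF that] A fin fL by (intro finite_cartesian_product finite_PiE) auto
  have fD: "finite ?D" by (intro finite_SigmaI f\<S> fYZ)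
  have sub: "?X \<subseteq> ?h ` ?D"
  proof
    fix g assume g: "g \<in> ?X"
    then have gc: "g i \<in> carrier G" if "i \<in> A" for i using that by auto
    define S where "S = outliers A L c g"
    have SA: "S \<subseteq> A" by (auto simp: S_def outliers_def)
    define w where "w = (\<lambda>i\<in>S. inv c \<otimes> g i)"
    define l where "l = (\<lambda>i\<in>A - S. inv c \<otimes> g i)"
    have a: "(S, w, l) \<in> ?D" using g SA gc c by (auto simp: S_def w_def l_def outliers_def)
    have b: "?h (S, w, l) = g"
    proof
      fix i show "?h (S, w, l) i = g i"
      proof (cases "i \<in> A")
        case True
        have "c \<otimes> (inv c \<otimes> g i) = g i" using c gc[OF True] by (simp add: m_assoc[symmetric])
        then show ?thesis using True by (simp add: w_def l_def)
      next
        case False then show ?thesis using g by (auto simp: PiE_iff extensional_def)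
      qed
    qed
    show "g \<in> ?h ` ?D" by (rule image_eqI[where f = ?h, OF b[symmetric] a])
  qed
  have "sum F ?X \<le> sum F (?h ` ?D)" using fD sub F by (intro sum_mono2) auto
  also have "\<dots> \<le> sum (F \<circ> ?h) ?D" using fD F by (intro sum_image_le) auto
  also have "\<dots> = (\<Sum>(S, x)\<in>?D. F (?h (S, x)))" by (intro sum.cong refl) auto
  also have "\<dots> = (\<Sum>S\<in>?\<S>. \<Sum>x\<in>?Y S \<times> ?Z S. F (?h (S, x)))"
    by (rule sum.Sigma[symmetric]) (use f\<S> fYZ in blast)+
  also have "\<dots> = (\<Sum>S\<in>?\<S>. \<Sum>w\<in>?Y S. \<Sum>l\<in>?Z S. F (?h (S, w, l)))"
    unfolding sum.cartesian_product by (intro sum.cong refl) auto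
  finally show ?thesis by simp
qed

lemma T_restrict: "T A (\<lambda>i\<in>A. h i) = T A h"
  by (rule mean_weight_cong) simp

text \<open>Close to a coset but not inside it: configurations without outliers belong to the main term.\<close>

definition near :: "nat \<Rightarrow> real \<Rightarrow> 'a set \<Rightarrow> 'a \<Rightarrow> (nat \<Rightarrow> 'a) set" where
  "near n \<delta> L c = {g\<in>PiE {0..<n} (\<lambda>_. carrier G).
     card (outliers {0..<n} L c g) \<in> {k. 1 \<le> k \<and> real k \<le> \<delta> * real n}}"

lemma finite_near_range: "finite {k::nat. 1 \<le> k \<and> real k \<le> r}"
  by (rule finite_subset[of _ "{..nat \<lceil>r\<rceil>}"]) (auto simp: le_nat_iff ceiling_le_iff intro: order.trans[OF _ le_of_int_ceiling], linarith)

text \<open>The decisive estimate. There are about \<open>(n / k) ^ k\<close> ways to place \<open>k\<close> outliers, whereas the cube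
of \<open>T\<close> averages to about \<open>(k / n) powr (3 * k / 2)\<close>. The quotient is summable over \<open>k\<close> and
dominated by \<open>k = 1\<close>, where it is of order \<open>1 / sqrt n\<close>. With the square in place of the cube the
two factors would balance; this is where degree at least three enters.\<close>

lemma near_lagrangian_bound:
  assumes L: "lagrangian L" and cL: "(card L)\<^sup>2 = N" and c: "c \<in> carrier G" and n: "even n" "n > 0"
    and \<delta>: "8 * \<delta> \<le> 1" and D: "D = 9000 * real N" "D * sqrt \<delta> \<le> 1 / 2"
  shows "(\<Sum>g\<in>near n \<delta> L c. norm (T {0..<n} g) ^ 3) \<le> real (card L) ^ n * (8 * D / sqrt (real n))"
proof -
  let ?A = "{0..<n}" let ?K = "{k. 1 \<le> k \<and> real k \<le> \<delta> * real n}"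
  have Lsub: "L \<subseteq> carrier G" using L by (simp add: lagrangian_def isotropic_def subgroup.subset)
  have fL: "finite L" using Lsub fin finite_subset by blast
  have L0: "card L > 0" using cL N_pos by (cases "card L") auto
  have k8: "8 * k \<le> n" if "k \<in> ?K" for k
  proof -
    have "8 * real k \<le> 8 * \<delta> * real n" using that by simp
    also have "\<dots> \<le> 1 * real n" using \<delta> by (intro mult_right_mono) auto
    finally show ?thesis by linarith
  qed
  have fK: "finite ?K" by (rule finite_near_range)
  let ?q = "\<lambda>k. sqrt (200 * real k / real n)"
  (* Translating by \<open>c\<close> does not change the modulus of \<open>T\<close>, so the third moment bound applies with
     the outliers fixed and the remaining values running through \<open>L\<close>. *)
  have inner: "(\<Sum>w\<in>PiE S (\<lambda>_. carrier G - L). \<Sum>l\<in>PiE (?A - S) (\<lambda>_. L).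
      norm (T ?A (\<lambda>i\<in>?A. c \<otimes> (if i \<in> S then w i else l i))) ^ 3) \<le>
      real N ^ card S * (real (card L) ^ (n - card S) * (2 * ?q (card S) ^ (3 * card S)))"
    if S: "S \<in> {S. S \<subseteq> ?A \<and> card S \<in> ?K}" for S
  proof -
    have fS: "finite S" using S by (auto intro: finite_subset)
    have Sne: "S \<noteq> {}" using S by auto
    have cAS: "card (?A - S) = n - card S" using S fS by (subst card_Diff_subset) auto
    have "(\<Sum>l\<in>PiE (?A - S) (\<lambda>_. L). norm (T ?A (\<lambda>i\<in>?A. c \<otimes> (if i \<in> S then w i else l i))) ^ 3) \<le>
       real (card L) ^ (n - card S) * (2 * ?q (card S) ^ (3 * card S))" if w: "w \<in> PiE S (\<lambda>_. carrier G - L)" for w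
    proof -
      have "(\<Sum>l\<in>PiE (?A - S) (\<lambda>_. L). norm (T ?A (\<lambda>i\<in>?A. c \<otimes> (if i \<in> S then w i else l i))) ^ 3) =
        (\<Sum>l\<in>PiE (?A - S) (\<lambda>_. L). norm (T ?A (\<lambda>i. if i \<in> S then w i else l i)) ^ 3)"
      proof (intro sum.cong refl)
        fix l assume l: "l \<in> PiE (?A - S) (\<lambda>_. L)"
        have "(\<lambda>i. if i \<in> S then w i else l i) \<in> ?A \<rightarrow> carrier G"
          using w l Lsub by (auto simp: Pi_iff PiE_iff subset_iff)
        then show "norm (T ?A (\<lambda>i\<in>?A. c \<otimes> (if i \<in> S then w i else l i))) ^ 3 =
            norm (T ?A (\<lambda>i. if i \<in> S then w i else l i)) ^ 3"
          unfolding T_restrict by (subst norm_T_translate) (use c in auto)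
      qed
      also have "\<dots> \<le> real (card L) ^ (n - card S) * (2 * ?q (card S) ^ (3 * card S))"
        using third_moment[of ?A S L w] n S Sne k8 L w unfolding cAS by auto
      finally show ?thesis .
    qed
    then have "(\<Sum>w\<in>PiE S (\<lambda>_. carrier G - L). \<Sum>l\<in>PiE (?A - S) (\<lambda>_. L).
      norm (T ?A (\<lambda>i\<in>?A. c \<otimes> (if i \<in> S then w i else l i))) ^ 3) \<le>
      (\<Sum>w\<in>PiE S (\<lambda>_. carrier G - L). real (card L) ^ (n - card S) * (2 * ?q (card S) ^ (3 * card S)))"
      by (rule sum_mono)
    also have "\<dots> = real (card (carrier G - L)) ^ card S * (real (card L) ^ (n - card S) * (2 * ?q (card S) ^ (3 * card S)))"
      using fS by (simp add: card_PiE)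
    also have "\<dots> \<le> real N ^ card S * (real (card L) ^ (n - card S) * (2 * ?q (card S) ^ (3 * card S)))"
      using fin by (intro mult_right_mono power_mono) (auto intro: card_mono)
    finally show ?thesis .
  qed
  have "(\<Sum>g\<in>near n \<delta> L c. norm (T ?A g) ^ 3) \<le>
     (\<Sum>S\<in>{S. S \<subseteq> ?A \<and> card S \<in> ?K}. real N ^ card S * (real (card L) ^ (n - card S) * (2 * ?q (card S) ^ (3 * card S))))"
    unfolding near_def by (rule order.trans[OF sum_near_le[OF _ c Lsub] sum_mono[OF inner]]) auto
  also have "\<dots> = (\<Sum>k\<in>?K. real (n choose k) * (real N ^ k * (real (card L) ^ (n - k) * (2 * ?q k ^ (3 * k)))))"
    using sum_subsets_by_card[OF _ fK, of ?A "\<lambda>k. real N ^ k * (real (card L) ^ (n - k) * (2 * ?q k ^ (3 * k)))"] by simp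
  also have "\<dots> \<le> (\<Sum>k\<in>?K. real (card L) ^ n * (2 * D / sqrt (real n)) * (real k * (1 / 2) ^ (k - 1)))"
  proof (rule sum_mono)
    fix k assume k: "k \<in> ?K"
    then have k1: "k \<ge> 1" "k \<le> n" using k8[OF k] by auto
    let ?s = "sqrt (real k / real n)"
    have N2: "real N = real (card L) * real (card L)" using cL by (simp add: power2_eq_square flip: of_nat_mult)
    have "real (card L) ^ n = real (card L) ^ k * real (card L) ^ (n - k)" using k1 by (simp flip: power_add)
    then have "real N ^ k * real (card L) ^ (n - k) = real (card L) ^ n * real (card L) ^ k"
      unfolding N2 by (simp add: power_mult_distrib)
    then have "real (n choose k) * (real N ^ k * (real (card L) ^ (n - k) * (2 * ?q k ^ (3 * k)))) =
       2 * real (card L) ^ n * (real (n choose k) * (real (card L) ^ k * ?q k ^ (3 * k)))"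
      by (simp add: mult_ac)
    also have "\<dots> \<le> 2 * real (card L) ^ n * ((exp 1 * real n / real k) ^ k * (real N ^ k * ?q k ^ (3 * k)))"
    proof (intro mult_left_mono mult_mono binomial_le_exp)
      have "card L \<le> N" using Lsub fin by (intro card_mono)
      then show "real (card L) ^ k \<le> real N ^ k" by (intro power_mono) auto
    qed (use k1 in auto)
    also have "(exp 1 * real n / real k) ^ k * (real N ^ k * ?q k ^ (3 * k)) = (exp 1 * real n / real k * real N * ?q k ^ 3) ^ k"
      by (simp only: power_mult power_mult_distrib[symmetric] mult.assoc)
    also have "2 * real (card L) ^ n * (exp 1 * real n / real k * real N * ?q k ^ 3) ^ k \<le> 2 * real (card L) ^ n * (D * ?s) ^ k"
    proof (intro mult_left_mono power_mono)
      (* The factor \<open>(n / k) ^ k\<close> from choosing the outliers meets \<open>(k / n) powr (3 * k / 2)\<close>; what remains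
         is \<open>(k / n) powr (k / 2)\<close>, and the constants multiply to at most 3 * 200 * 15 = 9000. *)
      have q3: "?q k ^ 3 = 200 * real k / real n * (sqrt 200 * ?s)"
        by (simp add: eval_nat_numeral real_sqrt_mult[symmetric] real_sqrt_divide[symmetric])
      have "exp 1 * real n / real k * real N * ?q k ^ 3 = exp 1 * 200 * sqrt 200 * real N * ?s"
        unfolding q3 using k1 by (simp add: field_simps)
      also have "\<dots> \<le> 3 * 200 * 15 * real N * ?s"
      proof (intro mult_right_mono mult_mono)
        show "exp 1 \<le> (3::real)" using e_less_272 by simp
        show "sqrt 200 \<le> (15::real)" by (rule real_le_lsqrt) auto
      qed auto
      also have "\<dots> = D * ?s" by (simp add: D)
      finally show "exp 1 * real n / real k * real N * ?q k ^ 3 \<le> D * ?s" .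
    qed auto
    also have "(D * ?s) ^ k = (D * ?s) * (D * ?s) ^ (k - 1)" using k1 by (metis power_eq_if not_one_le_zero)
    also have "2 * real (card L) ^ n * ((D * ?s) * (D * ?s) ^ (k - 1)) \<le> 2 * real (card L) ^ n * ((D * (real k / sqrt (real n))) * (1 / 2) ^ (k - 1))"
    proof (intro mult_left_mono mult_mono power_mono)
      show "?s \<le> real k / sqrt (real n)" using k1
        by (simp add: real_sqrt_divide divide_right_mono real_le_lsqrt power2_eq_square)
      have "real k / real n \<le> \<delta>" using k n by (simp add: field_simps)
      then have "D * ?s \<le> D * sqrt \<delta>" unfolding D by (intro mult_left_mono) auto
      then show "D * ?s \<le> 1 / 2" using D(2) by linarith
    qed (auto simp: D)
    finally show "real (n choose k) * (real N ^ k * (real (card L) ^ (n - k) * (2 * ?q k ^ (3 * k)))) \<le>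
      real (card L) ^ n * (2 * D / sqrt (real n)) * (real k * (1 / 2) ^ (k - 1))" by (simp add: mult_ac)
  qed
  also have "\<dots> = real (card L) ^ n * (2 * D / sqrt (real n)) * (\<Sum>k\<in>?K. real k * (1 / 2) ^ (k - 1))"
    by (simp only: sum_distrib_left)
  also have "\<dots> \<le> real (card L) ^ n * (2 * D / sqrt (real n)) * 4"
  proof (intro mult_left_mono)
    have s: "(\<lambda>j. of_nat (Suc j) * (1 / 2 :: real) ^ j) sums (1 / (1 - 1 / 2)\<^sup>2)"
      by (rule geometric_deriv_sums) simp
    have "(\<Sum>k\<in>?K. real k * (1 / 2) ^ (k - 1)) = (\<Sum>j\<in>(\<lambda>k. k - 1) ` ?K. of_nat (Suc j) * (1 / 2 :: real) ^ j)"
      by (rule sum.reindex_cong[of "Suc"]) (force simp: image_iff)+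
    also have "\<dots> \<le> suminf (\<lambda>j. of_nat (Suc j) * (1 / 2 :: real) ^ j)"
      using fK by (intro sum_le_suminf sums_summable[OF s]) auto
    also have "\<dots> = 4" using sums_unique[OF s] by (simp add: power2_eq_square)
    finally show "(\<Sum>k\<in>?K. real k * (1 / 2) ^ (k - 1)) \<le> 4" .
  qed (auto simp: D)
  also have "\<dots> = real (card L) ^ n * (8 * D / sqrt (real n))" by simp
  finally show ?thesis .
qed

end

section \<open>Unconfined assignments are negligible\<close>

lemma sum_UNION_le:
  fixes f :: "'b \<Rightarrow> real"
  assumes "finite I" "\<And>i. i \<in> I \<Longrightarrow> finite (X i)" "\<And>x. f x \<ge> 0"
  shows "sum f (\<Union>i\<in>I. X i) \<le> (\<Sum>i\<in>I. sum f (X i))"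
  using assms(1,2)
proof (induction I rule: finite_induct)
  case (insert i I)
  have "sum f (X i \<union> (\<Union>i\<in>I. X i)) \<le> sum f (X i) + sum f (\<Union>i\<in>I. X i)"
    using insert assms(3) by (subst sum_Un) (auto intro!: sum_nonneg)
  then show ?case using insert by fastforce
qed simp

context pairing begin

lemma norm_T_cube_le_1: "g \<in> PiE {0..<n::nat} (\<lambda>_. carrier G) \<Longrightarrow> norm (T {0..<n} g) ^ 3 \<le> 1"
  using norm_T_le_1[of "{0..<n}" g] by (intro power_le_one) auto

text \<open>Chernoff bound: give each outlier the weight \<open>x < 1\<close> and divide by the smallest total weight
\<open>x powr (\<delta> * n)\<close>.\<close>

lemma card_near_le:
  assumes c: "c \<in> carrier G" and L: "L \<subseteq> carrier G" and x: "0 < x" "x < (1::real)"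
  shows "real (card (near n \<delta> L c)) \<le> ((real (card L) + x * real N) * x powr (- \<delta>)) ^ n"
proof -
  let ?A = "{0..<n}" let ?K = "{k. 1 \<le> k \<and> real k \<le> \<delta> * real n} \<inter> {..n}"
  have fL: "finite L" using L fin finite_subset by blast
  have fK: "finite ?K" by simp
  have K: "card (outliers ?A L c g) \<in> {k. 1 \<le> k \<and> real k \<le> \<delta> * real n} \<longleftrightarrow> card (outliers ?A L c g) \<in> ?K" for g
  proof -
    have "card (outliers ?A L c g) \<le> card ?A" by (intro card_mono) (auto simp: outliers_def)
    then show ?thesis by simp
  qed
  have "real (card (near n \<delta> L c)) = (\<Sum>g\<in>near n \<delta> L c. 1)" by simp
  also have "\<dots> \<le> (\<Sum>S\<in>{S. S \<subseteq> ?A \<and> card S \<in> ?K}. \<Sum>w\<in>PiE S (\<lambda>_. carrier G - L). \<Sum>l\<in>PiE (?A - S) (\<lambda>_. L). 1)"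
    unfolding near_def K by (rule sum_near_le[OF _ c L]) auto
  also have "\<dots> \<le> (\<Sum>S\<in>{S. S \<subseteq> ?A \<and> card S \<in> ?K}. real N ^ card S * real (card L) ^ (n - card S))"
  proof (rule sum_mono)
    fix S assume S: "S \<in> {S. S \<subseteq> ?A \<and> card S \<in> ?K}"
    then have fS: "finite S" by (auto intro: finite_subset)
    have cAS: "card (?A - S) = n - card S" using S fS by (subst card_Diff_subset) auto
    have "(\<Sum>w\<in>PiE S (\<lambda>_. carrier G - L). \<Sum>l\<in>PiE (?A - S) (\<lambda>_. L). 1) = real (card (carrier G - L)) ^ card S * real (card L) ^ (n - card S)"
      using fS by (simp add: card_PiE cAS)
    also have "\<dots> \<le> real N ^ card S * real (card L) ^ (n - card S)"
      using fin by (intro mult_right_mono power_mono) (auto intro: card_mono)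
    finally show "(\<Sum>w\<in>PiE S (\<lambda>_. carrier G - L). \<Sum>l\<in>PiE (?A - S) (\<lambda>_. L). 1) \<le> real N ^ card S * real (card L) ^ (n - card S)" .
  qed
  also have "\<dots> = (\<Sum>k\<in>?K. real (n choose k) * (real N ^ k * real (card L) ^ (n - k)))"
    using sum_subsets_by_card[OF _ fK, of ?A "\<lambda>k. real N ^ k * real (card L) ^ (n - k)"] by simp
  also have "\<dots> \<le> (\<Sum>k\<in>?K. (x powr (- \<delta>)) ^ n * (real (n choose k) * ((x * real N) ^ k * real (card L) ^ (n - k))))"
  proof (rule sum_mono)
    fix k assume k: "k \<in> ?K"
    have "1 = x powr (- real k) * x ^ k" using x by (simp add: powr_minus powr_realpow)
    also have "\<dots> \<le> x powr (- \<delta> * real n) * x ^ k"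
      using k x by (intro mult_right_mono powr_mono') auto
    also have "x powr (- \<delta> * real n) = (x powr (- \<delta>)) ^ n"
      using x by (simp add: powr_powr powr_realpow[symmetric])
    finally have "real (n choose k) * (real N ^ k * real (card L) ^ (n - k)) * 1 \<le>
        real (n choose k) * (real N ^ k * real (card L) ^ (n - k)) * ((x powr (- \<delta>)) ^ n * x ^ k)"
      by (intro mult_left_mono) auto
    then show "real (n choose k) * (real N ^ k * real (card L) ^ (n - k)) \<le>
      (x powr (- \<delta>)) ^ n * (real (n choose k) * ((x * real N) ^ k * real (card L) ^ (n - k)))"
      by (simp add: power_mult_distrib mult_ac)
  qed
  also have "\<dots> \<le> (\<Sum>k\<le>n. (x powr (- \<delta>)) ^ n * (real (n choose k) * ((x * real N) ^ k * real (card L) ^ (n - k))))"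
    using x by (intro sum_mono2) auto
  also have "\<dots> = (x powr (- \<delta>)) ^ n * (x * real N + real (card L)) ^ n"
    unfolding sum_distrib_left[symmetric] by (simp add: binomial_ring mult.assoc)
  also have "\<dots> = ((real (card L) + x * real N) * x powr (- \<delta>)) ^ n"
    by (simp add: power_mult_distrib add.commute mult.commute)
  finally show ?thesis .
qed

text \<open>Near a subgroup smaller than a Lagrangian one there are exponentially fewer than \<open>sqrt N ^ n\<close>
assignments, so bounding \<open>T\<close> by 1 suffices.\<close>

lemma near_small_tendsto_0:
  assumes L: "L \<subseteq> carrier G" "(card L)\<^sup>2 < N"
  shows "\<forall>\<^sub>F \<delta> in at_right 0. \<forall>c\<in>carrier G.
    (\<lambda>m. (\<Sum>g\<in>near (2 * m) \<delta> L c. norm (T {0..<2 * m} g) ^ 3) / real N ^ m) \<longlonglongrightarrow> 0"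
proof -
  let ?r = "sqrt (real N)"
  have r: "real (card L) < ?r"
  proof -
    have "(real (card L))\<^sup>2 < real N" using L(2) by (simp flip: of_nat_power)
    then show ?thesis by (rule real_less_rsqrt)
  qed
  have r0: "?r > 0" using N_pos by simp
  (* Half of the gap between \<open>card L\<close> and \<open>sqrt N\<close> is spent on \<open>x\<close>, so that \<open>q < 1\<close>; the other half is
     spent on \<open>\<delta>\<close>, since \<open>x powr (- \<delta>)\<close> tends to 1. *)
  define x where "x = min (1 / 2) ((?r - real (card L)) / (2 * real N))"
  have x: "0 < x" "x < 1" using r N_pos by (auto simp: x_def)
  define q where "q = (real (card L) + x * real N) / ?r"
  have "x * real N \<le> (?r - real (card L)) / (2 * real N) * real N"
    unfolding x_def by (intro mult_right_mono) auto
  also have "\<dots> = (?r - real (card L)) / 2" using N_pos by simp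
  finally have "real (card L) + x * real N \<le> (real (card L) + ?r) / 2" by (simp add: field_simps)
  also have "\<dots> < ?r" using r by simp
  finally have "real (card L) + x * real N < ?r" .
  then have q: "q < 1" using r0 by (simp add: q_def)
  have "((\<lambda>\<delta>. q * x powr (- \<delta>)) \<longlongrightarrow> q * x powr (- 0)) (at_right 0)"
    using x by (intro tendsto_intros) auto
  then have "((\<lambda>\<delta>. q * x powr (- \<delta>)) \<longlongrightarrow> q) (at_right 0)" using x by simp
  then have "\<forall>\<^sub>F \<delta> in at_right 0. q * x powr (- \<delta>) < 1" using q by (rule order_tendstoD)
  then show ?thesis
  proof (rule eventually_mono)
    fix \<delta> assume d: "q * x powr (- \<delta>) < 1"
    define \<theta> where "\<theta> = q * x powr (- \<delta>)"
    have \<theta>: "0 \<le> \<theta>" "\<theta> < 1" using d x r0 by (auto simp: \<theta>_def q_def)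
    have bd: "(\<Sum>g\<in>near (2 * m) \<delta> L c. norm (T {0..<2 * m} g) ^ 3) / real N ^ m \<le> (\<theta>\<^sup>2) ^ m" if c: "c \<in> carrier G" for c m
    proof -
      have "(\<Sum>g\<in>near (2 * m) \<delta> L c. norm (T {0..<2 * m} g) ^ 3) \<le> (\<Sum>g\<in>near (2 * m) \<delta> L c. 1)"
        by (intro sum_mono norm_T_cube_le_1) (auto simp: near_def)
      also have "\<dots> = real (card (near (2 * m) \<delta> L c))" by simp
      also have "\<dots> \<le> ((real (card L) + x * real N) * x powr (- \<delta>)) ^ (2 * m)" by (rule card_near_le[OF c L(1) x])
      also have "(real (card L) + x * real N) * x powr (- \<delta>) = ?r * \<theta>" using r0 by (simp add: \<theta>_def q_def)
      also have "(?r * \<theta>) ^ (2 * m) = real N ^ m * (\<theta>\<^sup>2) ^ m"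
        by (simp add: power_mult power_mult_distrib)
      finally show ?thesis using N_pos by (simp add: field_simps)
    qed
    have t: "(\<lambda>m. (\<theta>\<^sup>2) ^ m) \<longlonglongrightarrow> 0" 
      using \<theta> by (intro LIMSEQ_realpow_zero) (simp_all add: abs_square_less_1)
    show "\<forall>c\<in>carrier G. (\<lambda>m. (\<Sum>g\<in>near (2 * m) \<delta> L c. norm (T {0..<2 * m} g) ^ 3) / real N ^ m) \<longlonglongrightarrow> 0"
    proof
      fix c assume "c \<in> carrier G"
      then show "(\<lambda>m. (\<Sum>g\<in>near (2 * m) \<delta> L c. norm (T {0..<2 * m} g) ^ 3) / real N ^ m) \<longlonglongrightarrow> 0"
        using bd by (intro tendsto_sandwich[OF _ _ tendsto_const t] always_eventually allI) (auto intro!: divide_nonneg_nonneg sum_nonneg)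
    qed
  qed
qed

lemma near_lagrangian_tendsto_0:
  assumes L: "lagrangian L" "(card L)\<^sup>2 = N" and \<delta>: "8 * \<delta> \<le> 1" "9000 * real N * sqrt \<delta> \<le> 1 / 2" and c: "c \<in> carrier G"
  shows "(\<lambda>m. (\<Sum>g\<in>near (2 * m) \<delta> L c. norm (T {0..<2 * m} g) ^ 3) / real N ^ m) \<longlonglongrightarrow> 0"
proof -
  let ?D = "9000 * real N"
  have bd: "(\<Sum>g\<in>near (2 * m) \<delta> L c. norm (T {0..<2 * m} g) ^ 3) / real N ^ m \<le> 8 * ?D / sqrt (real (2 * m))" if "m > 0" for m
  proof -
    have "(\<Sum>g\<in>near (2 * m) \<delta> L c. norm (T {0..<2 * m} g) ^ 3) \<le> real (card L) ^ (2 * m) * (8 * ?D / sqrt (real (2 * m)))"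
      by (rule near_lagrangian_bound[OF L c _ _ \<delta>(1) refl \<delta>(2)]) (use that in auto)
    also have "real (card L) ^ (2 * m) = real N ^ m"
      using L(2) by (simp add: power_mult flip: of_nat_power)
    finally show ?thesis using N_pos by (simp add: field_simps)
  qed
  have t: "(\<lambda>m. 8 * ?D / sqrt (real (2 * m))) \<longlonglongrightarrow> 0" by real_asymp
  have ev: "\<forall>\<^sub>F m in sequentially. (\<Sum>g\<in>near (2 * m) \<delta> L c. norm (T {0..<2 * m} g) ^ 3) / real N ^ m \<le> 8 * ?D / sqrt (real (2 * m))"
    using eventually_gt_at_top[of 0] by (rule eventually_mono) (rule bd)
  show ?thesis
    by (rule tendsto_sandwich[OF always_eventually ev tendsto_const t]) (auto intro!: divide_nonneg_nonneg sum_nonneg)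
qed

definition far :: "nat \<Rightarrow> real \<Rightarrow> (nat \<Rightarrow> 'a) set" where
  "far n \<delta> = {g\<in>PiE {0..<n} (\<lambda>_. carrier G). \<forall>L c. isotropic L \<longrightarrow> c \<in> carrier G \<longrightarrow>
     real (card (outliers {0..<n} L c g)) > \<delta> * real n}"

lemma isotropic_generate:
  assumes S: "S \<subseteq> carrier G" and B: "\<And>x y. x \<in> S \<Longrightarrow> y \<in> S \<Longrightarrow> B x y = 1"
  shows "isotropic (generate G S)"
proof -
  have gc: "x \<in> carrier G" if "x \<in> generate G S" for x using generate_in_carrier[OF S that] .
  have 1: "B x y = 1" if "x \<in> generate G S" "y \<in> S" for x y
    using that
  proof (induction rule: generate.induct)
    case (inv h) then show ?case using B_inv(1)[of h y] B S by auto
  next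
    case (eng h1 h2) then show ?case using B_left gc S by auto
  qed (use B B_one S in auto)
  have 2: "B x y = 1" if y: "y \<in> generate G S" and x: "x \<in> generate G S" for x y
    using y
  proof (induction rule: generate.induct)
    case one then show ?case using B_one gc[OF x] by simp
  next
    case (incl h) then show ?case using 1[OF x] by simp
  next
    case (inv h) then show ?case using B_inv(2)[of h x] 1[OF x] S gc[OF x] by auto
  next
    case (eng h1 h2) then show ?case using B_right gc x by auto
  qed
  then show ?thesis unfolding isotropic_def using generate_is_subgroup[OF S] by blast
qed

text \<open>If the differences of the frequent values annihilated each other, they would generate an isotropic
subgroup, one of whose cosets would contain all but few of the values.\<close>

lemma far_quadruple:
  assumes g: "g \<in> far n \<delta>" and n: "n > 0" and \<epsilon>: "real N * \<epsilon> \<le> \<delta>" "\<delta> < 1" "0 < \<epsilon>"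
  obtains a b c d where "{a, b, c, d} \<subseteq> carrier G" "B (a \<otimes> inv b) (c \<otimes> inv d) \<noteq> 1"
    "\<And>v. v \<in> {a, b, c, d} \<Longrightarrow> real (card {i\<in>{0..<n}. g i = v}) \<ge> \<epsilon> * real n"
proof -
  let ?A = "{0..<n}"
  have gc: "g i \<in> carrier G" if "i < n" for i using g that by (auto simp: far_def)
  (* The frequent values. All other values together occur at most \<open>\<delta> * n\<close> times. *)
  define S where "S = {v\<in>carrier G. real (card {i\<in>?A. g i = v}) \<ge> \<epsilon> * real n}"
  have rare: "real (card {i\<in>?A. g i \<notin> S}) \<le> \<delta> * real n"
  proof -
    have eq: "{i\<in>?A. g i \<notin> S} = (\<Union>v\<in>carrier G - S. {i\<in>?A. g i = v})" using gc by auto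
    have le: "card {i\<in>?A. g i \<notin> S} \<le> (\<Sum>v\<in>carrier G - S. card {i\<in>?A. g i = v})"
      unfolding eq by (rule card_UN_le) (use fin in simp)
    have "real (card {i\<in>?A. g i \<notin> S}) \<le> (\<Sum>v\<in>carrier G - S. real (card {i\<in>?A. g i = v}))"
      using of_nat_mono[OF le, where 'a = real] by (simp only: of_nat_sum)
    also have "\<dots> \<le> (\<Sum>v\<in>carrier G - S. \<epsilon> * real n)" by (intro sum_mono) (auto simp: S_def)
    also have "\<dots> = real (card (carrier G - S)) * (\<epsilon> * real n)" by simp
    also have "\<dots> \<le> real N * (\<epsilon> * real n)"
      using fin \<epsilon> by (intro mult_right_mono) (auto intro: card_mono)
    also have "\<dots> \<le> \<delta> * real n" using \<epsilon>(1) by (simp add: mult.assoc[symmetric] mult_right_mono)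
    finally show ?thesis .
  qed
  have "S \<noteq> {}"
  proof
    assume "S = {}"
    then have "real n \<le> \<delta> * real n" using rare by simp
    then show False using \<epsilon>(2) n by simp
  qed
  then obtain c0 where c0: "c0 \<in> S" by blast
  have Sc: "S \<subseteq> carrier G" by (auto simp: S_def)
  define X where "X = {a \<otimes> inv b | a b. a \<in> S \<and> b \<in> S}"
  have Xc: "X \<subseteq> carrier G" using Sc by (auto simp: X_def)
  have "\<not> (\<forall>x\<in>X. \<forall>y\<in>X. B x y = 1)"
  proof
    assume "\<forall>x\<in>X. \<forall>y\<in>X. B x y = 1"
    then have iso: "isotropic (generate G X)" using isotropic_generate[OF Xc] by blast
    have "outliers ?A (generate G X) c0 g \<subseteq> {i\<in>?A. g i \<notin> S}"
    proof
      fix i assume i: "i \<in> outliers ?A (generate G X) c0 g"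
      have "g i \<notin> S"
      proof
        assume "g i \<in> S"
        then have "g i \<otimes> inv c0 \<in> X" using c0 by (auto simp: X_def)
        then have "g i \<otimes> inv c0 \<in> generate G X" by (rule generate.incl)
        moreover have "inv c0 \<otimes> g i = g i \<otimes> inv c0" using c0 Sc \<open>g i \<in> S\<close> by (intro m_comm) auto
        ultimately show False using i by (simp add: outliers_def)
      qed
      then show "i \<in> {i\<in>?A. g i \<notin> S}" using i by (simp add: outliers_def)
    qed
    then have "card (outliers ?A (generate G X) c0 g) \<le> card {i\<in>?A. g i \<notin> S}" by (intro card_mono) auto
    moreover have "real (card (outliers ?A (generate G X) c0 g)) > \<delta> * real n"
      using g iso c0 Sc by (auto simp: far_def)
    ultimately show False using rare by linarith
  qed
  then obtain a b c d where "a \<in> S" "b \<in> S" "c \<in> S" "d \<in> S" "B (a \<otimes> inv b) (c \<otimes> inv d) \<noteq> 1"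
    unfolding X_def by blast
  then show thesis using that[of a b c d] by (auto simp: S_def)
qed

lemma uniform_gap: "\<exists>\<rho><1. \<forall>x\<in>carrier G. \<forall>y\<in>carrier G. B x y \<noteq> 1 \<longrightarrow> norm (1 + B x y) \<le> 2 * \<rho>"
proof -
  define X where "X = insert 0 ((\<lambda>(x, y). norm (1 + B x y) / 2) ` {(x, y). x \<in> carrier G \<and> y \<in> carrier G \<and> B x y \<noteq> 1})"
  have "finite {(x, y). x \<in> carrier G \<and> y \<in> carrier G \<and> B x y \<noteq> 1}"
    by (rule finite_subset[of _ "carrier G \<times> carrier G"]) (use fin in auto)
  then have fX: "finite X" by (simp add: X_def)
  have lt: "v < 1" if "v \<in> X" for v
  proof -
    have "norm (1 + w) < 2" if "norm w = 1" "w \<noteq> 1" for w :: complex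
    proof (rule ccontr)
      assume "\<not> norm (1 + w) < 2"
      then have "2\<^sup>2 \<le> (norm (1 + w))\<^sup>2" by (intro power_mono) auto
      also have "(norm (1 + w))\<^sup>2 = 2 + 2 * Re w"
        using that(1) by (simp add: cmod_power2 power2_sum) (metis cmod_power2 one_power2)
      finally have "Re w \<ge> 1" by simp
      moreover have "(Re w)\<^sup>2 + (Im w)\<^sup>2 = 1" using that(1) by (metis cmod_power2 one_power2)
      moreover have "Re w \<le> 1" using complex_Re_le_cmod[of w] that(1) by simp
      ultimately have "Re w = 1" "Im w = 0" by auto
      then show False using that(2) by (simp add: complex_eq_iff)
    qed
    then show ?thesis using that norm_B by (fastforce simp: X_def)
  qed
  show ?thesis
  proof (intro exI conjI ballI impI)
    show "Max X < 1" using fX lt by (subst Max_less_iff) (auto simp: X_def)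
    fix x y assume "x \<in> carrier G" "y \<in> carrier G" "B x y \<noteq> 1"
    then have "norm (1 + B x y) / 2 \<in> X" by (auto simp: X_def)
    then have "norm (1 + B x y) / 2 \<le> Max X" by (rule Max_ge[OF fX])
    then show "norm (1 + B x y) \<le> 2 * Max X" by simp
  qed
qed

text \<open>Far from all isotropic cosets \<open>T\<close> decays exponentially. One factor of the cube uses this decay, and
the other two are bounded by the second moment, which grows only polynomially.\<close>

lemma far_tendsto_0:
  assumes \<delta>: "0 < \<delta>" "\<delta> < 1"
  shows "(\<lambda>m. (\<Sum>g\<in>far (2 * m) \<delta>. norm (T {0..<2 * m} g) ^ 3) / real N ^ m) \<longlonglongrightarrow> 0"
proof -
  obtain \<rho> where \<rho>: "\<rho> < 1" "\<And>x y. x \<in> carrier G \<Longrightarrow> y \<in> carrier G \<Longrightarrow> B x y \<noteq> 1 \<Longrightarrow> norm (1 + B x y) \<le> 2 * \<rho>"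
    using uniform_gap by blast
  define \<rho>' where "\<rho>' = max \<rho> 0"
  have \<rho>': "\<rho>' < 1" "0 \<le> \<rho>'" "\<And>x y. x \<in> carrier G \<Longrightarrow> y \<in> carrier G \<Longrightarrow> B x y \<noteq> 1 \<Longrightarrow> norm (1 + B x y) \<le> 2 * \<rho>'"
    using \<rho> by (force simp: \<rho>'_def)+
  define \<epsilon> where "\<epsilon> = \<delta> / real N"
  have \<epsilon>0: "0 < \<epsilon>" "real N * \<epsilon> \<le> \<delta>" using \<delta> N_pos by (auto simp: \<epsilon>_def)
  have \<epsilon>1: "\<epsilon> < 1"
  proof -
    have "\<delta> / real N \<le> \<delta> / 1" using N_pos \<delta> by (intro divide_left_mono) auto
    then show ?thesis using \<delta> by (simp add: \<epsilon>_def)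
  qed
  define \<kappa> where "\<kappa> = 1 - (1 - \<rho>') * (\<epsilon> / 2)\<^sup>2"
  have sq: "0 < (\<epsilon> / 2)\<^sup>2" "(\<epsilon> / 2)\<^sup>2 < 1" using \<epsilon>0 \<epsilon>1 by (auto intro!: power_Suc_less_one simp: power_less_one_iff abs_square_less_1)
  have \<kappa>: "0 < \<kappa>" "\<kappa> < 1"
  proof -
    have "(1 - \<rho>') * (\<epsilon> / 2)\<^sup>2 \<le> 1 * (\<epsilon> / 2)\<^sup>2" using \<rho>' sq by (intro mult_right_mono) auto
    then show "0 < \<kappa>" using sq(2) unfolding \<kappa>_def by linarith
    have "0 < (1 - \<rho>') * (\<epsilon> / 2)\<^sup>2" using \<rho>' sq by (intro mult_pos_pos) auto
    then show "\<kappa> < 1" by (simp add: \<kappa>_def)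
  qed
  define \<theta> where "\<theta> = \<kappa> powr (\<epsilon> / 4)"
  have \<theta>: "0 < \<theta>" "\<theta> < 1"
    using \<kappa> \<epsilon>0 powr_less_mono2[of "\<epsilon> / 4" \<kappa> 1] by (simp_all add: \<theta>_def)
  have pt: "norm (T {0..<2 * m} g) \<le> \<theta> ^ m / \<kappa>" if g: "g \<in> far (2 * m) \<delta>" and m: "m > 0" for g m
  proof -
    let ?n = "2 * m"
    have n0: "?n > 0" using m by simp
    obtain a b c d where abcd: "{a, b, c, d} \<subseteq> carrier G" "B (a \<otimes> inv b) (c \<otimes> inv d) \<noteq> 1"
      "\<And>v. v \<in> {a, b, c, d} \<Longrightarrow> real (card {i\<in>{0..<?n}. g i = v}) \<ge> \<epsilon> * real ?n"
      by (rule far_quadruple[OF g n0 \<epsilon>0(2) \<delta>(2) \<epsilon>0(1)]) (rule that; assumption)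
    (* The four frequent values occur at least \<open>2 * \<epsilon> * m\<close> times; half of the occurrences is kept as
       the reserve \<open>s\<close> and the other half allows \<open>j\<close> rounds at four vertices each. *)
    define j where "j = nat \<lfloor>\<epsilon> * real m / 4\<rfloor>"
    have j: "real j \<le> \<epsilon> * real m / 4" "real j \<ge> \<epsilon> * real m / 4 - 1"
      using \<epsilon>0 by (auto simp: j_def) linarith+
    have "norm (T {0..<?n} g) \<le> (1 - (1 - \<rho>') * ((\<epsilon> * real ?n / 2) / real ?n)\<^sup>2) ^ j"
    proof (rule norm_T_far[OF abcd(1) _ \<rho>'(1)])
      show "norm (1 + B (a \<otimes> inv b) (c \<otimes> inv d)) \<le> 2 * \<rho>'" using abcd by (intro \<rho>'(3)) auto
      show "0 \<le> \<epsilon> * real ?n / 2" "\<epsilon> * real ?n / 2 \<le> real ?n"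
        using \<epsilon>0 \<epsilon>1 mult_right_mono[of \<epsilon> 2 "real m"] by auto
      show "g \<in> {0..<?n} \<rightarrow> carrier G" using g by (auto simp: far_def)
      fix v assume "v \<in> {a, b, c, d}"
      then show "4 * real j + \<epsilon> * real ?n / 2 \<le> real (card {i\<in>{0..<?n}. g i = v})"
        using abcd(3)[of v] j(1) by simp
    qed auto
    also have "1 - (1 - \<rho>') * ((\<epsilon> * real ?n / 2) / real ?n)\<^sup>2 = \<kappa>" using m by (simp add: \<kappa>_def)
    also have "\<kappa> ^ j = \<kappa> powr real j" using \<kappa> by (simp add: powr_realpow)
    also have "\<dots> \<le> \<kappa> powr (\<epsilon> / 4 * real m - 1)" using \<kappa> j by (intro powr_mono') auto
    also have "\<dots> = \<theta> powr real m / \<kappa>" unfolding \<theta>_def powr_powr using \<kappa> by (simp add: powr_diff)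
    also have "\<dots> = \<theta> ^ m / \<kappa>" using \<theta> by (simp add: powr_realpow)
    finally show ?thesis .
  qed
  have bd: "(\<Sum>g\<in>far (2 * m) \<delta>. norm (T {0..<2 * m} g) ^ 3) / real N ^ m \<le> 1 / \<kappa> * (\<theta> ^ m * real (m + 1) ^ N)" if m: "m > 0" for m
  proof -
    have ff: "finite (PiE {0..<2 * m} (\<lambda>_. carrier G))" using fin by (intro finite_PiE) auto
    have "(\<Sum>g\<in>far (2 * m) \<delta>. norm (T {0..<2 * m} g) ^ 3) \<le> (\<Sum>g\<in>far (2 * m) \<delta>. \<theta> ^ m / \<kappa> * (norm (T {0..<2 * m} g))\<^sup>2)"
    proof (rule sum_mono)
      fix g assume "g \<in> far (2 * m) \<delta>"
      from mult_right_mono[OF pt[OF this m], of "(norm (T {0..<2 * m} g))\<^sup>2"]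
      show "norm (T {0..<2 * m} g) ^ 3 \<le> \<theta> ^ m / \<kappa> * (norm (T {0..<2 * m} g))\<^sup>2"
        by (simp add: power3_eq_cube power2_eq_square mult.assoc)
    qed
    also have "\<dots> = \<theta> ^ m / \<kappa> * (\<Sum>g\<in>far (2 * m) \<delta>. (norm (T {0..<2 * m} g))\<^sup>2)" by (simp add: sum_distrib_left)
    also have "\<dots> \<le> \<theta> ^ m / \<kappa> * (\<Sum>g\<in>PiE {0..<2 * m} (\<lambda>_. carrier G). (norm (T {0..<2 * m} g))\<^sup>2)"
      using \<theta> \<kappa> ff by (intro mult_left_mono sum_mono2) (auto simp: far_def)
    also have "\<dots> \<le> \<theta> ^ m / \<kappa> * (real N ^ m * real (m + 1) ^ N)"
      using \<theta> \<kappa> by (intro mult_left_mono second_moment_poly) auto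
    also have "\<dots> = real N ^ m * (1 / \<kappa> * (\<theta> ^ m * real (m + 1) ^ N))" by simp
    finally show ?thesis using N_pos by (simp add: pos_divide_le_eq mult.commute)
  qed
  have "(\<lambda>m. 1 / \<kappa> * (\<theta> ^ m * real (m + 1) ^ N)) \<longlonglongrightarrow> 1 / \<kappa> * 0"
    by (intro tendsto_mult tendsto_const power_times_poly_tendsto_0 \<theta>)
  then have t: "(\<lambda>m. 1 / \<kappa> * (\<theta> ^ m * real (m + 1) ^ N)) \<longlonglongrightarrow> 0" by simp
  have ev: "\<forall>\<^sub>F m in sequentially. (\<Sum>g\<in>far (2 * m) \<delta>. norm (T {0..<2 * m} g) ^ 3) / real N ^ m \<le> 1 / \<kappa> * (\<theta> ^ m * real (m + 1) ^ N)"
    using eventually_gt_at_top[of 0] by (rule eventually_mono) (rule bd)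
  show ?thesis
    by (rule tendsto_sandwich[OF always_eventually ev tendsto_const t]) (auto intro!: divide_nonneg_nonneg sum_nonneg)
qed

text \<open>On all other assignments \<open>T\<close> has modulus 1 when the number of vertices is even, since translating
a coset of an isotropic subgroup to the subgroup itself makes all edge weights equal to 1.\<close>

definition unconfined :: "nat \<Rightarrow> (nat \<Rightarrow> 'a) set" where
  "unconfined n = {g\<in>PiE {0..<n} (\<lambda>_. carrier G).
     \<not> (\<exists>L c. isotropic L \<and> c \<in> carrier G \<and> (\<forall>i<n. inv c \<otimes> g i \<in> L))}"

text \<open>An unconfined assignment is far from all isotropic cosets, or it lies near a coset of some isotropic
subgroup and has at least one outlier. By \<open>isotropic_card\<close> that subgroup is Lagrangian or has
fewer than \<open>sqrt N\<close> elements, so one of the three preceding estimates applies.\<close>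

theorem unconfined_tendsto_0:
  "(\<lambda>m. (\<Sum>g\<in>unconfined (2 * m). norm (T {0..<2 * m} g) ^ 3) / real N ^ m) \<longlonglongrightarrow> 0"
proof -
  let ?I = "Collect isotropic" and ?f = "\<lambda>m g. norm (T {0..<2 * m} g) ^ 3"
  have Lc: "L \<subseteq> carrier G" if "isotropic L" for L using that by (simp add: isotropic_def subgroup.subset)
  have fI: "finite ?I"
    by (rule finite_subset[of _ "Pow (carrier G)"]) (use fin Lc in blast)+
  have 1: "\<forall>\<^sub>F \<delta> in at_right 0. \<forall>L\<in>{L\<in>?I. (card L)\<^sup>2 < N}. \<forall>c\<in>carrier G.
    (\<lambda>m. (\<Sum>g\<in>near (2 * m) \<delta> L c. ?f m g) / real N ^ m) \<longlonglongrightarrow> 0"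
    using fI by (intro eventually_ball_finite ballI near_small_tendsto_0) (simp_all add: Lc)
  have 2: "\<forall>\<^sub>F \<delta>::real in at_right 0. 8 * \<delta> < 1"
  proof -
    have "((\<lambda>\<delta>::real. 8 * \<delta>) \<longlongrightarrow> 8 * 0) (at_right 0)" by (intro tendsto_intros)
    then show ?thesis by (rule order_tendstoD) simp
  qed
  have 3: "\<forall>\<^sub>F \<delta> in at_right 0. 9000 * real N * sqrt \<delta> < 1 / 2"
  proof -
    have "((\<lambda>\<delta>::real. 9000 * real N * sqrt \<delta>) \<longlongrightarrow> 9000 * real N * sqrt 0) (at_right 0)" by (intro tendsto_intros)
    then show ?thesis by (rule order_tendstoD) simp
  qed
  have 4: "\<forall>\<^sub>F \<delta>::real in at_right 0. 0 < \<delta>" by (rule eventually_at_right_less)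
  (* One \<open>\<delta>\<close> serves the finitely many isotropic subgroups simultaneously. *)
  have "\<exists>\<delta>>0. 8 * \<delta> < 1 \<and> 9000 * real N * sqrt \<delta> < 1 / 2 \<and> (\<forall>L\<in>{L\<in>?I. (card L)\<^sup>2 < N}. \<forall>c\<in>carrier G.
    (\<lambda>m. (\<Sum>g\<in>near (2 * m) \<delta> L c. ?f m g) / real N ^ m) \<longlonglongrightarrow> 0)"
    using eventually_happens[OF eventually_conj[OF 4 eventually_conj[OF 2 eventually_conj[OF 3 1]]]] by auto
  then obtain \<delta> where \<delta>: "0 < \<delta>" "8 * \<delta> < 1" "9000 * real N * sqrt \<delta> < 1 / 2"
    and small: "\<And>L c. isotropic L \<Longrightarrow> (card L)\<^sup>2 < N \<Longrightarrow> c \<in> carrier G \<Longrightarrow>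
       (\<lambda>m. (\<Sum>g\<in>near (2 * m) \<delta> L c. ?f m g) / real N ^ m) \<longlonglongrightarrow> 0" by blast
  have nr: "(\<lambda>m. (\<Sum>g\<in>near (2 * m) \<delta> L c. ?f m g) / real N ^ m) \<longlonglongrightarrow> 0" if "L \<in> ?I" "c \<in> carrier G" for L c
  proof (cases "(card L)\<^sup>2 < N")
    case True then show ?thesis using small that by auto
  next
    case False
    then have "(card L)\<^sup>2 = N" using isotropic_card(1) that by (simp add: le_antisym)
    then show ?thesis using isotropic_card(2) that \<delta> by (intro near_lagrangian_tendsto_0) auto
  qed
  have "(\<lambda>m. (\<Sum>g\<in>far (2 * m) \<delta>. ?f m g) / real N ^ m +
     (\<Sum>L\<in>?I. \<Sum>c\<in>carrier G. (\<Sum>g\<in>near (2 * m) \<delta> L c. ?f m g) / real N ^ m)) \<longlonglongrightarrow> 0 + (\<Sum>L\<in>?I. \<Sum>c\<in>carrier G. 0)"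
    using \<delta> by (intro tendsto_add tendsto_sum far_tendsto_0 nr) auto
  then have t: "(\<lambda>m. (\<Sum>g\<in>far (2 * m) \<delta>. ?f m g) / real N ^ m +
     (\<Sum>L\<in>?I. \<Sum>c\<in>carrier G. (\<Sum>g\<in>near (2 * m) \<delta> L c. ?f m g) / real N ^ m)) \<longlonglongrightarrow> 0" by simp
  have bd: "(\<Sum>g\<in>unconfined (2 * m). ?f m g) / real N ^ m \<le> (\<Sum>g\<in>far (2 * m) \<delta>. ?f m g) / real N ^ m +
     (\<Sum>L\<in>?I. \<Sum>c\<in>carrier G. (\<Sum>g\<in>near (2 * m) \<delta> L c. ?f m g) / real N ^ m)" for m
  proof -
    let ?n = "2 * m"
    have ff: "finite (PiE {0..<?n} (\<lambda>_. carrier G))" using fin by (intro finite_PiE) auto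
    have fnear: "finite (near ?n \<delta> L c)" for L c by (rule finite_subset[OF _ ff]) (auto simp: near_def)
    have ffar: "finite (far ?n \<delta>)" by (rule finite_subset[OF _ ff]) (auto simp: far_def)
    have "unconfined ?n \<subseteq> far ?n \<delta> \<union> (\<Union>L\<in>?I. \<Union>c\<in>carrier G. near ?n \<delta> L c)"
    proof
      fix g assume g: "g \<in> unconfined ?n"
      show "g \<in> far ?n \<delta> \<union> (\<Union>L\<in>?I. \<Union>c\<in>carrier G. near ?n \<delta> L c)"
      proof (cases "g \<in> far ?n \<delta>")
        case False
        then obtain L c where Lc: "isotropic L" "c \<in> carrier G" "real (card (outliers {0..<?n} L c g)) \<le> \<delta> * real ?n"
          using g by (auto simp: far_def unconfined_def not_less)
        have "outliers {0..<?n} L c g \<noteq> {}" using g Lc by (auto simp: unconfined_def outliers_def)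
        moreover have "finite (outliers {0..<?n} L c g)" by (simp add: outliers_def)
        ultimately have "card (outliers {0..<?n} L c g) \<ge> 1" by (simp add: Suc_leI card_gt_0_iff)
        then have "g \<in> near ?n \<delta> L c" using g Lc by (simp add: near_def unconfined_def)
        then show ?thesis using Lc by blast
      qed simp
    qed
    then have "(\<Sum>g\<in>unconfined ?n. ?f m g) \<le> (\<Sum>g\<in>far ?n \<delta> \<union> (\<Union>L\<in>?I. \<Union>c\<in>carrier G. near ?n \<delta> L c). ?f m g)"
      using ffar fnear fI fin by (intro sum_mono2) auto
    also have "\<dots> \<le> (\<Sum>g\<in>far ?n \<delta>. ?f m g) + (\<Sum>g\<in>(\<Union>L\<in>?I. \<Union>c\<in>carrier G. near ?n \<delta> L c). ?f m g)"
      using ffar fnear fI fin by (subst sum_Un) (auto intro!: sum_nonneg)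
    also have "(\<Sum>g\<in>(\<Union>L\<in>?I. \<Union>c\<in>carrier G. near ?n \<delta> L c). ?f m g) \<le> (\<Sum>L\<in>?I. \<Sum>g\<in>(\<Union>c\<in>carrier G. near ?n \<delta> L c). ?f m g)"
      using fI fin fnear by (intro sum_UNION_le) auto
    also have "\<dots> \<le> (\<Sum>L\<in>?I. \<Sum>c\<in>carrier G. \<Sum>g\<in>near ?n \<delta> L c. ?f m g)"
      using fin fnear by (intro sum_mono sum_UNION_le) auto
    finally have "(\<Sum>g\<in>unconfined ?n. ?f m g) / real N ^ m \<le> ((\<Sum>g\<in>far ?n \<delta>. ?f m g) +
       (\<Sum>L\<in>?I. \<Sum>c\<in>carrier G. \<Sum>g\<in>near ?n \<delta> L c. ?f m g)) / real N ^ m" by (simp add: divide_right_mono)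
    then show ?thesis by (simp add: add_divide_distrib sum_divide_distrib)
  qed
  show ?thesis
    by (rule tendsto_sandwich[OF always_eventually always_eventually tendsto_const t])
      (use bd in \<open>auto intro!: divide_nonneg_nonneg sum_nonneg\<close>)
qed

end

section \<open>Fourier expansion of the solution probability\<close>

text \<open>The evaluation pairing on the product of a group and its dual. Its symmetrization is the standard
hyperbolic form.\<close>

definition eval_pairing :: "'a \<times> ('a \<Rightarrow> complex) \<Rightarrow> 'a \<times> ('a \<Rightarrow> complex) \<Rightarrow> complex" where
  "eval_pairing s t = snd s (fst t)"

context comm_group begin

abbreviation V where "V \<equiv> carrier G"

text \<open>Antisymmetric bicharacters, curried into homomorphisms to the dual group. Their graphs are the
Lagrangian subgroups that project onto the group.\<close>

definition antisymmetric_forms :: "('a \<Rightarrow> 'a \<Rightarrow> complex) set" where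
  "antisymmetric_forms = {f \<in> PiE V (\<lambda>_. characters G).
     (\<forall>x\<in>V. \<forall>y\<in>V. \<forall>z\<in>V. f (x \<otimes> y) z = f x z * f y z) \<and> (\<forall>x\<in>V. \<forall>y\<in>V. f x y * f y x = 1)}"

text \<open>The equation \<open>C q = d q\<close> at the vertices of \<open>A\<close>, in multiplicative notation, where \<open>C\<close> is the
adjacency matrix of the union of the matchings.\<close>

definition hits :: "'v set \<Rightarrow> nat \<Rightarrow> ('v \<Rightarrow> 'a) \<Rightarrow> (nat \<Rightarrow> 'v \<Rightarrow> 'v) \<Rightarrow> bool" where
  "hits A d q M \<longleftrightarrow> (\<forall>i\<in>A. finprod G (\<lambda>k. q (M k i)) {0..<d} = q i [^] d)"

definition hit_prob :: "'v set \<Rightarrow> nat \<Rightarrow> ('v \<Rightarrow> 'a) \<Rightarrow> real" where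
  "hit_prob A d q = real (card {M \<in> PiE {0..<d} (\<lambda>_. matchings A). hits A d q M}) / real (card (matchings A)) ^ d"

definition differences :: "'v set \<Rightarrow> ('v \<Rightarrow> 'a) \<Rightarrow> 'a set" where
  "differences A q = {q i \<otimes> inv (q j) | i j. i \<in> A \<and> j \<in> A}"

text \<open>The differences have to generate, rather than the values, because the condition must be invariant
under translation of \<open>q\<close>.\<close>

definition full :: "'v set \<Rightarrow> ('v \<Rightarrow> 'a) set" where
  "full A = {q \<in> PiE A (\<lambda>_. V). generate G (differences A q) = V}"

lemma character_finprod:
  assumes "\<eta> \<in> characters G" "finite K" "h \<in> K \<rightarrow> V"
  shows "\<eta> (finprod G h K) = (\<Prod>k\<in>K. \<eta> (h k))"
  using assms(2,3)
proof (induction K rule: finite_induct)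
  case empty then show ?case using character_one[OF assms(1)] by simp
next
  case (insert k K)
  then show ?case using charactersD(2)[OF assms(1), of "h k" "finprod G h K"] by (simp add: Pi_iff)
qed

lemma pairing_eval:
  assumes fin: "finite V"
  shows "pairing (G \<times>\<times> dual_group G) eval_pairing"
proof -
  interpret D: comm_group "dual_group G" by (rule comm_group_dual)
  interpret P: group "G \<times>\<times> dual_group G" by (intro DirProd_group is_group D.is_group)
  interpret P: comm_group "G \<times>\<times> dual_group G"
    by (rule P.group_comm_groupI) (auto simp: m_comm mult.commute cong: restrict_cong)
  show ?thesis
  proof
    show "finite (carrier (G \<times>\<times> dual_group G))" using fin finite_characters by simp
    fix s assume s: "s \<in> carrier (G \<times>\<times> dual_group G)"
      and all: "\<And>t. t \<in> carrier (G \<times>\<times> dual_group G) \<Longrightarrow> eval_pairing s t * eval_pairing t s = 1"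
    obtain x \<eta> where s_eq: "s = (x, \<eta>)" "x \<in> V" "\<eta> \<in> characters G" using s by auto
    have "\<eta> = (\<lambda>x\<in>V. 1)"
    proof (rule characters_eqI[OF s_eq(3) trivial_character])
      fix y assume y: "y \<in> V"
      then show "\<eta> y = (\<lambda>x\<in>V. 1) y"
        using all[of "(y, \<lambda>x\<in>V. 1)"] s_eq trivial_character by (simp add: eval_pairing_def)
    qed
    moreover have "x = \<one>"
    proof (rule ccontr)
      assume "x \<noteq> \<one>"
      then obtain \<psi> where "\<psi> \<in> characters G" "\<psi> x \<noteq> 1" using exists_character_neq_one[OF fin s_eq(2)] by blast
      then show False using all[of "(\<one>, \<psi>)"] s_eq character_one[OF s_eq(3)] by (simp add: eval_pairing_def)
    qed
    ultimately show "s = \<one>\<^bsub>G \<times>\<times> dual_group G\<^esub>" using s_eq by simp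
  qed (auto simp: eval_pairing_def charactersD(2,3))
qed

lemma fourier_indicator:
  assumes "finite V" "v \<in> V"
  shows "(\<Sum>\<eta>\<in>characters G. \<eta> v) = of_nat (card V) * (if v = \<one> then 1 else 0)"
  using assms by (auto simp: sum_characters_at character_one card_characters)

text \<open>Expand the indicator of \<open>C q = d q\<close> into characters, with one character for each vertex. As the
matchings are independent and identically distributed, the expectation of the phase is the \<open>d\<close>-th
power of a mean weight for the evaluation pairing.\<close>

lemma hit_prob_fourier:
  assumes fin: "finite V" and A: "finite (A :: 'v set)" and q: "q \<in> A \<rightarrow> V"
  shows "of_real (hit_prob A d q) = (\<Sum>h\<in>PiE A (\<lambda>_. characters G).
    (\<Prod>i\<in>A. cnj (h i (q i)) ^ d) * mean_weight eval_pairing A (\<lambda>i. (q i, h i)) ^ d) / of_nat (card V) ^ card A"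
proof -
  let ?M = "PiE {0..<d} (\<lambda>_. matchings A)" and ?X = "PiE A (\<lambda>_. characters G)"
  let ?W = "\<lambda>h. matching_weight eval_pairing A (\<lambda>i. (q i, h i))"
  have fM: "finite (matchings A)" by (rule finite_matchings[OF A])
  have fPM: "finite ?M" using fM by (intro finite_PiE) auto
  have fX: "finite (characters G)" by (rule finite_characters[OF fin])
  have cl: "\<pi> i \<in> A" if "\<pi> \<in> matchings A" "i \<in> A" for \<pi> i
    using that permutes_in_image[of \<pi> A] by (auto simp: matchings_def)
  (* Orthogonality detects the equation at every vertex; the character sum splits over the \<open>d\<close> matchings. *)
  have ind: "of_nat (card V) ^ card A * (if hits A d q M then 1 else 0) =
     (\<Sum>h\<in>?X. (\<Prod>i\<in>A. cnj (h i (q i)) ^ d) * (\<Prod>k\<in>{0..<d}. ?W h (M k)))" if M: "M \<in> ?M" for M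
  proof -
    define v where "v i = finprod G (\<lambda>k. q (M k i)) {0..<d} \<otimes> inv (q i [^] d)" for i
    have qM: "q (M k i) \<in> V" if "k \<in> {0..<d}" "i \<in> A" for k i
      using funcset_mem[OF q cl[OF PiE_mem[OF M that(1)] that(2)]] .
    have fc: "finprod G (\<lambda>k. q (M k i)) {0..<d} \<in> V" if "i \<in> A" for i
      using qM that by (intro finprod_closed) auto
    have qi: "q i \<in> V" if "i \<in> A" for i using q that by auto
    have vV: "v i \<in> V" if "i \<in> A" for i using fc qi that by (simp add: v_def)
    have v1: "v i = \<one> \<longleftrightarrow> finprod G (\<lambda>k. q (M k i)) {0..<d} = q i [^] d" if "i \<in> A" for i
      unfolding v_def using fc[OF that] qi[OF that] by (metis inv_closed inv_equality inv_inv nat_pow_closed r_inv)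
    have "(\<Prod>i\<in>A. if v i = \<one> then 1 else 0 :: complex) = (if hits A d q M then 1 else 0)"
    proof (cases "hits A d q M")
      case True then show ?thesis using v1 by (auto simp: hits_def intro!: prod.neutral)
    next
      case False
      then have "\<exists>i\<in>A. v i \<noteq> \<one>" using v1 by (auto simp: hits_def)
      then show ?thesis using False A by (auto simp: prod_zero_iff)
    qed
    then have "of_nat (card V) ^ card A * (if hits A d q M then 1 else 0) =
       (\<Prod>i\<in>A. of_nat (card V) * (if v i = \<one> then 1 else 0 :: complex))"
      by (simp only: prod.distrib prod_constant)
    also have "\<dots> = (\<Prod>i\<in>A. \<Sum>\<eta>\<in>characters G. \<eta> (v i))"
      by (intro prod.cong refl fourier_indicator[OF fin, symmetric] vV)
    also have "\<dots> = (\<Sum>h\<in>?X. \<Prod>i\<in>A. h i (v i))"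
      by (rule prod_sum_PiE[OF A fX])
    also have "\<dots> = (\<Sum>h\<in>?X. (\<Prod>i\<in>A. cnj (h i (q i)) ^ d) * (\<Prod>k\<in>{0..<d}. ?W h (M k)))"
    proof (intro sum.cong refl)
      fix h assume h: "h \<in> ?X"
      have "(\<Prod>i\<in>A. h i (v i)) = (\<Prod>i\<in>A. cnj (h i (q i)) ^ d * (\<Prod>k\<in>{0..<d}. h i (q (M k i))))"
      proof (intro prod.cong refl)
        fix i assume i: "i \<in> A"
        then have hi: "h i \<in> characters G" using h by auto
        have "h i (v i) = (\<Prod>k\<in>{0..<d}. h i (q (M k i))) * cnj (h i (q i) ^ d)"
          unfolding v_def using fc[OF i] qi[OF i] qM i
          by (simp add: charactersD(2)[OF hi] character_inv(2)[OF hi] character_pow[OF hi] character_finprod[OF hi])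
        then show "h i (v i) = cnj (h i (q i)) ^ d * (\<Prod>k\<in>{0..<d}. h i (q (M k i)))" by (simp add: mult.commute)
      qed
      also have "\<dots> = (\<Prod>i\<in>A. cnj (h i (q i)) ^ d) * (\<Prod>k\<in>{0..<d}. \<Prod>i\<in>A. h i (q (M k i)))"
        unfolding prod.distrib by (subst (2) prod.swap) (rule refl)
      finally show "(\<Prod>i\<in>A. h i (v i)) = (\<Prod>i\<in>A. cnj (h i (q i)) ^ d) * (\<Prod>k\<in>{0..<d}. ?W h (M k))"
        by (simp add: matching_weight_def eval_pairing_def)
    qed
    finally show ?thesis .
  qed
  have "of_nat (card V) ^ card A * of_nat (card {M \<in> ?M. hits A d q M}) =
     (\<Sum>M\<in>?M. of_nat (card V) ^ card A * (if hits A d q M then 1 else 0 :: complex))"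
    unfolding sum_distrib_left[symmetric] using fPM by (simp flip: sum.inter_filter)
  also have "\<dots> = (\<Sum>M\<in>?M. \<Sum>h\<in>?X. (\<Prod>i\<in>A. cnj (h i (q i)) ^ d) * (\<Prod>k\<in>{0..<d}. ?W h (M k)))"
    by (intro sum.cong refl ind)
  also have "\<dots> = (\<Sum>h\<in>?X. (\<Prod>i\<in>A. cnj (h i (q i)) ^ d) * (\<Prod>k\<in>{0..<d}. \<Sum>\<pi>\<in>matchings A. ?W h \<pi>))"
    unfolding prod_sum_PiE[OF finite_atLeastLessThan fM] sum_distrib_left by (rule sum.swap)
  finally have eq: "of_nat (card V) ^ card A * of_nat (card {M \<in> ?M. hits A d q M}) =
     (\<Sum>h\<in>?X. (\<Prod>i\<in>A. cnj (h i (q i)) ^ d) * (\<Sum>\<pi>\<in>matchings A. ?W h \<pi>) ^ d)" by simp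
  have V0: "of_nat (card V) ^ card A \<noteq> (0 :: complex)"
    using fin by (auto simp: card_eq_0_iff)
  have cancel: "x * y / z / x = y / z" if "x \<noteq> 0" for x y z :: complex using that by simp
  have "complex_of_real (hit_prob A d q) = (of_nat (card V) ^ card A * of_nat (card {M \<in> ?M. hits A d q M})) /
     of_nat (card (matchings A)) ^ d / of_nat (card V) ^ card A"
    unfolding hit_prob_def cancel[OF V0] by simp
  also have "\<dots> = (\<Sum>h\<in>?X. (\<Prod>i\<in>A. cnj (h i (q i)) ^ d) * mean_weight eval_pairing A (\<lambda>i. (q i, h i)) ^ d) / of_nat (card V) ^ card A"
  proof -
    have "(\<Sum>h\<in>?X. (\<Prod>i\<in>A. cnj (h i (q i)) ^ d) * (\<Sum>\<pi>\<in>matchings A. ?W h \<pi>) ^ d) / of_nat (card (matchings A)) ^ d =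
      (\<Sum>h\<in>?X. (\<Prod>i\<in>A. cnj (h i (q i)) ^ d) * mean_weight eval_pairing A (\<lambda>i. (q i, h i)) ^ d)"
      by (subst sum_divide_distrib) (simp add: mean_weight_def matching_avg_def power_divide)
    then show ?thesis unfolding eq by (rule arg_cong)
  qed
  finally show ?thesis .
qed

lemma mean_weight_antisymmetric:
  assumes "finite A" "even (card A)" "\<And>i j. i \<in> A \<Longrightarrow> j \<in> A \<Longrightarrow> \<beta> (g i) (g j) * \<beta> (g j) (g i) = 1"
  shows "mean_weight \<beta> A g = 1"
  using assms
proof (induction "card A" arbitrary: A rule: less_induct)
  case less
  show ?case
  proof (cases "A = {}")
    case False
    then obtain a where a: "a \<in> A" by blast
    have c2: "card A \<ge> 2" using less.prems False by (metis card_gt_0_iff dvd_imp_le)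
    have "mean_weight \<beta> (A - {a, j}) g = 1" if j: "j \<in> A - {a}" for j
    proof (rule less.hyps)
      have c: "card (A - {a, j}) = card A - 2" using less.prems(1) a j by (rule card_remove_pair)
      show "card (A - {a, j}) < card A" "even (card (A - {a, j}))" using c c2 less.prems(2) by auto
    qed (use less.prems in auto)
    then have "(\<Sum>j\<in>A - {a}. \<beta> (g a) (g j) * \<beta> (g j) (g a) * mean_weight \<beta> (A - {a, j}) g) = (\<Sum>j\<in>A - {a}. 1)"
      using less.prems(3) a by (intro sum.cong refl) auto
    then have "mean_weight \<beta> A g = of_nat (card A - 1) / of_nat (card A - 1)"
      unfolding mean_weight_rec[OF less.prems(1) a] using less.prems(1) a by simp
    then show ?thesis using c2 by simp
  qed simp
qed

lemma antisymmetric_formsD: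
  assumes "f \<in> antisymmetric_forms"
  shows "x \<in> V \<Longrightarrow> f x \<in> characters G" "f \<in> extensional V"
    "x \<in> V \<Longrightarrow> y \<in> V \<Longrightarrow> z \<in> V \<Longrightarrow> f (x \<otimes> y) z = f x z * f y z"
    "x \<in> V \<Longrightarrow> y \<in> V \<Longrightarrow> f x y * f y x = 1"
  using assms unfolding antisymmetric_forms_def by (auto simp: PiE_def)

lemma antisymmetric_forms_inv:
  assumes f: "f \<in> antisymmetric_forms" and x: "x \<in> V" "z \<in> V"
  shows "f (inv x) z = inverse (f x z)" "f \<one> z = 1"
proof -
  have "f (inv x) z * f z (inv x) = 1" "f x z * f z x = 1" using antisymmetric_formsD(4)[OF f] x by auto
  moreover have "f z (inv x) = inverse (f z x)" using character_inv(1)[OF antisymmetric_formsD(1)[OF f x(2)] x(1)] .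
  moreover have "f z x \<noteq> 0" using charactersD(4)[OF antisymmetric_formsD(1)[OF f x(2)] x(1)] .
  ultimately have "f (inv x) z = f z x" "inverse (f x z) = f z x"
    using inverse_unique[of "f x z" "f z x"] by (simp_all add: field_simps)
  then show "f (inv x) z = inverse (f x z)" by simp
  show "f \<one> z = 1"
    using antisymmetric_formsD(4)[OF f, of \<one> z] character_one[OF antisymmetric_formsD(1)[OF f x(2)]] x by simp
qed

text \<open>The assignments of characters for which the points \<open>(q i, h i)\<close> lie on a translate of the graph of
the form \<open>f\<close>.\<close>

definition structured :: "'v set \<Rightarrow> ('v \<Rightarrow> 'a) \<Rightarrow> ('a \<Rightarrow> 'a \<Rightarrow> complex) \<times> ('a \<Rightarrow> complex) \<Rightarrow> 'v \<Rightarrow> 'a \<Rightarrow> complex" where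
  "structured A q p = (\<lambda>i\<in>A. \<lambda>y\<in>V. fst p (q i) y * snd p y)"

lemma structured_in:
  assumes "q \<in> A \<rightarrow> V" "f \<in> antisymmetric_forms" "\<psi> \<in> characters G"
  shows "structured A q (f, \<psi>) \<in> PiE A (\<lambda>_. characters G)"
proof (rule PiE_I)
  fix i assume i: "i \<in> A"
  show "structured A q (f, \<psi>) i \<in> characters G"
    using character_mult_closed[OF antisymmetric_formsD(1)[OF assms(2) funcset_mem[OF assms(1) i]] assms(3)] i
    by (simp add: structured_def)
qed (simp add: structured_def)

text \<open>The main terms of different forms are distinct because the differences of \<open>q\<close> generate.\<close>

lemma structured_inj:
  assumes q: "q \<in> full A" and A: "A \<noteq> {}"
  shows "inj_on (structured A q) (antisymmetric_forms \<times> characters G)"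
proof (rule inj_onI, clarify)
  fix f \<psi> f' \<psi>'
  assume f: "f \<in> antisymmetric_forms" "f' \<in> antisymmetric_forms" and \<psi>: "\<psi> \<in> characters G" "\<psi>' \<in> characters G"
    and eq: "structured A q (f, \<psi>) = structured A q (f', \<psi>')"
  have qV: "q i \<in> V" if "i \<in> A" for i using q that by (auto simp: full_def)
  have e: "f (q i) y * \<psi> y = f' (q i) y * \<psi>' y" if "i \<in> A" "y \<in> V" for i y
    using fun_cong[OF fun_cong[OF eq], of i y] that by (simp add: structured_def)
  (* \<open>f\<close> and \<open>f'\<close> agree on the differences of the values of \<open>q\<close>, where \<open>\<psi>\<close> and \<open>\<psi>'\<close> cancel. *)
  define H where "H = {x\<in>V. \<forall>z\<in>V. f x z = f' x z}"
  have H: "subgroup H G"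
  proof (rule subgroupI)
    have "\<one> \<in> H" using antisymmetric_forms_inv(2)[OF f(1), of \<one>] antisymmetric_forms_inv(2)[OF f(2), of \<one>] by (simp add: H_def)
    then show "H \<noteq> {}" by blast
  qed (auto simp: H_def antisymmetric_forms_inv(1)[OF f(1)] antisymmetric_forms_inv(1)[OF f(2)] antisymmetric_formsD(3)[OF f(1)] antisymmetric_formsD(3)[OF f(2)])
  have nz: "h x y \<noteq> 0" if "h \<in> antisymmetric_forms" "x \<in> V" "y \<in> V" for h x y
    using charactersD(4)[OF antisymmetric_formsD(1)[OF that(1,2)] that(3)] .
  have "differences A q \<subseteq> H"
  proof
    fix x assume "x \<in> differences A q"
    then obtain i j where x: "x = q i \<otimes> inv (q j)" "i \<in> A" "j \<in> A" by (auto simp: differences_def)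
    have "f x z = f' x z" if z: "z \<in> V" for z
    proof -
      have "\<psi> z \<noteq> 0" "\<psi>' z \<noteq> 0" using charactersD(4)[OF \<psi>(1) z] charactersD(4)[OF \<psi>(2) z] by auto
      have "f x z = f (q i) z / f (q j) z" "f' x z = f' (q i) z / f' (q j) z"
        using antisymmetric_formsD(3)[OF f(1)] antisymmetric_formsD(3)[OF f(2)] antisymmetric_forms_inv(1)[OF f(1)] antisymmetric_forms_inv(1)[OF f(2)] qV x z
        by (simp_all add: field_simps)
      moreover have "f (q i) z / f (q j) z = (f (q i) z * \<psi> z) / (f (q j) z * \<psi> z)" using \<open>\<psi> z \<noteq> 0\<close> by simp
      moreover have "f' (q i) z / f' (q j) z = (f' (q i) z * \<psi>' z) / (f' (q j) z * \<psi>' z)" using \<open>\<psi>' z \<noteq> 0\<close> by simp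
      ultimately show ?thesis using e[OF x(2) z] e[OF x(3) z] by simp
    qed
    then show "x \<in> H" using qV x by (simp add: H_def)
  qed
  then have "generate G (differences A q) \<subseteq> H" by (rule generate_subgroup_incl[OF _ H])
  then have "V \<subseteq> H" using q by (simp add: full_def)
  then have ff: "f x z = f' x z" if "x \<in> V" "z \<in> V" for x z using that by (auto simp: H_def)
  have "f = f'"
  proof (rule extensionalityI[OF antisymmetric_formsD(2)[OF f(1)] antisymmetric_formsD(2)[OF f(2)]])
    fix x assume "x \<in> V"
    then show "f x = f' x" using ff by (intro characters_eqI[OF antisymmetric_formsD(1)[OF f(1)] antisymmetric_formsD(1)[OF f(2)]])
  qed
  moreover have "\<psi> = \<psi>'"
  proof (rule characters_eqI[OF \<psi>])
    fix z assume z: "z \<in> V"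
    obtain i where i: "i \<in> A" using A by blast
    show "\<psi> z = \<psi>' z" using e[OF i z] ff[OF qV[OF i] z] nz[OF f(1) qV[OF i] z] by simp
  qed
  ultimately show "f = f' \<and> \<psi> = \<psi>'" by simp
qed

text \<open>The pairing of two points on the graph of \<open>f\<close> is antisymmetric, so all matchings have the same
weight. It is the contribution of \<open>\<psi>\<close> alone, which cancels against the first factor; only the
diagonal values of \<open>f\<close> remain.\<close>

lemma structured_term:
  assumes A: "finite A" "even (card A)" and q: "q \<in> A \<rightarrow> V" and f: "f \<in> antisymmetric_forms" and \<psi>: "\<psi> \<in> characters G"
  shows "(\<Prod>i\<in>A. cnj (structured A q (f, \<psi>) i (q i)) ^ d) * mean_weight eval_pairing A (\<lambda>i. (q i, structured A q (f, \<psi>) i)) ^ d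
    = (\<Prod>i\<in>A. cnj (f (q i) (q i)) ^ d)"
proof -
  let ?s = "structured A q (f, \<psi>)" and ?p = "\<Prod>i\<in>A. \<psi> (q i)"
  have qV: "q i \<in> V" if "i \<in> A" for i using q that by auto
  have "matching_weight eval_pairing A (\<lambda>i. (q i, ?s i)) \<pi> = ?p * matching_weight f A q \<pi>" if "\<pi> \<in> matchings A" for \<pi>
  proof -
    have p: "\<pi> permutes A" using that by (simp add: matchings_def)
    have cl: "\<pi> i \<in> A" if "i \<in> A" for i using that permutes_in_image[OF p] by auto
    have "matching_weight eval_pairing A (\<lambda>i. (q i, ?s i)) \<pi> = (\<Prod>i\<in>A. f (q i) (q (\<pi> i)) * \<psi> (q (\<pi> i)))"
      unfolding matching_weight_def using cl qV by (intro prod.cong refl) (simp add: eval_pairing_def structured_def)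
    also have "\<dots> = matching_weight f A q \<pi> * (\<Prod>i\<in>A. \<psi> (q (\<pi> i)))" by (simp add: prod.distrib matching_weight_def)
    also have "(\<Prod>i\<in>A. \<psi> (q (\<pi> i))) = ?p" using prod.permute[OF p, of "\<lambda>i. \<psi> (q i)"] by (simp add: o_def)
    finally show ?thesis by simp
  qed
  then have "mean_weight eval_pairing A (\<lambda>i. (q i, ?s i)) = ?p * mean_weight f A q"
    unfolding mean_weight_def matching_avg_cmult[symmetric] by (rule matching_avg_cong)
  also have "mean_weight f A q = 1"
    using antisymmetric_formsD(4)[OF f] qV by (intro mean_weight_antisymmetric A) auto
  finally have T: "mean_weight eval_pairing A (\<lambda>i. (q i, ?s i)) = ?p" by simp
  have "(\<Prod>i\<in>A. cnj (?s i (q i)) ^ d) * ?p ^ d = (\<Prod>i\<in>A. (cnj (?s i (q i)) * \<psi> (q i)) ^ d)"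
    by (simp only: prod.distrib power_mult_distrib prod_power_distrib)
  also have "\<dots> = (\<Prod>i\<in>A. cnj (f (q i) (q i)) ^ d)"
  proof (intro prod.cong refl arg_cong2[of _ _ _ _ "(^)"])
    fix i assume i: "i \<in> A"
    have "cnj (\<psi> (q i)) * \<psi> (q i) = 1"
      using charactersD(3)[OF \<psi> qV[OF i]] by (simp add: mult.commute flip: complex_norm_square)
    then show "cnj (?s i (q i)) * \<psi> (q i) = cnj (f (q i) (q i))"
      using i qV by (simp add: structured_def mult.assoc)
  qed
  finally show ?thesis unfolding T .
qed

lemma cancel_common_factor:
  assumes "a \<in> V" "b \<in> V" "c \<in> V"
  shows "(a \<otimes> b) \<otimes> inv (a \<otimes> c) = b \<otimes> inv c"
proof -
  have "(a \<otimes> b) \<otimes> inv (a \<otimes> c) = (b \<otimes> a) \<otimes> (inv a \<otimes> inv c)"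
    using assms by (simp only: inv_mult m_comm[of a b])
  also have "\<dots> = b \<otimes> ((a \<otimes> inv a) \<otimes> inv c)" using assms by (simp only: m_assoc m_closed inv_closed)
  finally show ?thesis using assms by simp
qed

text \<open>A coset of an isotropic subgroup that contains all the points \<open>(q i, h i)\<close> has to be a translate of
the graph of an antisymmetric form, because the differences of \<open>q\<close> generate.\<close>

lemma unstructured_unconfined:
  assumes fin: "finite V" and q: "q \<in> full {0..<n}" and n: "n > 0" and h: "h \<in> PiE {0..<n} (\<lambda>_. characters G)"
    and ns: "h \<notin> structured {0..<n} q ` (antisymmetric_forms \<times> characters G)"
  shows "(\<lambda>i\<in>{0..<n}. (q i, h i)) \<in> pairing.unconfined (G \<times>\<times> dual_group G) eval_pairing n"
proof (rule ccontr)
  interpret P: pairing "G \<times>\<times> dual_group G" eval_pairing by (rule pairing_eval[OF fin])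
  interpret D: comm_group "dual_group G" by (rule comm_group_dual)
  let ?g = "\<lambda>i\<in>{0..<n}. (q i, h i)" let ?P = "G \<times>\<times> dual_group G"
  have qV: "q i \<in> V" if "i < n" for i using q that by (auto simp: full_def)
  have hX: "h i \<in> characters G" if "i < n" for i using h that by auto
  assume "?g \<notin> P.unconfined n"
  moreover have "?g \<in> PiE {0..<n} (\<lambda>_. carrier ?P)" using qV hX by auto
  ultimately obtain L c where L: "P.isotropic L" and c: "c \<in> carrier ?P"
    and g: "\<And>i. i < n \<Longrightarrow> inv\<^bsub>?P\<^esub> c \<otimes>\<^bsub>?P\<^esub> ?g i \<in> L"
    unfolding P.unconfined_def by blast
  have subL: "subgroup L ?P" using L by (simp add: P.isotropic_def)
  interpret L: subgroup L ?P by (rule subL)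
  have fL: "finite L" using L.subset P.fin finite_subset by blast
  obtain c1 c2 where c12: "c = (c1, c2)" "c1 \<in> V" "c2 \<in> characters G" using c by auto
  have LV: "x \<in> V" "\<eta> \<in> characters G" if "(x, \<eta>) \<in> L" for x \<eta> using L.mem_carrier[OF that] by auto
  have invP: "inv\<^bsub>?P\<^esub> (x, \<eta>) = (inv x, inv\<^bsub>dual_group G\<^esub> \<eta>)" if "x \<in> V" "\<eta> \<in> characters G" for x \<eta>
    using that inv_DirProd[of G "dual_group G" x \<eta>] by (simp add: is_group D.is_group)
  have invD: "(inv\<^bsub>dual_group G\<^esub> \<eta>) y = inverse (\<eta> y)" if "\<eta> \<in> characters G" "y \<in> V" for \<eta> y
  proof -
    have e: "\<eta> \<in> carrier (dual_group G)" using that(1) by simp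
    have "(inv\<^bsub>dual_group G\<^esub> \<eta> \<otimes>\<^bsub>dual_group G\<^esub> \<eta>) y = 1" unfolding D.l_inv[OF e] using that(2) by simp
    then have "(inv\<^bsub>dual_group G\<^esub> \<eta>) y * \<eta> y = 1" using that(2) by simp
    then show ?thesis using charactersD(4)[OF that] by (simp add: field_simps)
  qed
  (* The first projection of \<open>L\<close> contains the differences of \<open>q\<close>, hence is all of \<open>V\<close>. An isotropic
     subgroup has at most \<open>card V\<close> elements, so \<open>L\<close> is the graph of a homomorphism \<open>f\<close>. *)
  have "generate G (differences {0..<n} q) \<subseteq> fst ` L"
  proof (rule generate_subgroup_incl)
    have "group_hom ?P G fst"
      by unfold_locales (auto simp: hom_def)
    then show "subgroup (fst ` L) G" using group_hom.subgroup_img_is_subgroup subL by blast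
    show "differences {0..<n} q \<subseteq> fst ` L"
    proof
      fix x assume "x \<in> differences {0..<n} q"
      then obtain i j where x: "x = q i \<otimes> inv (q j)" "i < n" "j < n" by (auto simp: differences_def)
      have mem: "(inv\<^bsub>?P\<^esub> c \<otimes>\<^bsub>?P\<^esub> ?g i) \<otimes>\<^bsub>?P\<^esub> inv\<^bsub>?P\<^esub> (inv\<^bsub>?P\<^esub> c \<otimes>\<^bsub>?P\<^esub> ?g j) \<in> L"
        by (rule L.m_closed[OF g[OF x(2)] L.m_inv_closed[OF g[OF x(3)]]])
      have fst_eq: "fst ((inv\<^bsub>?P\<^esub> c \<otimes>\<^bsub>?P\<^esub> ?g i) \<otimes>\<^bsub>?P\<^esub> inv\<^bsub>?P\<^esub> (inv\<^bsub>?P\<^esub> c \<otimes>\<^bsub>?P\<^esub> ?g j)) = x"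
      proof -
        have cl: "inv c1 \<otimes> q j \<in> V" "inv\<^bsub>dual_group G\<^esub> c2 \<otimes>\<^bsub>dual_group G\<^esub> h j \<in> characters G"
          using c12 qV hX x D.m_closed[of "inv\<^bsub>dual_group G\<^esub> c2" "h j"] D.inv_closed[of c2] by auto
        have "fst ((inv\<^bsub>?P\<^esub> c \<otimes>\<^bsub>?P\<^esub> ?g i) \<otimes>\<^bsub>?P\<^esub> inv\<^bsub>?P\<^esub> (inv\<^bsub>?P\<^esub> c \<otimes>\<^bsub>?P\<^esub> ?g j)) =
          (inv c1 \<otimes> q i) \<otimes> inv (inv c1 \<otimes> q j)"
          using x c12 cl by (simp add: invP del: dual_group_simps(3))
        also have "\<dots> = x" unfolding x(1) using c12 qV x by (intro cancel_common_factor) auto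
        finally show ?thesis .
      qed
      show "x \<in> fst ` L" by (rule image_eqI[where f = fst, OF fst_eq[symmetric] mem])
    qed
  qed
  then have VL: "V \<subseteq> fst ` L" using q by (simp add: full_def)
  have "fst ` L \<subseteq> V" using L.subset by auto
  then have fstL: "fst ` L = V" using VL by (rule subset_antisym)
  have "card L \<le> card V"
  proof -
    have "(card L)\<^sup>2 \<le> (card V)\<^sup>2" using P.isotropic_card(1)[OF L] by (simp add: card_cartesian_product card_characters[OF fin] power2_eq_square)
    then show ?thesis by (rule power2_le_imp_le) simp
  qed
  then have inj: "inj_on fst L" using fstL fL card_image_le[OF fL, of fst] by (intro eq_card_imp_inj_on) auto
  define f where "f = (\<lambda>x\<in>V. THE \<eta>. (x, \<eta>) \<in> L)"
  have fL: "f x = \<eta>" if "(x, \<eta>) \<in> L" for x \<eta>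
  proof -
    have "(THE \<eta>. (x, \<eta>) \<in> L) = \<eta>"
    proof (rule the_equality)
      show "(x, \<eta>) \<in> L" by (rule that)
      fix \<eta>' assume "(x, \<eta>') \<in> L"
      then show "\<eta>' = \<eta>" using inj_onD[OF inj, of "(x, \<eta>')" "(x, \<eta>)"] that by simp
    qed
    then show ?thesis using LV[OF that] by (simp add: f_def)
  qed
  have Lf: "(x, f x) \<in> L" if x: "x \<in> V" for x
  proof -
    obtain \<eta> where "(x, \<eta>) \<in> L" using subsetD[OF VL x] by auto
    then show ?thesis using fL by simp
  qed
  have fc: "f x \<in> characters G" if "x \<in> V" for x using LV Lf[OF that] by blast
  have fm: "f (x \<otimes> y) z = f x z * f y z" if "x \<in> V" "y \<in> V" "z \<in> V" for x y z
    using fL[of "x \<otimes> y" "\<lambda>z\<in>V. f x z * f y z"] L.m_closed[OF Lf[OF that(1)] Lf[OF that(2)]] that by simp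
  have alt: "f \<in> antisymmetric_forms"
  proof -
    have "f x y * f y x = 1" if "x \<in> V" "y \<in> V" for x y
    proof -
      have "P.B (x, f x) (y, f y) = 1"
        using L Lf[OF that(1)] Lf[OF that(2)] by (simp add: P.isotropic_def)
      then show ?thesis by (simp add: P.B_def eval_pairing_def)
    qed
    then show ?thesis using fc fm by (auto simp: antisymmetric_forms_def f_def)
  qed
  (* The representative \<open>(c1, c2)\<close> of the coset is moved to \<open>(\<one>, \<psi>)\<close> along the graph of \<open>f\<close>. *)
  define \<psi> where "\<psi> = (\<lambda>y\<in>V. c2 y * cnj (f c1 y))"
  have \<psi>: "\<psi> \<in> characters G"
    using character_mult_closed[OF c12(3) cnj_character[OF fc[OF c12(2)]]] unfolding \<psi>_def by (simp cong: restrict_cong)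
  have "h = structured {0..<n} q (f, \<psi>)"
  proof
    fix i show "h i = structured {0..<n} q (f, \<psi>) i"
    proof (cases "i < n")
      case True
      have s: "structured {0..<n} q (f, \<psi>) i \<in> characters G"
        using structured_in[of q "{0..<n}" f \<psi>] alt \<psi> qV True by auto
      show ?thesis
      proof (rule characters_eqI[OF hX[OF True] s])
        fix y assume y: "y \<in> V"
        have "(inv c1 \<otimes> q i, inv\<^bsub>dual_group G\<^esub> c2 \<otimes>\<^bsub>dual_group G\<^esub> h i) \<in> L"
          using g[OF True] c12 True by (simp add: invP del: dual_group_simps(3))
        from fL[OF this] have 1: "f (inv c1 \<otimes> q i) y = inverse (c2 y) * h i y"
          using y invD[OF c12(3) y] by simp
        have 2: "f (inv c1 \<otimes> q i) y = inverse (f c1 y) * f (q i) y"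
          using fm[of "inv c1" "q i" y] antisymmetric_forms_inv(1)[OF alt c12(2) y] c12 qV[OF True] y by simp
        have "h i y = c2 y * (inverse (c2 y) * h i y)" using charactersD(4)[OF c12(3) y] by simp
        also have "inverse (c2 y) * h i y = inverse (f c1 y) * f (q i) y" using 1 2 by simp
        also have "c2 y * (inverse (f c1 y) * f (q i) y) = f (q i) y * \<psi> y"
          using character_inv[OF fc[OF c12(2)] y] y by (simp add: \<psi>_def)
        finally show "h i y = structured {0..<n} q (f, \<psi>) i y" using True y by (simp add: structured_def)
      qed
    next
      case False then show ?thesis using h by (auto simp: structured_def PiE_iff extensional_def)
    qed
  qed
  then show False using ns alt \<psi> by blast
qed

end

section \<open>The limit as a number of antisymmetric forms\<close>

context comm_group begin

text \<open>An assignment that is not full takes its values in a coset of a proper subgroup, which has at most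
half of the elements.\<close>

lemma card_not_full_le:
  assumes fin: "finite V" and n: "n > 0"
  shows "real (card (PiE {0..<n} (\<lambda>_. V) - full {0..<n})) \<le> 2 ^ card V * real (card V) * (real (card V) / 2) ^ n"
proof -
  let ?A = "{0..<n}" let ?H = "{H. subgroup H G \<and> H \<noteq> V}"
  let ?X = "\<lambda>H c. (\<lambda>l. \<lambda>i\<in>?A. c \<otimes> l i) ` PiE ?A (\<lambda>_. H)"
  have HV: "H \<subseteq> V" if "subgroup H G" for H using that by (rule subgroup.subset)
  have fH: "finite ?H" by (rule finite_subset[of _ "Pow V"]) (use fin HV in blast)+
  have fin_sub: "finite H" if "H \<in> ?H" for H using HV fin that finite_subset by blast
  have half: "real (card H) \<le> real (card V) / 2" if H: "H \<in> ?H" for H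
  proof -
    have "card (rcosets H) * card H = order G" using H by (intro lagrange) auto
    moreover have "card (rcosets H) \<noteq> 1"
    proof
      assume "card (rcosets H) = 1"
      then have "card H = card V" using calculation by (simp add: order_def)
      then have "H = V" using card_subset_eq[OF fin HV] H by blast
      then show False using H by simp
    qed
    moreover have "order G > 0" using fin order_gt_0_iff_finite by blast
    ultimately have "card (rcosets H) \<ge> 2" by (cases "card (rcosets H)") auto
    then have "2 * card H \<le> card V" using \<open>card (rcosets H) * card H = order G\<close>
      by (metis mult_le_mono1 order_def)
    then show ?thesis by linarith
  qed
  have sub: "PiE ?A (\<lambda>_. V) - full ?A \<subseteq> (\<Union>p\<in>?H \<times> V. ?X (fst p) (snd p))"
  proof
    fix q assume q: "q \<in> PiE ?A (\<lambda>_. V) - full ?A"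
    then have qV: "q i \<in> V" if "i < n" for i using that by auto
    have dV: "differences ?A q \<subseteq> V" using qV by (auto simp: differences_def)
    let ?K = "generate G (differences ?A q)"
    have K: "?K \<in> ?H" using q generate_is_subgroup[OF dV] by (auto simp: full_def)
    have e: "q = (\<lambda>i\<in>?A. q 0 \<otimes> (\<lambda>i\<in>?A. inv (q 0) \<otimes> q i) i)"
    proof
      fix i show "q i = (\<lambda>i\<in>?A. q 0 \<otimes> (\<lambda>i\<in>?A. inv (q 0) \<otimes> q i) i) i"
        using q qV[of i] qV[of 0] n by (cases "i < n") (auto simp: m_assoc[symmetric] PiE_iff extensional_def)
    qed
    have "inv (q 0) \<otimes> q i \<in> ?K" if i: "i < n" for i
    proof -
      have "q i \<otimes> inv (q 0) \<in> differences ?A q" unfolding differences_def using i n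
        by (intro CollectI exI[of _ i] exI[of _ 0]) auto
      moreover have "inv (q 0) \<otimes> q i = q i \<otimes> inv (q 0)" using qV[OF i] qV[of 0] n by (intro m_comm) auto
      ultimately show ?thesis by (simp add: generate.incl)
    qed
    then have "(\<lambda>i\<in>?A. inv (q 0) \<otimes> q i) \<in> PiE ?A (\<lambda>_. ?K)" by auto
    then have "q \<in> ?X ?K (q 0)" by (subst e) (rule imageI)
    then show "q \<in> (\<Union>p\<in>?H \<times> V. ?X (fst p) (snd p))" using K qV[of 0] n by force
  qed
  have cX: "card (?X H c) \<le> card H ^ n" and fX: "finite (?X H c)" if "H \<in> ?H" for H c
  proof -
    have f: "finite (PiE ?A (\<lambda>_. H))" using fin_sub[OF that] by (intro finite_PiE) auto
    then show "finite (?X H c)" by simp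
    have "card (?X H c) \<le> card (PiE ?A (\<lambda>_. H))" by (rule card_image_le[OF f])
    then show "card (?X H c) \<le> card H ^ n" by (simp add: card_PiE)
  qed
  have fU: "finite (\<Union>p\<in>?H \<times> V. ?X (fst p) (snd p))"
    by (intro finite_UN_I finite_cartesian_product fH fin fX) (erule SigmaE, simp)
  have "card (PiE ?A (\<lambda>_. V) - full ?A) \<le> card (\<Union>p\<in>?H \<times> V. ?X (fst p) (snd p))"
    by (rule card_mono[OF fU sub])
  also have "\<dots> \<le> (\<Sum>p\<in>?H \<times> V. card (?X (fst p) (snd p)))"
    using fH fin by (intro card_UN_le finite_cartesian_product)
  finally have le: "card (PiE ?A (\<lambda>_. V) - full ?A) \<le> (\<Sum>p\<in>?H \<times> V. card (?X (fst p) (snd p)))" .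
  have "real (card (PiE ?A (\<lambda>_. V) - full ?A)) \<le> (\<Sum>p\<in>?H \<times> V. real (card (?X (fst p) (snd p))))"
    using of_nat_mono[OF le, where 'a = real] by (simp only: of_nat_sum)
  also have "\<dots> \<le> (\<Sum>p\<in>?H \<times> V. (real (card V) / 2) ^ n)"
  proof (rule sum_mono)
    fix p assume p: "p \<in> ?H \<times> V"
    then have H: "fst p \<in> ?H" by (simp only: mem_Times_iff)
    have "real (card (?X (fst p) (snd p))) \<le> real (card (fst p)) ^ n"
      using of_nat_mono[OF cX[OF H, of "snd p"], where 'a = real] by (simp only: of_nat_power)
    also have "\<dots> \<le> (real (card V) / 2) ^ n" using half[OF H] by (intro power_mono) auto
    finally show "real (card (?X (fst p) (snd p))) \<le> (real (card V) / 2) ^ n" .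
  qed
  also have "\<dots> = real (card ?H) * real (card V) * (real (card V) / 2) ^ n" by (simp add: card_cartesian_product)
  also have "\<dots> \<le> 2 ^ card V * real (card V) * (real (card V) / 2) ^ n"
  proof (intro mult_right_mono)
    have "card ?H \<le> card (Pow V)" using fin HV by (intro card_mono) auto
    then show "real (card ?H) \<le> 2 ^ card V" using fin by (simp add: card_Pow)
  qed auto
  finally show ?thesis .
qed

text \<open>Without the restriction to full assignments the sum is the \<open>n\<close>-th power of a complete character
sum; the excluded assignments are exponentially rare.\<close>

lemma sum_full_character_tendsto:
  assumes fin: "finite V" and s: "s \<in> characters G"
  shows "(\<lambda>m. (\<Sum>q\<in>full {0..<2 * m}. \<Prod>i\<in>{0..<2 * m}. s (q i)) / of_nat (card V) ^ (2 * m))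
     \<longlonglongrightarrow> (if \<forall>x\<in>V. s x = 1 then 1 else 0)" (is "?F \<longlonglongrightarrow> ?l")
proof -
  let ?v = "card V"
  have v0: "?v > 0" using fin by (auto simp: card_gt_0_iff)
  have bd: "norm (?F m - ?l) \<le> 2 ^ ?v * real ?v * (1 / 4) ^ m" if m: "m > 0" for m
  proof -
    let ?A = "{0..<2 * m}" let ?P = "PiE ?A (\<lambda>_. V)"
    have fP: "finite ?P" using fin by (intro finite_PiE) auto
    have sub: "full ?A \<subseteq> ?P" by (auto simp: full_def)
    have "(\<Sum>q\<in>?P. \<Prod>i\<in>?A. s (q i)) = (\<Prod>i\<in>?A. \<Sum>x\<in>V. s x)"
      using fin by (intro prod_sum_PiE[symmetric]) auto
    also have "\<dots> = (\<Sum>x\<in>V. s x) ^ (2 * m)" by simp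
    also have "(\<Sum>x\<in>V. s x) = of_nat ?v * ?l"
      using sum_character[OF fin s] by (auto simp: s)
    finally have tot: "(\<Sum>q\<in>?P. \<Prod>i\<in>?A. s (q i)) = of_nat ?v ^ (2 * m) * ?l"
      using m by (simp add: power_mult_distrib)
    have "(\<Sum>q\<in>?P. \<Prod>i\<in>?A. s (q i)) = (\<Sum>q\<in>full ?A. \<Prod>i\<in>?A. s (q i)) + (\<Sum>q\<in>?P - full ?A. \<Prod>i\<in>?A. s (q i))"
      by (rule sum.subset_diff[OF sub fP, THEN trans]) (simp add: add.commute)
    then have "(\<Sum>q\<in>full ?A. \<Prod>i\<in>?A. s (q i)) - of_nat ?v ^ (2 * m) * ?l = - (\<Sum>q\<in>?P - full ?A. \<Prod>i\<in>?A. s (q i))"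
      unfolding tot by (simp add: algebra_simps)
    moreover have "?F m - ?l = ((\<Sum>q\<in>full ?A. \<Prod>i\<in>?A. s (q i)) - of_nat ?v ^ (2 * m) * ?l) / of_nat ?v ^ (2 * m)"
      using v0 by (simp add: field_simps)
    ultimately have "norm (?F m - ?l) = norm (\<Sum>q\<in>?P - full ?A. \<Prod>i\<in>?A. s (q i)) / real ?v ^ (2 * m)"
      by (simp add: norm_divide norm_power)
    also have "\<dots> \<le> (\<Sum>q\<in>?P - full ?A. 1) / real ?v ^ (2 * m)"
    proof (intro divide_right_mono sum_norm_le)
      fix q assume "q \<in> ?P - full ?A"
      then have "norm (\<Prod>i\<in>?A. s (q i)) = 1"
        unfolding prod_norm[symmetric] using charactersD(3)[OF s] by (intro prod.neutral) auto
      then show "norm (\<Prod>i\<in>?A. s (q i)) \<le> 1" by simp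
    qed simp
    also have "\<dots> \<le> (2 ^ ?v * real ?v * (real ?v / 2) ^ (2 * m)) / real ?v ^ (2 * m)"
      using card_not_full_le[OF fin, of "2 * m"] m by (intro divide_right_mono) auto
    also have "\<dots> = 2 ^ ?v * real ?v * (1 / 4) ^ m"
      using v0 by (simp add: power_divide power_mult)
    finally show ?thesis .
  qed
  have "(\<lambda>m. 2 ^ ?v * real ?v * (1 / 4) ^ m) \<longlonglongrightarrow> 2 ^ ?v * real ?v * 0"
    by (intro tendsto_mult tendsto_const LIMSEQ_realpow_zero) auto
  then have t: "(\<lambda>m. 2 ^ ?v * real ?v * (1 / 4) ^ m) \<longlonglongrightarrow> 0" by simp
  have "(\<lambda>m. ?F m - ?l) \<longlonglongrightarrow> 0"
    by (rule Lim_null_comparison[OF eventually_mono[OF eventually_gt_at_top[of 0] bd] t])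
  then show ?thesis by (simp only: LIM_zero_iff)
qed

text \<open>The mixed terms of \<open>f (x \<otimes> y) (x \<otimes> y)\<close> cancel by antisymmetry.\<close>

lemma diagonal_character:
  assumes f: "f \<in> antisymmetric_forms"
  shows "(\<lambda>x\<in>V. cnj (f x x) ^ d) \<in> characters G"
proof -
  have "f (x \<otimes> y) (x \<otimes> y) = f x x * f y y" if "x \<in> V" "y \<in> V" for x y
  proof -
    have "f (x \<otimes> y) (x \<otimes> y) = f x (x \<otimes> y) * f y (x \<otimes> y)" using antisymmetric_formsD(3)[OF f] that by simp
    also have "\<dots> = (f x x * f x y) * (f y x * f y y)"
      using charactersD(2)[OF antisymmetric_formsD(1)[OF f]] that by simp
    also have "\<dots> = (f x y * f y x) * (f x x * f y y)" by (simp add: mult_ac)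
    finally show ?thesis using antisymmetric_formsD(4)[OF f that] by simp
  qed
  then show ?thesis using charactersD(3)[OF antisymmetric_formsD(1)[OF f]]
    by (auto simp: characters_def power_mult_distrib norm_power)
qed

lemma finite_antisymmetric_forms: "finite V \<Longrightarrow> finite antisymmetric_forms"
  by (rule finite_subset[of _ "PiE V (\<lambda>_. characters G)"]) (auto simp: antisymmetric_forms_def intro!: finite_PiE finite_characters)

text \<open>The structured terms of the Fourier expansion give the main term. All others are unconfined points
of the product group, and \<open>d \<ge> 3\<close> bounds them by cubes.\<close>

lemma sum_hit_prob_error:
  assumes fin: "finite V" and d: "d \<ge> 3" and m: "m > 0"
  defines "A \<equiv> {0..<2 * m}"
  shows "norm (of_real (\<Sum>q\<in>full A. hit_prob A d q) / of_nat (card V) -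
     (\<Sum>f\<in>antisymmetric_forms. (\<Sum>q\<in>full A. \<Prod>i\<in>A. cnj (f (q i) (q i)) ^ d) / of_nat (card V) ^ (2 * m)))
   \<le> (\<Sum>g\<in>pairing.unconfined (G \<times>\<times> dual_group G) eval_pairing (2 * m). norm (mean_weight eval_pairing A g) ^ 3) /
      real (card (carrier (G \<times>\<times> dual_group G))) ^ m"
proof -
  interpret P: pairing "G \<times>\<times> dual_group G" eval_pairing by (rule pairing_eval[OF fin])
  let ?v = "card V" let ?X = "PiE A (\<lambda>_. characters G)" let ?D = "antisymmetric_forms \<times> characters G"
  let ?g = "\<lambda>q h. \<lambda>i\<in>A. (q i, h i)"
  let ?t = "\<lambda>q h. (\<Prod>i\<in>A. cnj (h i (q i)) ^ d) * mean_weight eval_pairing A (\<lambda>i. (q i, h i)) ^ d"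
  have v0: "?v > 0" using fin by (auto simp: card_gt_0_iff)
  have A: "finite A" "even (card A)" "A \<noteq> {}" "card A = 2 * m" using m by (auto simp: A_def)
  have fX: "finite ?X" using fin A by (intro finite_PiE finite_characters) auto
  have ffull: "finite (full A)"
    by (rule finite_subset[of _ "PiE A (\<lambda>_. V)"]) (use fin A in \<open>auto simp: full_def intro!: finite_PiE\<close>)
  have qV: "q \<in> A \<rightarrow> V" if "q \<in> full A" for q using that by (auto simp: full_def)
  have main: "(\<Sum>h\<in>?X. ?t q h) = of_nat ?v * (\<Sum>f\<in>antisymmetric_forms. \<Prod>i\<in>A. cnj (f (q i) (q i)) ^ d) + (\<Sum>h\<in>?X - structured A q ` ?D. ?t q h)"
    if q: "q \<in> full A" for q
  proof -
    have "structured A q ` ?D \<subseteq> ?X" using structured_in[OF qV[OF q]] by auto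
    then have "(\<Sum>h\<in>?X. ?t q h) = (\<Sum>h\<in>structured A q ` ?D. ?t q h) + (\<Sum>h\<in>?X - structured A q ` ?D. ?t q h)"
      using fX by (subst sum.subset_diff) (auto simp: add.commute)
    also have "(\<Sum>h\<in>structured A q ` ?D. ?t q h) = (\<Sum>p\<in>?D. ?t q (structured A q p))"
      using structured_inj[OF q A(3)] by (subst sum.reindex) auto
    also have "\<dots> = (\<Sum>(f, \<psi>)\<in>?D. \<Prod>i\<in>A. cnj (f (q i) (q i)) ^ d)"
      using structured_term[OF A(1,2) qV[OF q]] by (intro sum.cong refl) auto
    also have "\<dots> = of_nat ?v * (\<Sum>f\<in>antisymmetric_forms. \<Prod>i\<in>A. cnj (f (q i) (q i)) ^ d)"
      unfolding sum.cartesian_product[symmetric] by (simp add: card_characters[OF fin] sum_distrib_left)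
    finally show ?thesis .
  qed
  have "of_real (\<Sum>q\<in>full A. hit_prob A d q) / of_nat ?v = (\<Sum>q\<in>full A. (\<Sum>h\<in>?X. ?t q h)) / of_nat ?v ^ (2 * m) / of_nat ?v"
    using hit_prob_fourier[OF fin A(1) qV] A(4) by (simp add: sum_divide_distrib)
  also have "\<dots> = (of_nat ?v * (\<Sum>q\<in>full A. \<Sum>f\<in>antisymmetric_forms. \<Prod>i\<in>A. cnj (f (q i) (q i)) ^ d) + 
     (\<Sum>q\<in>full A. \<Sum>h\<in>?X - structured A q ` ?D. ?t q h)) / of_nat ?v ^ (2 * m) / of_nat ?v"
    by (simp add: main sum.distrib sum_distrib_left)
  also have "\<dots> = (\<Sum>q\<in>full A. \<Sum>f\<in>antisymmetric_forms. \<Prod>i\<in>A. cnj (f (q i) (q i)) ^ d) / of_nat ?v ^ (2 * m) + 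
     (\<Sum>q\<in>full A. \<Sum>h\<in>?X - structured A q ` ?D. ?t q h) / of_nat ?v ^ (2 * m) / of_nat ?v"
    using v0 by (simp add: add_divide_distrib)
  also have "(\<Sum>q\<in>full A. \<Sum>f\<in>antisymmetric_forms. \<Prod>i\<in>A. cnj (f (q i) (q i)) ^ d) / of_nat ?v ^ (2 * m) =
     (\<Sum>f\<in>antisymmetric_forms. (\<Sum>q\<in>full A. \<Prod>i\<in>A. cnj (f (q i) (q i)) ^ d) / of_nat ?v ^ (2 * m))"
    unfolding sum_divide_distrib[symmetric] by (subst sum.swap) (rule refl)
  finally have diff: "of_real (\<Sum>q\<in>full A. hit_prob A d q) / of_nat ?v -
     (\<Sum>f\<in>antisymmetric_forms. (\<Sum>q\<in>full A. \<Prod>i\<in>A. cnj (f (q i) (q i)) ^ d) / of_nat ?v ^ (2 * m)) =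
     (\<Sum>q\<in>full A. \<Sum>h\<in>?X - structured A q ` ?D. ?t q h) / of_nat ?v ^ (2 * m) / of_nat ?v" by simp
  (* The modulus of \<open>T\<close> is at most 1, so its \<open>d\<close>-th power is at most its cube. *)
  have ft: "norm (?t q h) \<le> norm (mean_weight eval_pairing A (?g q h)) ^ 3" if q: "q \<in> full A" and h: "h \<in> ?X" for q h
  proof -
    have gc: "(\<lambda>i. (q i, h i)) \<in> A \<rightarrow> carrier (G \<times>\<times> dual_group G)" using qV[OF q] h by auto
    have "norm (h i (q i)) = 1" if "i \<in> A" for i
      using charactersD(3)[OF PiE_mem[OF h that] funcset_mem[OF qV[OF q] that]] .
    then have "norm (\<Prod>i\<in>A. cnj (h i (q i)) ^ d) = 1"
      unfolding prod_norm[symmetric] by (intro prod.neutral) (simp add: norm_power)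
    then have "norm (?t q h) = norm (mean_weight eval_pairing A (\<lambda>i. (q i, h i))) ^ d" by (simp add: norm_mult norm_power)
    also have "\<dots> \<le> norm (mean_weight eval_pairing A (\<lambda>i. (q i, h i))) ^ 3"
      using P.norm_T_le_1[OF A(1) gc] d by (intro power_decreasing) auto
    finally show ?thesis unfolding P.T_restrict .
  qed
  let ?R = "SIGMA q:full A. ?X - structured A q ` ?D"
  have fU: "finite (P.unconfined (2 * m))"
    by (rule finite_subset[of _ "PiE {0..<2 * m} (\<lambda>_. carrier (G \<times>\<times> dual_group G))"])
      (use P.fin in \<open>auto simp: P.unconfined_def intro!: finite_PiE\<close>)
  have "norm (\<Sum>q\<in>full A. \<Sum>h\<in>?X - structured A q ` ?D. ?t q h) \<le>
      (\<Sum>q\<in>full A. \<Sum>h\<in>?X - structured A q ` ?D. norm (mean_weight eval_pairing A (?g q h)) ^ 3)"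
    by (intro sum_norm_le ft) auto
  also have "\<dots> = (\<Sum>(q, h)\<in>?R. norm (mean_weight eval_pairing A (?g q h)) ^ 3)"
    using ffull fX by (intro sum.Sigma) auto
  also have "\<dots> = (\<Sum>g\<in>(\<lambda>(q, h). ?g q h) ` ?R. norm (mean_weight eval_pairing A g) ^ 3)"
  proof (subst sum.reindex)
    show "inj_on (\<lambda>(q, h). ?g q h) ?R"
    proof (rule inj_onI, clarify)
      fix q h q' h' assume *: "q \<in> full A" "h \<in> ?X" "q' \<in> full A" "h' \<in> ?X" and eq: "?g q h = ?g q' h'"
      have e: "q i = q' i \<and> h i = h' i" if "i \<in> A" for i using fun_cong[OF eq, of i] that by simp
      have "q \<in> extensional A" "q' \<in> extensional A" using * by (auto simp: full_def PiE_def)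
      then have "q = q'" by (rule extensionalityI) (use e in auto)
      moreover have "h = h'" by (rule PiE_ext[OF *(2,4)]) (use e in auto)
      ultimately show "q = q' \<and> h = h'" by simp
    qed
  qed (simp add: case_prod_beta)
  also have "\<dots> \<le> (\<Sum>g\<in>P.unconfined (2 * m). norm (mean_weight eval_pairing A g) ^ 3)"
    using unstructured_unconfined[OF fin _ _, of _ "2 * m"] m fU
    by (intro sum_mono2) (auto simp: A_def)
  finally have fin_bd: "norm (\<Sum>q\<in>full A. \<Sum>h\<in>?X - structured A q ` ?D. ?t q h) \<le>
     (\<Sum>g\<in>P.unconfined (2 * m). norm (mean_weight eval_pairing A g) ^ 3)" .
  let ?U = "\<Sum>g\<in>P.unconfined (2 * m). norm (mean_weight eval_pairing A g) ^ 3"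
  have U0: "0 \<le> ?U" by (intro sum_nonneg) simp
  have "norm ((\<Sum>q\<in>full A. \<Sum>h\<in>?X - structured A q ` ?D. ?t q h) / of_nat ?v ^ (2 * m) / of_nat ?v) \<le> ?U / real ?v ^ (2 * m) / real ?v"
    unfolding norm_divide norm_power norm_of_nat by (intro divide_right_mono fin_bd) auto
  also have "\<dots> \<le> ?U / real ?v ^ (2 * m) / 1" using v0 U0 by (intro divide_left_mono) auto
  also have "real ?v ^ (2 * m) = real (card (carrier (G \<times>\<times> dual_group G))) ^ m"
    by (simp add: card_cartesian_product card_characters[OF fin] power_mult power2_eq_square)
  finally show ?thesis unfolding diff by simp
qed

text \<open>The form \<open>f\<close> contributes the average of the character \<open>x \<mapsto> cnj (f x x) ^ d\<close> over the values of
\<open>q\<close>, which tends to 1 if this character is trivial and to 0 otherwise.\<close>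

theorem sum_hit_prob_tendsto:
  assumes fin: "finite V" and d: "d \<ge> 3"
  shows "(\<lambda>m. (\<Sum>q\<in>full {0..<2 * m}. hit_prob {0..<2 * m} d q) / real (card V))
    \<longlonglongrightarrow> real (card {f \<in> antisymmetric_forms. \<forall>x\<in>V. f x x ^ d = 1})"
proof -
  interpret P: pairing "G \<times>\<times> dual_group G" eval_pairing by (rule pairing_eval[OF fin])
  let ?M = "\<lambda>m. \<Sum>f\<in>antisymmetric_forms. (\<Sum>q\<in>full {0..<2 * m}. \<Prod>i\<in>{0..<2 * m}. cnj (f (q i) (q i)) ^ d) / of_nat (card V) ^ (2 * m)"
  let ?E = "\<lambda>m. (\<Sum>q\<in>full {0..<2 * m}. hit_prob {0..<2 * m} d q) / real (card V)"
  have "(\<lambda>m. of_real (?E m) - ?M m) \<longlonglongrightarrow> 0"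
  proof (rule Lim_null_comparison[OF _ P.unconfined_tendsto_0])
    show "\<forall>\<^sub>F m in sequentially. norm (of_real (?E m) - ?M m) \<le>
      (\<Sum>g\<in>P.unconfined (2 * m). norm (mean_weight eval_pairing {0..<2 * m} g) ^ 3) / real P.N ^ m"
      using eventually_gt_at_top[of 0]
    proof (rule eventually_mono)
      fix m :: nat assume "0 < m"
      then show "norm (of_real (?E m) - ?M m) \<le>
        (\<Sum>g\<in>P.unconfined (2 * m). norm (mean_weight eval_pairing {0..<2 * m} g) ^ 3) / real P.N ^ m"
        using sum_hit_prob_error[OF fin d, of m] by simp
    qed
  qed
  moreover have "?M \<longlonglongrightarrow> (\<Sum>f\<in>antisymmetric_forms. if \<forall>x\<in>V. cnj (f x x) ^ d = 1 then 1 else 0)"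
  proof (rule tendsto_sum)
    fix f assume f: "f \<in> antisymmetric_forms"
    have e: "(\<Prod>i\<in>{0..<2 * m}. cnj (f (q i) (q i)) ^ d) = (\<Prod>i\<in>{0..<2 * m}. (\<lambda>x\<in>V. cnj (f x x) ^ d) (q i))" 
      if "q \<in> full {0..<2 * m}" for q m
      using that by (intro prod.cong refl) (auto simp: full_def)
    show "(\<lambda>m. (\<Sum>q\<in>full {0..<2 * m}. \<Prod>i\<in>{0..<2 * m}. cnj (f (q i) (q i)) ^ d) / of_nat (card V) ^ (2 * m))
       \<longlonglongrightarrow> (if \<forall>x\<in>V. cnj (f x x) ^ d = 1 then 1 else 0)"
      using sum_full_character_tendsto[OF fin diagonal_character[OF f, of d]] by (simp add: e cong: sum.cong)
  qed
  ultimately have "(\<lambda>m. (of_real (?E m) - ?M m) + ?M m) \<longlonglongrightarrow> 0 + (\<Sum>f\<in>antisymmetric_forms. if \<forall>x\<in>V. cnj (f x x) ^ d = 1 then 1 else 0)"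
    by (rule tendsto_add)
  moreover have "(\<Sum>f\<in>antisymmetric_forms. if \<forall>x\<in>V. cnj (f x x) ^ d = 1 then 1 else (0::complex)) =
     of_real (real (card {f \<in> antisymmetric_forms. \<forall>x\<in>V. f x x ^ d = 1}))"
  proof -
    have "cnj z ^ d = 1 \<longleftrightarrow> z ^ d = 1" for z :: complex
      by (metis complex_cnj_cnj complex_cnj_one complex_cnj_power)
    then show ?thesis using finite_antisymmetric_forms[OF fin] by (simp flip: sum.inter_filter)
  qed
  ultimately have "(\<lambda>m. complex_of_real (?E m)) \<longlonglongrightarrow> of_real (real (card {f \<in> antisymmetric_forms. \<forall>x\<in>V. f x x ^ d = 1}))" by simp
  then show ?thesis by (simp only: tendsto_of_real_iff)
qed

end

section \<open>Surjections from the sandpile group\<close>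

context comm_group begin

lemma additive_map_int_pow:
  fixes h :: "int \<Rightarrow> 'a"
  assumes h: "\<And>a b. h (a + b) = h a \<otimes> h b" and c: "\<And>a. h a \<in> V"
  shows "h a = h 1 [^] a"
proof -
  have h0: "h 0 = \<one>" using h[of 0 0] c[of 0] by (metis add_0 r_cancel_one')
  have nat: "h (int n) = h 1 [^] n" for n
    by (induction n) (use h0 h[of 1] c in \<open>auto simp: m_comm\<close>)
  have pos: "h b = h 1 [^] b" if "b \<ge> 0" for b
  proof -
    have "h 1 [^] b = h 1 [^] int (nat b)" using that by simp
    also have "\<dots> = h 1 [^] nat b" by (rule int_pow_int)
    also have "\<dots> = h (int (nat b))" by (rule nat[symmetric])
    finally show ?thesis using that by simp
  qed
  show ?thesis
  proof (cases "a \<ge> 0")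
    case False
    have "h (- a) \<otimes> h a = \<one>" using h[of "- a" a] h0 by simp
    then have "h a = inv (h (- a))" using c by (metis inv_equality inv_inv)
    also have "h (- a) = h 1 [^] (- a)" using False by (intro pos) simp
    also have "inv (h 1 [^] (- a)) = h 1 [^] a" using c by (simp add: int_pow_neg)
    finally show ?thesis .
  qed (rule pos)
qed

text \<open>The homomorphism from integer vectors that sends the unit vector \<open>j\<close> to \<open>q j\<close>.\<close>

definition eval_vec :: "nat \<Rightarrow> (nat \<Rightarrow> 'a) \<Rightarrow> int Matrix.vec \<Rightarrow> 'a" where
  "eval_vec m q v = finprod G (\<lambda>j. q j [^] (vec_index v j)) {0..<m}"

lemma eval_vec_closed: "(\<And>j. j < m \<Longrightarrow> q j \<in> V) \<Longrightarrow> eval_vec m q v \<in> V"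
  unfolding eval_vec_def by (intro finprod_closed) auto

lemma eval_vec_add:
  assumes "\<And>j. j < m \<Longrightarrow> q j \<in> V" "v \<in> carrier_vec m" "w \<in> carrier_vec m"
  shows "eval_vec m q (v + w) = eval_vec m q v \<otimes> eval_vec m q w"
proof -
  have "eval_vec m q (v + w) = finprod G (\<lambda>j. q j [^] (vec_index v j) \<otimes> q j [^] (vec_index w j)) {0..<m}"
    unfolding eval_vec_def using assms by (intro finprod_cong') (auto simp: int_pow_mult)
  also have "\<dots> = eval_vec m q v \<otimes> eval_vec m q w"
    unfolding eval_vec_def using assms by (intro finprod_multf) auto
  finally show ?thesis .
qed

lemma finprod_single:
  assumes "finite A" "i \<in> A" "x \<in> V"
  shows "finprod G (\<lambda>j. if i = j then x else \<one>) A = x"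
  using finprod_singleton[OF assms(2,1), of "\<lambda>_. x"] assms(3) by simp

lemma eval_vec_unit:
  assumes "\<And>j. j < m \<Longrightarrow> q j \<in> V" "i < m"
  shows "eval_vec m q (unit_vec m i) = q i"
proof -
  have "eval_vec m q (unit_vec m i) = finprod G (\<lambda>j. if i = j then q i else \<one>) {0..<m}"
    unfolding eval_vec_def using assms by (intro finprod_cong') (auto simp: unit_vec_def)
  then show ?thesis using finprod_single[of "{0..<m}" i "q i"] assms by simp
qed

lemma hom_vec_unique:
  assumes h: "h \<in> hom (monoid_vec TYPE(int) m) G" and v: "v \<in> carrier_vec m"
  shows "h v = eval_vec m (\<lambda>j. h (unit_vec m j)) v"
proof -
  have hc: "h w \<in> V" if "w \<in> carrier_vec m" for w using h that by (auto simp: hom_def monoid_vec_simps)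
  have hm: "h (w + w') = h w \<otimes> h w'" if "w \<in> carrier_vec m" "w' \<in> carrier_vec m" for w w'
    using h that by (auto simp: hom_def monoid_vec_simps)
  have sm: "h (a \<cdot>\<^sub>v unit_vec m j) = h (unit_vec m j) [^] a" for a :: int and j
  proof -
    have "h (a \<cdot>\<^sub>v unit_vec m j) = h (1 \<cdot>\<^sub>v unit_vec m j) [^] a"
      by (rule additive_map_int_pow) (auto simp: add_smult_distrib_vec hm hc)
    then show ?thesis by simp
  qed
  define t where "t k = Matrix.vec m (\<lambda>j. if j < k then vec_index v j else 0)" for k
  have "h (t k) = finprod G (\<lambda>j. h (unit_vec m j) [^] (vec_index v j)) {0..<k}" if "k \<le> m" for k
    using that
  proof (induction k)
    case 0
    have "t 0 = 0 \<cdot>\<^sub>v unit_vec m 0" by (auto simp: t_def)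
    then show ?case using sm[of 0 0] by simp
  next
    case (Suc k)
    have "t (Suc k) = t k + (vec_index v k) \<cdot>\<^sub>v unit_vec m k" using Suc.prems
      by (intro eq_vecI) (auto simp: t_def unit_vec_def less_Suc_eq)
    then have "h (t (Suc k)) = h (t k) \<otimes> h ((vec_index v k) \<cdot>\<^sub>v unit_vec m k)" using hm by (simp add: t_def)
    also have "\<dots> = finprod G (\<lambda>j. h (unit_vec m j) [^] (vec_index v j)) {0..<k} \<otimes> h (unit_vec m k) [^] (vec_index v k)"
      using Suc sm by simp
    also have "\<dots> = finprod G (\<lambda>j. h (unit_vec m j) [^] (vec_index v j)) (insert k {0..<k})"
      using hc by (subst finprod_insert) (auto simp: m_comm)
    finally show ?case by (simp add: atLeast0_lessThan_Suc)
  qed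
  moreover have "t m = v" using v by (auto simp: t_def)
  ultimately show ?thesis unfolding eval_vec_def by (metis order_refl)
qed

text \<open>Converts a row of the adjacency matrix, which counts edges with multiplicity, into the product over
the matchings.\<close>

lemma finprod_multiplicities:
  fixes d n :: nat and p :: "nat \<Rightarrow> nat"
  assumes "\<And>k. k < d \<Longrightarrow> p k < n" "\<And>j. j < n \<Longrightarrow> q j \<in> V"
  shows "finprod G (\<lambda>j. q j [^] (\<Sum>k\<in>{0..<d}. if p k = j then 1 else 0 :: int)) {0..<n} = finprod G (\<lambda>k. q (p k)) {0..<d}"
  using assms(1)
proof (induction d)
  case (Suc d)
  let ?S = "\<lambda>j. \<Sum>k\<in>{0..<d}. if p k = j then 1 else 0 :: int"
  have pd: "q (p d) \<in> V" using assms(2) Suc.prems by auto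
  have "finprod G (\<lambda>j. q j [^] (\<Sum>k\<in>{0..<Suc d}. if p k = j then 1 else 0 :: int)) {0..<n} =
     finprod G (\<lambda>j. q j [^] ?S j \<otimes> (if p d = j then q (p d) else \<one>)) {0..<n}"
    using assms(2) pd by (intro finprod_cong') (auto simp: int_pow_mult)
  also have "\<dots> = finprod G (\<lambda>j. q j [^] ?S j) {0..<n} \<otimes> finprod G (\<lambda>j. if p d = j then q (p d) else \<one>) {0..<n}"
    using assms(2) pd by (intro finprod_multf) auto
  also have "finprod G (\<lambda>j. if p d = j then q (p d) else \<one>) {0..<n} = q (p d)"
    using Suc.prems pd by (intro finprod_single) auto
  also have "finprod G (\<lambda>j. q j [^] ?S j) {0..<n} = finprod G (\<lambda>k. q (p k)) {0..<d}"
    using Suc by simp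
  also have "finprod G (\<lambda>k. q (p k)) {0..<d} \<otimes> q (p d) = finprod G (\<lambda>k. q (p k)) (insert d {0..<d})"
    using assms(2) Suc.prems pd by (subst finprod_insert) (auto simp: m_comm)
  finally show ?case by (simp add: atLeast0_lessThan_Suc)
qed simp

end

text \<open>Homomorphisms from the sandpile group of a fixed tuple of matchings are labellings of the vertices
by elements of \<open>G\<close>, normalized to be trivial at the deleted vertex.\<close>

locale sandpile_hom = comm_group G for G (structure) +
  fixes d n :: nat and M :: "nat \<Rightarrow> nat \<Rightarrow> nat"
  assumes fin: "finite (carrier G)" and n: "n > 0"
    and M: "\<And>k. k < d \<Longrightarrow> M k \<in> matchings {0..<n}"
begin

abbreviation "m \<equiv> n - 1"
abbreviation "Z \<equiv> monoid_vec TYPE(int) m"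
abbreviation "\<Delta> \<equiv> reduced_laplacian d n M"
abbreviation "R \<equiv> row_space m \<Delta>"

lemma M_less: "k < d \<Longrightarrow> i < n \<Longrightarrow> M k i < n"
  using M[of k] permutes_in_image[of "M k" "{0..<n}" i] by (auto simp: matchings_def)

lemma laplacian_dims: "\<Delta> \<in> carrier_mat m m"
  by (simp add: reduced_laplacian_def mat_delete_def adjacency_matrix_def)

lemma laplacian_entry:
  assumes "i < m" "j < m"
  shows "\<Delta> $$ (i, j) = (\<Sum>k\<in>{0..<d}. if M k i = j then 1 else 0) - (if i = j then int d else 0)"
  using assms by (simp add: reduced_laplacian_def mat_delete_def adjacency_matrix_def permutation_matrix_def)

definition anchored :: "(nat \<Rightarrow> 'a) \<Rightarrow> bool" where
  "anchored q \<longleftrightarrow> q \<in> PiE {0..<n} (\<lambda>_. V) \<and> q m = \<one>"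

lemma eval_row:
  assumes q: "anchored q" and i: "i < m"
  shows "eval_vec m q (Matrix.row \<Delta> i) = finprod G (\<lambda>k. q (M k i)) {0..<d} \<otimes> inv (q i [^] d)"
proof -
  have qV: "q j \<in> V" if "j < n" for j using q that by (auto simp: anchored_def)
  let ?S = "\<lambda>j. \<Sum>k\<in>{0..<d}. if M k i = j then 1 else 0 :: int"
  let ?u = "\<lambda>j. if i = j then inv (q i [^] d) else \<one>"
  have qm: "q m = \<one>" using q by (simp add: anchored_def)
  have "eval_vec m q (Matrix.row \<Delta> i) = finprod G (\<lambda>j. q j [^] ?S j \<otimes> ?u j) {0..<m}"
    unfolding eval_vec_def
  proof (rule finprod_cong'[OF refl])
    show "(\<lambda>j. q j [^] ?S j \<otimes> ?u j) \<in> {0..<m} \<rightarrow> V" using qV i by auto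
    fix j assume j: "j \<in> {0..<m}"
    have e: "vec_index (Matrix.row \<Delta> i) j = ?S j + (if i = j then - int d else 0)"
      using i j laplacian_dims laplacian_entry[of i j] by auto
    have qj: "q j \<in> V" using qV j by auto
    show "q j [^] (vec_index (Matrix.row \<Delta> i) j) = q j [^] ?S j \<otimes> ?u j"
      unfolding e int_pow_mult[OF qj] using qj by (auto simp: int_pow_neg_int)
  qed
  also have "\<dots> = finprod G (\<lambda>j. q j [^] ?S j) {0..<m} \<otimes> finprod G ?u {0..<m}"
    using qV i by (intro finprod_multf) auto
  also have "finprod G ?u {0..<m} = inv (q i [^] d)" using i qV by (intro finprod_single) auto
  also have "finprod G (\<lambda>j. q j [^] ?S j) {0..<m} = finprod G (\<lambda>j. q j [^] ?S j) (insert m {0..<m})"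
    using qV qm by (subst finprod_insert) (auto intro!: m_closed finprod_closed l_one[symmetric])
  also have "insert m {0..<m} = {0..<n}" using n by auto
  also have "finprod G (\<lambda>j. q j [^] ?S j) {0..<n} = finprod G (\<lambda>k. q (M k i)) {0..<d}"
    using M_less i qV by (intro finprod_multiplicities) auto
  finally show ?thesis .
qed

text \<open>The equation at the deleted vertex follows from the others: each matching permutes the vertices, so
the product of both sides over all vertices agrees.\<close>

lemma hits_iff_rows:
  assumes q: "anchored q"
  shows "hits {0..<n} d q M \<longleftrightarrow> (\<forall>i<m. eval_vec m q (Matrix.row \<Delta> i) = \<one>)"
proof -
  have qV: "q j \<in> V" if "j < n" for j using q that by (auto simp: anchored_def)
  define v where "v i = finprod G (\<lambda>k. q (M k i)) {0..<d} \<otimes> inv (q i [^] d)" for i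
  have fc: "finprod G (\<lambda>k. q (M k i)) {0..<d} \<in> V" if "i < n" for i
    using qV M_less that by (intro finprod_closed) auto
  have vV: "v i \<in> V" if "i < n" for i using fc[OF that] qV[OF that] by (simp add: v_def)
  have v1: "v i = \<one> \<longleftrightarrow> finprod G (\<lambda>k. q (M k i)) {0..<d} = q i [^] d" if "i < n" for i
    unfolding v_def using fc[OF that] qV[OF that] by (metis inv_closed inv_equality inv_inv nat_pow_closed r_inv)
  have last: "v m = \<one>" if v: "\<And>i. i < m \<Longrightarrow> v i = \<one>"
  proof (rule ccontr)
    assume "v m \<noteq> \<one>"
    then obtain \<eta> where e: "\<eta> \<in> characters G" "\<eta> (v m) \<noteq> 1"
      using exists_character_neq_one[OF fin vV[of m]] n by auto
    have "(\<Prod>i\<in>{0..<n}. \<eta> (v i)) = (\<Prod>i\<in>{0..<n}. (\<Prod>k\<in>{0..<d}. \<eta> (q (M k i))) * inverse (\<eta> (q i) ^ d))"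
    proof (intro prod.cong refl)
      fix i assume i: "i \<in> {0..<n}"
      then show "\<eta> (v i) = (\<Prod>k\<in>{0..<d}. \<eta> (q (M k i))) * inverse (\<eta> (q i) ^ d)"
        unfolding v_def using fc[of i] qV M_less
        by (simp add: charactersD(2)[OF e(1)] character_inv(1)[OF e(1)] character_pow[OF e(1)] character_finprod[OF e(1)])
    qed
    also have "\<dots> = (\<Prod>k\<in>{0..<d}. \<Prod>i\<in>{0..<n}. \<eta> (q (M k i))) * inverse (\<Prod>i\<in>{0..<n}. \<eta> (q i) ^ d)"
      unfolding prod.distrib using prod_inversef[of "\<lambda>i. \<eta> (q i) ^ d" "{0..<n}"]
      by (subst prod.swap) (simp add: o_def)
    also have "(\<Prod>k\<in>{0..<d}. \<Prod>i\<in>{0..<n}. \<eta> (q (M k i))) = (\<Prod>k\<in>{0..<d}. \<Prod>i\<in>{0..<n}. \<eta> (q i))"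
    proof (rule prod.cong[OF refl])
      fix k assume "k \<in> {0..<d}"
      then have "M k permutes {0..<n}" using M[of k] by (simp add: matchings_def)
      from prod.permute[OF this, of "\<lambda>i. \<eta> (q i)"]
      show "(\<Prod>i\<in>{0..<n}. \<eta> (q (M k i))) = (\<Prod>i\<in>{0..<n}. \<eta> (q i))" by (simp add: o_def)
    qed
    also have "\<dots> * inverse (\<Prod>i\<in>{0..<n}. \<eta> (q i) ^ d) = 1"
      using charactersD(4)[OF e(1) qV] by (simp add: prod_power_distrib[symmetric])
    finally have "(\<Prod>i\<in>{0..<n}. \<eta> (v i)) = 1" .
    moreover have "{0..<n} = insert m {0..<m}" using n by auto
    ultimately have "\<eta> (v m) * (\<Prod>i\<in>{0..<m}. \<eta> (v i)) = 1" by simp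
    moreover have "(\<Prod>i\<in>{0..<m}. \<eta> (v i)) = 1" using v character_one[OF e(1)] by (intro prod.neutral) auto
    ultimately show False using e(2) by simp
  qed
  have "hits {0..<n} d q M \<longleftrightarrow> (\<forall>i<n. v i = \<one>)" using v1 by (auto simp: hits_def)
  also have "\<dots> \<longleftrightarrow> (\<forall>i<m. v i = \<one>)"
  proof (intro iffI allI impI)
    fix i assume all: "\<forall>i<m. v i = \<one>" and i: "i < n"
    show "v i = \<one>"
    proof (cases "i = m")
      case True then show ?thesis using last all by simp
    next
      case False then show ?thesis using all i by simp
    qed
  qed auto
  also have "\<dots> \<longleftrightarrow> (\<forall>i<m. eval_vec m q (Matrix.row \<Delta> i) = \<one>)" using eval_row[OF q] by (simp add: v_def)
  finally show ?thesis .
qed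

definition potentials :: "(nat \<Rightarrow> 'a) set" where
  "potentials = {q. anchored q \<and> generate G (q ` {0..<n}) = V \<and> hits {0..<n} d q M}"

lemma card_Sur: "card (Sur (sandpile_group d n M) G) = card potentials"
proof -
  interpret Z: comm_group Z by (rule comm_group_vec)
  have Zc: "carrier Z = carrier_vec m" by (simp add: monoid_vec_simps)
  have rows: "set (Matrix.rows \<Delta>) \<subseteq> carrier_vec m" using laplacian_dims rows_carrier[of \<Delta>] by auto
  have sR: "subgroup R Z" unfolding row_space_def using rows by (intro Z.generate_is_subgroup) (simp only: Zc)
  have nR: "R \<lhd> Z" using Z.normal_iff_subgroup sR by blast
  have grp: "group (Z Mod R)" by (rule normal.factorgroup_is_group[OF nR])
  have S: "sandpile_group d n M = Z Mod R" by (simp add: sandpile_group_def)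
  have carr: "carrier (Z Mod R) = (\<lambda>v. R #>\<^bsub>Z\<^esub> v) ` carrier_vec m"
    by (simp only: carrier_FactGroup Zc)
  have proj: "(\<lambda>v. R #>\<^bsub>Z\<^esub> v) \<in> hom Z (Z Mod R)" by (rule normal.r_coset_hom_Mod[OF nR])
  define \<Phi> where "\<Phi> h = (\<lambda>i\<in>{0..<n}. if i < m then h (R #>\<^bsub>Z\<^esub> unit_vec m i) else \<one>)" for h :: "int Matrix.vec set \<Rightarrow> 'a"
  have ev: "h (R #>\<^bsub>Z\<^esub> v) = eval_vec m (\<Phi> h) v" if h: "h \<in> hom (Z Mod R) G" and v: "v \<in> carrier_vec m" for h v
  proof -
    have "h \<circ> (\<lambda>v. R #>\<^bsub>Z\<^esub> v) \<in> hom Z G" by (rule Group.hom_compose[OF proj h])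
    from hom_vec_unique[OF this v] have "h (R #>\<^bsub>Z\<^esub> v) = eval_vec m (\<lambda>j. h (R #>\<^bsub>Z\<^esub> unit_vec m j)) v" by simp
    also have "\<dots> = eval_vec m (\<Phi> h) v"
    proof -
      have "h (R #>\<^bsub>Z\<^esub> unit_vec m j) \<in> V" for j using h carr by (auto simp: hom_def)
      then show ?thesis unfolding eval_vec_def by (intro finprod_cong') (auto simp: \<Phi>_def)
    qed
    finally show ?thesis .
  qed
  have bij: "bij_betw \<Phi> (Sur (sandpile_group d n M) G) potentials"
  proof (rule bij_betw_imageI)
    show "inj_on \<Phi> (Sur (sandpile_group d n M) G)"
    proof (rule inj_onI)
      fix h h' assume h: "h \<in> Sur (sandpile_group d n M) G" "h' \<in> Sur (sandpile_group d n M) G" and eq: "\<Phi> h = \<Phi> h'"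
      have hh: "h \<in> hom (Z Mod R) G" "h' \<in> hom (Z Mod R) G"
        "h \<in> extensional (carrier (Z Mod R))" "h' \<in> extensional (carrier (Z Mod R))"
        using h by (auto simp: Sur_def S epi_def)
      show "h = h'"
      proof (rule extensionalityI[OF hh(3,4)])
        fix X assume "X \<in> carrier (Z Mod R)"
        then obtain v where "v \<in> carrier_vec m" "X = R #>\<^bsub>Z\<^esub> v" using carr by auto
        then show "h X = h' X" using ev[OF hh(1)] ev[OF hh(2)] eq by simp
      qed
    qed
    show "\<Phi> ` Sur (sandpile_group d n M) G = potentials"
    proof (intro subset_antisym subsetI)
      fix q assume "q \<in> \<Phi> ` Sur (sandpile_group d n M) G"
      then obtain h where h: "h \<in> hom (Z Mod R) G" "h ` carrier (Z Mod R) = V" and q: "q = \<Phi> h"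
        by (auto simp: Sur_def S epi_def)
      have hV: "h (R #>\<^bsub>Z\<^esub> v) \<in> V" if "v \<in> carrier_vec m" for v using h carr that by (auto simp: hom_def)
      have qv: "anchored q" using n hV by (auto simp: anchored_def q \<Phi>_def)
      have qV: "q j \<in> V" if "j < n" for j using qv that by (auto simp: anchored_def)
      have qc: "q ` {0..<n} \<subseteq> V" using qV by auto
      have sg: "subgroup (generate G (q ` {0..<n})) G" by (rule generate_is_subgroup[OF qc])
      have "eval_vec m q v \<in> generate G (q ` {0..<n})" for v
      proof -
        have "finprod G (\<lambda>j. q j [^] (vec_index v j)) K \<in> generate G (q ` {0..<n})" if "finite K" "K \<subseteq> {0..<m}" for K
          using that
        proof (induction K rule: finite_induct)
          case empty then show ?case using subgroup.one_closed[OF sg] by simp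
        next
          case (insert j K)
          have "q j \<in> generate G (q ` {0..<n})" using insert by (intro generate.incl) auto
          then have "q j [^] (vec_index v j) \<in> generate G (q ` {0..<n})" by (rule subgroup_int_pow_closed[OF sg])
          moreover have "finprod G (\<lambda>j. q j [^] (vec_index v j)) (insert j K) = q j [^] (vec_index v j) \<otimes> finprod G (\<lambda>j. q j [^] (vec_index v j)) K"
            using insert qV by (intro finprod_insert) auto
          ultimately show ?case using insert subgroup.m_closed[OF sg] by simp
        qed
        then show ?thesis unfolding eval_vec_def by simp
      qed
      note evg = this
      have "V \<subseteq> generate G (q ` {0..<n})"
      proof
        fix x assume "x \<in> V"
        then obtain X where X: "X \<in> carrier (Z Mod R)" "x = h X" using h(2) by blast
        obtain v where v: "v \<in> carrier_vec m" "X = R #>\<^bsub>Z\<^esub> v" using X(1) unfolding carr by blast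
        have "x = eval_vec m q v" unfolding X(2) v(2) q by (rule ev[OF h(1) v(1)])
        then show "x \<in> generate G (q ` {0..<n})" using evg by simp
      qed
      then have gen: "generate G (q ` {0..<n}) = V" using subgroup.subset[OF sg] by blast
      have "eval_vec m q (Matrix.row \<Delta> i) = \<one>" if i: "i < m" for i
      proof -
        have rv: "Matrix.row \<Delta> i \<in> carrier_vec m" using laplacian_dims row_carrier_vec i by blast
        have "Matrix.row \<Delta> i \<in> set (Matrix.rows \<Delta>)" using i laplacian_dims by (auto simp: Matrix.rows_def)
        then have "Matrix.row \<Delta> i \<in> R" unfolding row_space_def by (rule generate.incl)
        then have "R #>\<^bsub>Z\<^esub> Matrix.row \<Delta> i = \<one>\<^bsub>Z Mod R\<^esub>"
          unfolding one_FactGroup by (rule Z.coset_join2[OF rv[folded Zc] sR])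
        then have "h (R #>\<^bsub>Z\<^esub> Matrix.row \<Delta> i) = \<one>" using hom_one[OF h(1) grp is_group] by simp
        then show ?thesis using ev[OF h(1) rv] q by simp
      qed
      then show "q \<in> potentials" using qv gen hits_iff_rows[OF qv] by (simp add: potentials_def)
    next
      fix q assume "q \<in> potentials"
      then have qv: "anchored q" and gen: "generate G (q ` {0..<n}) = V" and ht: "hits {0..<n} d q M"
        by (auto simp: potentials_def)
      have qV: "q j \<in> V" if "j < n" for j using qv that by (auto simp: anchored_def)
      have qVm: "q j \<in> V" if "j < m" for j using qV that by simp
      have eh: "eval_vec m q \<in> hom Z G"
        using eval_vec_closed[OF qVm] eval_vec_add[OF qVm] by (auto simp: hom_def monoid_vec_simps)
      interpret E: group_hom Z G "eval_vec m q" by unfold_locales (rule eh)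
      have "set (Matrix.rows \<Delta>) \<subseteq> kernel Z G (eval_vec m q)"
      proof
        fix r assume r: "r \<in> set (Matrix.rows \<Delta>)"
        then obtain i where "i < m" "r = Matrix.row \<Delta> i" using laplacian_dims by (auto simp: Matrix.rows_def)
        then show "r \<in> kernel Z G (eval_vec m q)" 
          using subsetD[OF rows r, folded Zc] ht hits_iff_rows[OF qv] by (auto simp: kernel_def)
      qed
      then have ker: "R \<subseteq> kernel Z G (eval_vec m q)"
        unfolding row_space_def by (rule Z.generate_subgroup_incl[OF _ E.subgroup_kernel])
      obtain g where g: "g \<in> hom (Z Mod R) G" "\<And>v. v \<in> carrier Z \<Longrightarrow> g (R #>\<^bsub>Z\<^esub> v) = eval_vec m q v"
        using E.FactGroup_universal_kernel[OF nR ker] by blast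
      define h where "h = restrict g (carrier (Z Mod R))"
      have hh: "h \<in> hom (Z Mod R) G"
      proof (rule homI)
        fix x assume x: "x \<in> carrier (Z Mod R)"
        show "h x \<in> V" using hom_in_carrier[OF g(1) x] x by (simp only: h_def restrict_apply')
        fix y assume y: "y \<in> carrier (Z Mod R)"
        have "x \<otimes>\<^bsub>Z Mod R\<^esub> y \<in> carrier (Z Mod R)"
          by (rule monoid.m_closed[OF group.is_monoid[OF grp] x y])
        then show "h (x \<otimes>\<^bsub>Z Mod R\<^esub> y) = h x \<otimes> h y"
          using hom_mult[OF g(1) x y] x y by (simp only: h_def restrict_apply')
      qed
      have \<Phi>h: "\<Phi> h = q"
      proof
        fix i
        have qe: "q \<in> extensional {0..<n}" "q m = \<one>" using qv by (auto simp: anchored_def PiE_def)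
        show "\<Phi> h i = q i"
        proof (cases "i < m")
          case True
          have "R #>\<^bsub>Z\<^esub> unit_vec m i \<in> carrier (Z Mod R)" using carr by auto
          moreover have "unit_vec m i \<in> carrier Z" unfolding Zc by simp
          moreover have "i < n" using True by simp
          ultimately show ?thesis
            using True g(2)[of "unit_vec m i"] eval_vec_unit[where q = q, OF qVm True] by (simp add: \<Phi>_def h_def)
        next
          case False
          then show ?thesis using qe n by (cases "i = m") (auto simp: \<Phi>_def extensional_def)
        qed
      qed
      have "subgroup (h ` carrier (Z Mod R)) G"
        using group_hom.img_is_subgroup[of "Z Mod R" G h] hh grp is_group by (simp add: group_hom_def group_hom_axioms_def)
      moreover have "q ` {0..<n} \<subseteq> h ` carrier (Z Mod R)"
      proof
        fix x assume "x \<in> q ` {0..<n}"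
        then obtain i where i: "i < n" "x = q i" by auto
        show "x \<in> h ` carrier (Z Mod R)"
        proof (cases "i < m")
          case True
          then have "x = h (R #>\<^bsub>Z\<^esub> unit_vec m i)" using i fun_cong[OF \<Phi>h, of i] by (simp add: \<Phi>_def)
          moreover have "R #>\<^bsub>Z\<^esub> unit_vec m i \<in> carrier (Z Mod R)" using carr by auto
          ultimately show ?thesis by (simp only: imageI)
        next
          case False
          then have "i = m" using i by simp
          then have "x = \<one>" using i qv by (simp add: anchored_def)
          then show ?thesis using subgroup.one_closed[OF calculation] by simp
        qed
      qed
      ultimately have "V \<subseteq> h ` carrier (Z Mod R)" using generate_subgroup_incl gen by metis
      moreover have "h ` carrier (Z Mod R) \<subseteq> V" using hh by (auto simp: hom_def)
      ultimately have "h \<in> Sur (sandpile_group d n M) G"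
        using hh by (auto simp: Sur_def S epi_def h_def)
      then show "q \<in> \<Phi> ` Sur (sandpile_group d n M) G" using \<Phi>h by (metis imageI)
    qed
  qed
  then show ?thesis by (rule bij_betw_same_card)
qed

end

context comm_group begin

lemma differences_translate:
  assumes "q \<in> A \<rightarrow> V" "c \<in> V"
  shows "differences A (\<lambda>i\<in>A. c \<otimes> q i) = differences A q"
proof -
  have "(c \<otimes> q i) \<otimes> inv (c \<otimes> q j) = q i \<otimes> inv (q j)" if "i \<in> A" "j \<in> A" for i j
    using assms that by (intro cancel_common_factor) auto
  then show ?thesis unfolding differences_def by (intro Collect_cong) auto
qed

lemma hits_translate:
  assumes "q \<in> A \<rightarrow> V" "c \<in> V" and M: "M \<in> PiE {0..<d} (\<lambda>_. matchings A)"
  shows "hits A d (\<lambda>i\<in>A. c \<otimes> q i) M \<longleftrightarrow> hits A d q M"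
proof -
  have MA: "M k i \<in> A" if "k < d" "i \<in> A" for k i
    using PiE_mem[OF M, of k] that permutes_in_image[of "M k" A] by (auto simp: matchings_def)
  have qV: "q i \<in> V" if "i \<in> A" for i using assms that by auto
  have "finprod G (\<lambda>k. (\<lambda>i\<in>A. c \<otimes> q i) (M k i)) {0..<d} = (\<lambda>i\<in>A. c \<otimes> q i) i [^] d \<longleftrightarrow>
      finprod G (\<lambda>k. q (M k i)) {0..<d} = q i [^] d" if i: "i \<in> A" for i
  proof -
    have f: "finprod G (\<lambda>k. q (M k i)) {0..<d} \<in> V" using MA qV i by (intro finprod_closed) auto
    have "finprod G (\<lambda>k. (\<lambda>i\<in>A. c \<otimes> q i) (M k i)) {0..<d} = finprod G (\<lambda>k. c \<otimes> q (M k i)) {0..<d}"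
      using MA qV i assms(2) by (intro finprod_cong') auto
    also have "\<dots> = c [^] d \<otimes> finprod G (\<lambda>k. q (M k i)) {0..<d}"
      using MA qV i assms(2) by (subst finprod_multf) (auto simp: finprod_const)
    finally have "finprod G (\<lambda>k. (\<lambda>i\<in>A. c \<otimes> q i) (M k i)) {0..<d} = c [^] d \<otimes> finprod G (\<lambda>k. q (M k i)) {0..<d}" .
    moreover have "(\<lambda>i\<in>A. c \<otimes> q i) i [^] d = c [^] d \<otimes> q i [^] d"
      using i assms(2) qV by (simp add: pow_mult_distrib m_comm)
    ultimately show ?thesis using f assms(2) qV[OF i] by simp
  qed
  then show ?thesis unfolding hits_def by blast
qed

lemma hit_prob_translate:
  assumes "q \<in> A \<rightarrow> V" "c \<in> V"
  shows "hit_prob A d (\<lambda>i\<in>A. c \<otimes> q i) = hit_prob A d q"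
proof -
  have "{M \<in> PiE {0..<d} (\<lambda>_. matchings A). hits A d (\<lambda>i\<in>A. c \<otimes> q i) M} =
    {M \<in> PiE {0..<d} (\<lambda>_. matchings A). hits A d q M}" using hits_translate[OF assms] by blast
  then show ?thesis by (simp only: hit_prob_def)
qed

text \<open>The candidates for surjections, which do not depend on the matchings.\<close>

definition grounded :: "nat \<Rightarrow> (nat \<Rightarrow> 'a) set" where
  "grounded n = {q \<in> PiE {0..<n} (\<lambda>_. V). q (n - 1) = \<one> \<and> generate G (q ` {0..<n}) = V}"

text \<open>Every full assignment is uniquely a translate of a grounded one, and translation changes both sides
of \<open>C q = d q\<close> equally.\<close>

lemma sum_full_grounded:
  assumes fin: "finite V" and n: "n > 0"
  shows "(\<Sum>q\<in>full {0..<n}. hit_prob {0..<n} d q) = real (card V) * (\<Sum>q\<in>grounded n. hit_prob {0..<n} d q)"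
proof -
  let ?A = "{0..<n}" let ?l = "n - 1"
  have l: "?l \<in> ?A" using n by simp
  have "(\<Sum>q\<in>full ?A. hit_prob ?A d q) = (\<Sum>(q, c)\<in>grounded n \<times> V. hit_prob ?A d q)"
  proof (rule sum.reindex_bij_witness[of _ "\<lambda>(q, c). \<lambda>i\<in>?A. c \<otimes> q i" "\<lambda>p. (\<lambda>i\<in>?A. inv (p ?l) \<otimes> p i, p ?l)"], goal_cases)
    case (1 p)
    then have pV: "p i \<in> V" if "i \<in> ?A" for i using that by (auto simp: full_def)
    have "p \<in> extensional ?A" using 1 by (auto simp: full_def PiE_def)
    then show ?case using pV l by (auto simp: fun_eq_iff m_assoc[symmetric] extensional_def)
  next
    case (2 p)
    then have pV: "p i \<in> V" if "i \<in> ?A" for i using that by (auto simp: full_def)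
    have pA: "p \<in> ?A \<rightarrow> V" using pV by auto
    let ?q = "\<lambda>i\<in>?A. inv (p ?l) \<otimes> p i"
    have qV: "?q ` ?A \<subseteq> V" using pV l by auto
    have "differences ?A p = differences ?A ?q" using pA pV[OF l] by (intro differences_translate[symmetric]) auto
    also have "\<dots> \<subseteq> generate G (?q ` ?A)"
    proof
      fix x assume "x \<in> differences ?A ?q"
      then obtain i j where x: "x = ?q i \<otimes> inv (?q j)" "i \<in> ?A" "j \<in> ?A" unfolding differences_def by blast
      show "x \<in> generate G (?q ` ?A)" unfolding x(1)
        by (intro generate.eng generate.incl generate.inv imageI x(2,3))
    qed
    finally have "generate G (differences ?A p) \<subseteq> generate G (?q ` ?A)"
      by (rule generate_subgroup_incl[OF _ generate_is_subgroup[OF qV]])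
    then have "generate G (?q ` ?A) = V"
      using 2 subgroup.subset[OF generate_is_subgroup[OF qV]] by (simp add: full_def subset_antisym)
    then show ?case using qV pV[OF l] l by (auto simp: grounded_def)
  next
    case (3 x)
    obtain q c where x: "x = (q, c)" by (cases x)
    then have q: "q \<in> grounded n" and c: "c \<in> V" using 3 by auto
    have qV: "q i \<in> V" if "i \<in> ?A" for i using that q by (auto simp: grounded_def)
    have e: "q \<in> extensional ?A" "q ?l = \<one>" using q by (auto simp: grounded_def PiE_def)
    show ?case using e qV c l by (auto simp: x fun_eq_iff m_assoc[symmetric] extensional_def)
  next
    case (4 x)
    obtain q c where x: "x = (q, c)" by (cases x)
    then have q: "q \<in> grounded n" and c: "c \<in> V" using 4 by auto
    have qV: "q i \<in> V" if "i \<in> ?A" for i using that q by (auto simp: grounded_def)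
    have qA: "q \<in> ?A \<rightarrow> V" using qV by auto
    have dV: "differences ?A q \<subseteq> V" using qV by (auto simp: differences_def)
    have "q ` ?A \<subseteq> generate G (differences ?A q)"
    proof
      fix y assume "y \<in> q ` ?A"
      then obtain i where i: "i \<in> ?A" "y = q i" by blast
      have "q i \<otimes> inv (q ?l) \<in> generate G (differences ?A q)"
        unfolding differences_def using i l
        by (intro generate.incl CollectI exI[of _ i] exI[of _ ?l]) auto
      then show "y \<in> generate G (differences ?A q)" using i qV q by (simp add: grounded_def)
    qed
    then have "generate G (q ` ?A) \<subseteq> generate G (differences ?A q)"
      by (rule generate_subgroup_incl[OF _ generate_is_subgroup[OF dV]])
    then have "generate G (differences ?A q) = V"
      using q subgroup.subset[OF generate_is_subgroup[OF dV]] by (simp add: grounded_def subset_antisym)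
    then show ?case using differences_translate[OF qA c] qV c by (auto simp: x full_def)
  next
    case (5 p)
    then have pA: "p \<in> ?A \<rightarrow> V" by (auto simp: full_def)
    then have "inv (p ?l) \<in> V" using l by auto
    then show ?case using hit_prob_translate[OF pA, of "inv (p ?l)" d] by simp
  qed
  also have "\<dots> = (\<Sum>q\<in>grounded n. \<Sum>c\<in>V. hit_prob ?A d q)" by (rule sum.cartesian_product[symmetric])
  also have "\<dots> = real (card V) * (\<Sum>q\<in>grounded n. hit_prob ?A d q)" by (simp add: sum_distrib_left)
  finally show ?thesis .
qed

theorem expected_sur_eq:
  assumes fin: "finite V" and n: "even n" "n > 0"
  shows "expected_sur d n G = (\<Sum>q\<in>full {0..<n}. hit_prob {0..<n} d q) / real (card V)"
proof -
  let ?A = "{0..<n}" let ?D = "PiE_dflt {0..<d} id (\<lambda>_. matchings {0..<n})"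
  let ?c = "\<lambda>M. card (Sur (sandpile_group d n M) G)"
  have fM: "finite (matchings ?A)" by (rule finite_matchings) simp
  have neM: "matchings ?A \<noteq> {}" using n by (intro matchings_nonempty) auto
  have fD: "finite ?D" by (intro finite_PiE_dflt fM) simp
  have cD: "card ?D = card (matchings ?A) ^ d" using fM by (subst card_PiE_dflt) auto
  have "card (matchings ?A) > 0" using neM fM by (simp add: card_gt_0_iff)
  then have "card ?D > 0" unfolding cD by simp
  then have neD: "?D \<noteq> {}" by (metis card.empty less_irrefl)
  have "random_matchings d n = pmf_of_set ?D"
    unfolding random_matchings_def perfect_matchings_eq by (intro Pi_pmf_of_set fM neM) simp
  then have "expected_sur d n G = (\<Sum>M\<in>?D. real (?c M)) / real (card ?D)"
    unfolding expected_sur_def by (simp add: integral_pmf_of_set[OF neD fD])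
  also have "(\<Sum>M\<in>?D. real (?c M)) = (\<Sum>M\<in>?D. \<Sum>q\<in>grounded n. if hits ?A d q M then 1 else 0)"
  proof (rule sum.cong[OF refl])
    fix M assume M: "M \<in> ?D"
    interpret S: sandpile_hom G d n M
      by unfold_locales (use fin n M in \<open>auto simp: PiE_dflt_def\<close>)
    have "S.potentials = {q \<in> grounded n. hits ?A d q M}"
      unfolding S.potentials_def S.anchored_def grounded_def by auto
    moreover have "finite (grounded n)"
      by (rule finite_subset[of _ "PiE ?A (\<lambda>_. V)"]) (use fin in \<open>auto simp: grounded_def intro!: finite_PiE\<close>)
    ultimately show "real (?c M) = (\<Sum>q\<in>grounded n. if hits ?A d q M then 1 else 0)"
      using S.card_Sur by (simp flip: sum.inter_filter)
  qed
  also have "\<dots> = (\<Sum>q\<in>grounded n. \<Sum>M\<in>?D. if hits ?A d q M then 1 else 0)" by (rule sum.swap)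
  also have "\<dots> = (\<Sum>q\<in>grounded n. hit_prob ?A d q * real (card ?D))"
  proof (rule sum.cong[OF refl])
    fix q assume q: "q \<in> grounded n"
    have "(\<Sum>M\<in>?D. if hits ?A d q M then 1 else 0) = real (card {M\<in>?D. hits ?A d q M})"
      using fD by (simp flip: sum.inter_filter)
    also have "card {M\<in>?D. hits ?A d q M} = card {M \<in> PiE {0..<d} (\<lambda>_. matchings ?A). hits ?A d q M}"
    proof (rule bij_betw_same_card)
      have h: "hits ?A d q M' \<longleftrightarrow> hits ?A d q M"
        if M: "\<And>k. k < d \<Longrightarrow> M k \<in> matchings ?A" and eq: "\<And>k. k < d \<Longrightarrow> M' k = M k" for M M'
      proof -
        have "q (M k i) \<in> V" if "k < d" "i \<in> ?A" for k i
          using M[OF that(1)] that(2) q permutes_in_image[of "M k" ?A i] by (auto simp: matchings_def grounded_def)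
        then have "finprod G (\<lambda>k. q (M' k i)) {0..<d} = finprod G (\<lambda>k. q (M k i)) {0..<d}" if "i \<in> ?A" for i
          using that by (intro finprod_cong') (auto simp: eq)
        then show ?thesis by (simp add: hits_def)
      qed
      show "bij_betw (\<lambda>M. restrict M {0..<d}) {M\<in>?D. hits ?A d q M} {M \<in> PiE {0..<d} (\<lambda>_. matchings ?A). hits ?A d q M}"
      proof (rule bij_betwI[of _ _ _ "\<lambda>M k. if k < d then M k else id"], goal_cases)
        case 1
        have "hits ?A d q (restrict M {0..<d})" if "M \<in> ?D" "hits ?A d q M" for M
          using that h[of M "restrict M {0..<d}"] by (auto simp: PiE_dflt_def)
        then show ?case by (auto simp: PiE_dflt_def)
      next
        case 2
        have "hits ?A d q (\<lambda>k. if k < d then M k else id)" 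
          if "M \<in> PiE {0..<d} (\<lambda>_. matchings ?A)" "hits ?A d q M" for M
          using that(2) h[of M "\<lambda>k. if k < d then M k else id"] PiE_mem[OF that(1)] by simp
        then show ?case by (auto simp: PiE_dflt_def)
      next
        case (3 M) then show ?case by (auto simp: PiE_dflt_def fun_eq_iff)
      next
        case (4 M) then show ?case by (auto simp: PiE_def extensional_def fun_eq_iff)
      qed
    qed
    finally have e: "(\<Sum>M\<in>?D. if hits ?A d q M then 1 else 0) =
       real (card {M \<in> PiE {0..<d} (\<lambda>_. matchings ?A). hits ?A d q M})" .
    show "(\<Sum>M\<in>?D. if hits ?A d q M then 1 else 0) = hit_prob ?A d q * real (card ?D)"
      unfolding e hit_prob_def cD using neM fM by simp
  qed
  also have "\<dots> / real (card ?D) = (\<Sum>q\<in>grounded n. hit_prob ?A d q)"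
    using neD fD by (simp add: sum_distrib_right[symmetric])
  also have "\<dots> = (\<Sum>q\<in>full ?A. hit_prob ?A d q) / real (card V)"
    using fin unfolding sum_full_grounded[OF fin n(2)] by (simp add: card_eq_0_iff) auto
  finally show ?thesis .
qed

end

section \<open>Characters of the exterior square\<close>

definition circle :: "complex monoid" where
  "circle = \<lparr>carrier = {z. norm z = 1}, mult = (*), one = 1\<rparr>"

lemma comm_group_circle: "comm_group circle"
proof (rule comm_groupI)
  fix x assume "x \<in> carrier circle"
  then show "\<exists>y\<in>carrier circle. y \<otimes>\<^bsub>circle\<^esub> x = \<one>\<^bsub>circle\<^esub>"
    by (intro bexI[of _ "inverse x"]) (auto simp: circle_def norm_inverse intro!: left_inverse)
qed (auto simp: circle_def norm_mult)

lemma characters_eq_hom: "characters G = hom G circle \<inter> extensional (carrier G)"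
  by (auto simp: characters_def hom_def circle_def)

lemma bij_betw_Collect:
  assumes "bij_betw f A B" "\<And>a. a \<in> A \<Longrightarrow> P a \<longleftrightarrow> Q (f a)"
  shows "bij_betw f {a \<in> A. P a} {b \<in> B. Q b}"
  using assms unfolding bij_betw_def by (auto simp: inj_on_def)

lemma restrict_hom_character:
  assumes "group G" "h \<in> hom G circle" shows "restrict h (carrier G) \<in> characters G"
proof -
  interpret group G by (rule assms(1))
  show ?thesis using assms(2) by (auto simp: characters_def hom_def circle_def)
qed

text \<open>Universal property of the quotient. It reduces the dual of a group given by generators and relations
to families of unit complex numbers that satisfy the relations.\<close>

lemma (in comm_group) quotient_characters:
  assumes S: "S \<subseteq> carrier G" and N: "N = generate G S"
  shows "bij_betw (\<lambda>\<eta>. \<lambda>x\<in>carrier G. \<eta> (N #> x)) (characters (G Mod N)) {\<eta> \<in> characters G. \<forall>s\<in>S. \<eta> s = 1}"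
proof -
  have sN: "subgroup N G" unfolding N by (rule generate_is_subgroup[OF S])
  have nN: "N \<lhd> G" using normal_iff_subgroup sN by blast
  interpret Q: group "G Mod N" by (rule normal.factorgroup_is_group[OF nN])
  have proj: "(\<lambda>x. N #> x) \<in> hom G (G Mod N)" by (rule normal.r_coset_hom_Mod[OF nN])
  have carr: "carrier (G Mod N) = (\<lambda>x. N #> x) ` carrier G" by (rule carrier_FactGroup)
  let ?f = "\<lambda>\<eta>. \<lambda>x\<in>carrier G. \<eta> (N #> x)"
  show ?thesis
  proof (rule bij_betw_imageI)
    show "inj_on ?f (characters (G Mod N))"
    proof (rule inj_onI)
      fix \<eta> \<psi> assume *: "\<eta> \<in> characters (G Mod N)" "\<psi> \<in> characters (G Mod N)" "?f \<eta> = ?f \<psi>"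
      show "\<eta> = \<psi>"
      proof (rule characters_eqI[OF *(1,2)])
        fix X assume "X \<in> carrier (G Mod N)"
        then obtain x where "x \<in> carrier G" "X = N #> x" unfolding carr by blast
        then show "\<eta> X = \<psi> X" using fun_cong[OF *(3), of x] by simp
      qed
    qed
    show "?f ` characters (G Mod N) = {\<eta> \<in> characters G. \<forall>s\<in>S. \<eta> s = 1}"
    proof (intro subset_antisym subsetI)
      fix \<psi> assume "\<psi> \<in> ?f ` characters (G Mod N)"
      then obtain \<eta> where e: "\<eta> \<in> characters (G Mod N)" "\<psi> = ?f \<eta>" by blast
      have h: "\<eta> \<in> hom (G Mod N) circle" using e(1) by (simp add: characters_eq_hom)
      have "(\<eta> \<circ> (\<lambda>x. N #> x)) \<in> hom G circle" by (rule Group.hom_compose[OF proj h])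
      then have "restrict (\<eta> \<circ> (\<lambda>x. N #> x)) (carrier G) \<in> characters G" by (rule restrict_hom_character[OF is_group])
      then have 1: "\<psi> \<in> characters G" unfolding e(2) by (simp add: o_def)
      have s1: "\<psi> s = 1" if s: "s \<in> S" for s
      proof -
        have sc: "s \<in> carrier G" using s S by auto
        have "N #> s = \<one>\<^bsub>G Mod N\<^esub>" unfolding one_FactGroup
          by (rule coset_join2[OF sc sN]) (simp add: N generate.incl s)
        then have "\<eta> (N #> s) = \<one>\<^bsub>circle\<^esub>"
          using hom_one[OF h Q.is_group] comm_group_circle by (simp add: comm_group_def)
        then show ?thesis using sc by (simp add: e(2) circle_def)
      qed
      then show "\<psi> \<in> {\<eta> \<in> characters G. \<forall>s\<in>S. \<eta> s = 1}" using 1 by simp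
    next
      fix \<psi> assume "\<psi> \<in> {\<eta> \<in> characters G. \<forall>s\<in>S. \<eta> s = 1}"
      then have p: "\<psi> \<in> characters G" "\<And>s. s \<in> S \<Longrightarrow> \<psi> s = 1" by auto
      have ph: "\<psi> \<in> hom G circle" using p(1) by (simp add: characters_eq_hom)
      interpret C: group_hom G circle \<psi>
        using comm_group_circle ph by (simp add: group_hom_def group_hom_axioms_def comm_group_def)
      have "S \<subseteq> kernel G circle \<psi>" using S p(2) by (auto simp: kernel_def circle_def)
      then have "N \<subseteq> kernel G circle \<psi>" unfolding N by (rule generate_subgroup_incl[OF _ C.subgroup_kernel])
      then obtain g where g: "g \<in> hom (G Mod N) circle" "\<And>x. x \<in> carrier G \<Longrightarrow> g (N #> x) = \<psi> x"
        using C.FactGroup_universal_kernel[OF nN] by blast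
      have r: "restrict g (carrier (G Mod N)) \<in> characters (G Mod N)" by (rule restrict_hom_character[OF Q.is_group g(1)])
      have e: "?f (restrict g (carrier (G Mod N))) = \<psi>"
      proof (rule extensionalityI[of _ "carrier G"])
        fix x assume x: "x \<in> carrier G"
        then have "N #> x \<in> carrier (G Mod N)" unfolding carr by (rule imageI)
        then show "?f (restrict g (carrier (G Mod N))) x = \<psi> x" using g(2)[OF x] x by simp
      qed (use charactersD(1)[OF p(1)] in auto)
      show "\<psi> \<in> ?f ` characters (G Mod N)" by (rule image_eqI[where f = ?f, OF e[symmetric] r])
    qed
  qed
qed

lemma free_character_diff:
  assumes "\<eta> \<in> characters (free_Abelian_group S)" "Poly_Mapping.keys x \<subseteq> S" "Poly_Mapping.keys y \<subseteq> S"
  shows "\<eta> (x - y) = \<eta> x / \<eta> y"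
proof -
  have k: "Poly_Mapping.keys (x - y) \<subseteq> S" 
    by (rule order_trans[OF keys_diff]) (use assms in auto)
  have "\<eta> ((x - y) + y) = \<eta> (x - y) * \<eta> y" using charactersD(2)[OF assms(1), of "x - y" y] k assms by simp
  moreover have "\<eta> y \<noteq> 0" using charactersD(4)[OF assms(1), of y] assms by simp
  ultimately show ?thesis by (simp add: field_simps)
qed

lemma free_characters:
  "bij_betw (\<lambda>\<eta>. \<lambda>x\<in>S. \<eta> (frag_of x)) (characters (free_Abelian_group S)) (PiE S (\<lambda>_. carrier circle))"
proof (rule bij_betw_imageI)
  let ?F = "free_Abelian_group S" let ?f = "\<lambda>\<eta>. \<lambda>x\<in>S. \<eta> (frag_of x)"
  interpret C: comm_group circle by (rule comm_group_circle)
  interpret F: comm_group ?F by (rule abelian_free_Abelian_group)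
  show "inj_on ?f (characters ?F)"
  proof (rule inj_onI)
    fix \<eta> \<psi> assume *: "\<eta> \<in> characters ?F" "\<psi> \<in> characters ?F" "?f \<eta> = ?f \<psi>"
    show "\<eta> = \<psi>"
    proof (rule characters_eqI[OF *(1,2)])
      fix x assume "x \<in> carrier ?F"
      then have "Poly_Mapping.keys x \<subseteq> S" by simp
      then show "\<eta> x = \<psi> x"
      proof (induction x rule: free_Abelian_group_induct[consumes 1, case_names zero diff gen])
        case zero then show ?case using F.character_one[OF *(1)] F.character_one[OF *(2)] by simp
      next
        case (diff x y) then show ?case using free_character_diff[OF *(1)] free_character_diff[OF *(2)] by simp
      next
        case (gen a) then show ?case using fun_cong[OF *(3), of a] by simp
      qed
    qed
  qed
  show "?f ` characters ?F = PiE S (\<lambda>_. carrier circle)"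
  proof (intro subset_antisym subsetI)
    fix h assume "h \<in> ?f ` characters ?F"
    then obtain \<eta> where "\<eta> \<in> characters ?F" "h = ?f \<eta>" by blast
    then show "h \<in> PiE S (\<lambda>_. carrier circle)" using charactersD(3)[of \<eta> ?F] by (auto simp: circle_def)
  next
    fix h assume h: "h \<in> PiE S (\<lambda>_. carrier circle)"
    then have hS: "h ` S \<subseteq> carrier circle" by auto
    obtain g where g: "g \<in> hom ?F circle" "\<And>x. x \<in> S \<Longrightarrow> g (frag_of x) = h x"
      by (rule C.free_Abelian_group_universal[OF hS]) (rule that; assumption)
    have r: "restrict g (carrier ?F) \<in> characters ?F" by (rule restrict_hom_character[OF F.is_group g(1)])
    have e: "?f (restrict g (carrier ?F)) = h"
      by (rule extensionalityI[of _ S]) (use g(2) h in \<open>auto simp: PiE_def\<close>)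
    show "h \<in> ?f ` characters ?F" by (rule image_eqI[where f = ?f, OF e[symmetric] r])
  qed
qed

text \<open>Needed for the tensor square, whose finiteness is not visible from its presentation.\<close>

lemma (in comm_group) finite_generate_torsion:
  assumes "finite S" "S \<subseteq> carrier G" "e > 0" "\<And>s. s \<in> S \<Longrightarrow> s [^] (e::nat) = \<one>"
  shows "finite (generate G S)"
  using assms(1,2,4)
proof (induction S rule: finite_induct)
  case empty
  then show ?case by (simp add: generate_empty)
next
  case (insert s S)
  let ?K = "generate G S" let ?H = "(\<lambda>(k, i). k \<otimes> s [^] i) ` (?K \<times> (UNIV :: nat set))"
  have fK: "finite ?K" using insert by auto
  have s: "s \<in> carrier G" "s [^] e = \<one>" and S: "S \<subseteq> carrier G" using insert by auto
  have sK: "subgroup ?K G" by (rule generate_is_subgroup[OF S])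
  have Kc: "k \<in> carrier G" if "k \<in> ?K" for k using subgroup.subset[OF sK] that by blast
  have "?H \<subseteq> (\<lambda>(k, i). k \<otimes> s [^] i) ` (?K \<times> {..<e})"
  proof
    fix x assume "x \<in> ?H"
    then obtain k i where x: "k \<in> ?K" "x = k \<otimes> s [^] (i::nat)" by auto
    have "s [^] i = s [^] (e * (i div e) + i mod e)" by simp
    also have "\<dots> = (s [^] e) [^] (i div e) \<otimes> s [^] (i mod e)" by (simp only: nat_pow_pow[OF s(1)] nat_pow_mult[OF s(1)])
    also have "\<dots> = s [^] (i mod e)" unfolding s(2) using s(1) by simp
    finally have "s [^] i = s [^] (i mod e)" .
    then have "x = (\<lambda>(k, i). k \<otimes> s [^] i) (k, i mod e)" using x by simp
    moreover have "(k, i mod e) \<in> ?K \<times> {..<e}" using x assms(3) by simp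
    ultimately show "x \<in> (\<lambda>(k, i). k \<otimes> s [^] i) ` (?K \<times> {..<e})" by (rule image_eqI)
  qed
  then have fH: "finite ?H" by (rule finite_subset) (use fK in simp)
  have HI: "k \<otimes> s [^] (i::nat) \<in> ?H" if "k \<in> ?K" for k i by (rule image_eqI[of _ _ "(k, i)"]) (use that in auto)
  have sub: "subgroup ?H G"
  proof (rule subgroupI)
    show "?H \<subseteq> carrier G" using Kc s by auto
    show "?H \<noteq> {}" using HI[OF subgroup.one_closed[OF sK]] by blast
  next
    fix x assume "x \<in> ?H"
    then obtain k i where x: "k \<in> ?K" "x = k \<otimes> s [^] (i::nat)" by auto
    have "(e - 1) * i + i = e * i" using assms(3) by (cases e) simp_all
    then have "s [^] ((e - 1) * i) \<otimes> s [^] i = (s [^] e) [^] i"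
      by (simp only: nat_pow_mult[OF s(1)] nat_pow_pow[OF s(1)])
    also have "\<dots> = \<one>" unfolding s(2) by simp
    finally have "inv (s [^] i) = s [^] ((e - 1) * i)" using s by (intro inv_equality) auto
    then have "inv x = inv k \<otimes> s [^] ((e - 1) * i)" unfolding x(2) using Kc[OF x(1)] s by (simp add: inv_mult)
    then show "inv x \<in> ?H" using HI[OF subgroup.m_inv_closed[OF sK x(1)]] by simp
  next
    fix x y assume "x \<in> ?H" "y \<in> ?H"
    then obtain k i k' j where x: "k \<in> ?K" "x = k \<otimes> s [^] (i::nat)" "k' \<in> ?K" "y = k' \<otimes> s [^] (j::nat)" by auto
    have "x \<otimes> y = (k \<otimes> k') \<otimes> s [^] (i + j)"
      unfolding x(2,4) using Kc[OF x(1)] Kc[OF x(3)] s by (simp add: nat_pow_mult[symmetric] m_ac)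
    then show "x \<otimes> y \<in> ?H" using HI[OF subgroup.m_closed[OF sK x(1,3)]] by simp
  qed
  have "insert s S \<subseteq> ?H"
  proof
    fix x assume "x \<in> insert s S"
    then consider "x = s" | "x \<in> S" by blast
    then show "x \<in> ?H"
    proof cases
      case 1 then show ?thesis using HI[OF subgroup.one_closed[OF sK], of 1] s by simp
    next
      case 2
      then have e: "x \<otimes> s [^] (0::nat) = x" using S by auto
      show ?thesis using HI[OF generate.incl[OF 2], of 0] unfolding e .
    qed
  qed
  then have "generate G (insert s S) \<subseteq> ?H" by (rule generate_subgroup_incl[OF _ sub])
  then show ?case using fH by (rule finite_subset)
qed

context comm_group begin

abbreviation "FA \<equiv> free_Abelian_group (V \<times> V)"
abbreviation "RT \<equiv> generate FA (tensor_relations G)"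

lemma tensor_relations_subset: "tensor_relations G \<subseteq> carrier FA"
proof -
  have "Poly_Mapping.keys (frag_of a - frag_of b - frag_of c) \<subseteq> V \<times> V"
    if "a \<in> V \<times> V" "b \<in> V \<times> V" "c \<in> V \<times> V" for a b c
    using that keys_diff[of "frag_of a - frag_of b" "frag_of c"] keys_diff[of "frag_of a" "frag_of b"] by fastforce
  then show ?thesis unfolding tensor_relations_def by auto
qed

lemma subgroup_RT: "subgroup RT FA"
  using group.generate_is_subgroup[OF group_free_Abelian_group tensor_relations_subset] .

lemma comm_group_tensor: "comm_group (tensor_square G)"
  unfolding tensor_square_def Let_def
  by (rule comm_group.abelian_FactGroup[OF abelian_free_Abelian_group subgroup_RT])

lemma pure_tensor_eq: "pure_tensor G x y = RT #>\<^bsub>FA\<^esub> frag_of (x, y)"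
  by (simp add: pure_tensor_def Let_def)

lemma pure_tensor_mult:
  assumes "x \<in> V" "x' \<in> V" "y \<in> V"
  shows "pure_tensor G (x \<otimes> x') y = pure_tensor G x y \<otimes>\<^bsub>tensor_square G\<^esub> pure_tensor G x' y"
proof -
  interpret F: comm_group FA by (rule abelian_free_Abelian_group)
  interpret N: normal RT FA using F.normal_iff_subgroup subgroup_RT by blast
  let ?a = "frag_of (x \<otimes> x', y)" and ?b = "frag_of (x, y) + frag_of (x', y)"
  have b: "?b \<in> carrier FA" using assms F.m_closed[of "frag_of (x, y)" "frag_of (x', y)"] by simp
  have "?a - frag_of (x, y) - frag_of (x', y) \<in> RT"
    using assms by (intro generate.incl) (auto simp: tensor_relations_def)
  moreover have "?a = (?a - frag_of (x, y) - frag_of (x', y)) + ?b" by simp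
  ultimately have "?a \<in> RT #>\<^bsub>FA\<^esub> ?b" unfolding r_coset_def by (metis (no_types, lifting) UN_iff mult_free_Abelian_group singletonI)
  then have "RT #>\<^bsub>FA\<^esub> ?b = RT #>\<^bsub>FA\<^esub> ?a" by (rule F.repr_independence[OF _ b subgroup_RT])
  moreover have "(RT #>\<^bsub>FA\<^esub> frag_of (x, y)) <#>\<^bsub>FA\<^esub> (RT #>\<^bsub>FA\<^esub> frag_of (x', y)) = RT #>\<^bsub>FA\<^esub> ?b"
    using N.rcos_sum[of "frag_of (x, y)" "frag_of (x', y)"] assms by simp
  ultimately show ?thesis by (simp add: pure_tensor_eq tensor_square_def Let_def)
qed

lemma finite_tensor:
  assumes fin: "finite V"
  shows "finite (carrier (tensor_square G))"
proof -
  interpret F: comm_group FA by (rule abelian_free_Abelian_group)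
  interpret N: normal RT FA using F.normal_iff_subgroup subgroup_RT by blast
  interpret T: comm_group "tensor_square G" by (rule comm_group_tensor)
  have Teq: "tensor_square G = FA Mod RT" by (simp add: tensor_square_def Let_def)
  let ?S = "(\<lambda>p. RT #>\<^bsub>FA\<^esub> frag_of p) ` (V \<times> V)"
  have proj: "(\<lambda>x. RT #>\<^bsub>FA\<^esub> x) \<in> hom FA (tensor_square G)" unfolding Teq by (rule N.r_coset_hom_Mod)
  have Sc: "?S \<subseteq> carrier (tensor_square G)" using proj by (auto simp: hom_def)
  have gen: "RT #>\<^bsub>FA\<^esub> x \<in> generate (tensor_square G) ?S" if "Poly_Mapping.keys x \<subseteq> V \<times> V" for x
    using that
  proof (induction x rule: free_Abelian_group_induct[consumes 1, case_names zero diff gen])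
    case zero
    have "RT #>\<^bsub>FA\<^esub> 0 = \<one>\<^bsub>tensor_square G\<^esub>"
      using F.coset_mult_one[of RT] N.subset by (simp add: Teq)
    then show ?case by (simp add: generate.one)
  next
    case (diff x y)
    interpret h: group_hom FA "tensor_square G" "\<lambda>x. RT #>\<^bsub>FA\<^esub> x"
      by unfold_locales (rule proj)
    have "x - y = x \<otimes>\<^bsub>FA\<^esub> inv\<^bsub>FA\<^esub> y" using diff by simp
    then have "RT #>\<^bsub>FA\<^esub> (x - y) = (RT #>\<^bsub>FA\<^esub> x) \<otimes>\<^bsub>tensor_square G\<^esub> inv\<^bsub>tensor_square G\<^esub> (RT #>\<^bsub>FA\<^esub> y)"
      using diff h.hom_mult[of x "inv\<^bsub>FA\<^esub> y"] h.hom_inv[of y] F.inv_closed[of y] by simp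
    then show ?case
      using subgroup.m_closed[OF T.generate_is_subgroup[OF Sc] diff(3) subgroup.m_inv_closed[OF T.generate_is_subgroup[OF Sc] diff(4)]] by simp
  next
    case (gen a) then show ?case by (intro generate.incl imageI)
  qed
  have "carrier (tensor_square G) \<subseteq> generate (tensor_square G) ?S"
    using gen by (auto simp: Teq carrier_FactGroup)
  moreover have "finite (generate (tensor_square G) ?S)"
  proof (rule T.finite_generate_torsion[OF _ Sc])
    show "finite ?S" using fin by simp
    show "0 < order G" using fin order_gt_0_iff_finite by blast
    fix s assume "s \<in> ?S"
    then obtain x y where xy: "x \<in> V" "y \<in> V" "s = pure_tensor G x y" by (auto simp: pure_tensor_eq)
    have "(\<lambda>x. pure_tensor G x y) \<in> hom G (tensor_square G)"
      using Sc xy(2) pure_tensor_mult by (auto simp: hom_def pure_tensor_eq)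
    then interpret h: group_hom G "tensor_square G" "\<lambda>x. pure_tensor G x y" by unfold_locales
    show "s [^]\<^bsub>tensor_square G\<^esub> order G = \<one>\<^bsub>tensor_square G\<^esub>"
      unfolding xy(3) using h.hom_nat_pow[OF xy(1), of "order G"] pow_order_eq_1[OF xy(1)] h.hom_one by simp
  qed
  ultimately show ?thesis by (rule finite_subset)
qed

text \<open>A finite abelian group has as many elements as characters. Since the exterior square is an iterated
quotient of a free abelian group, its characters are the bicharacters of the original group that are
trivial on the diagonal, and these are antisymmetric.\<close>

lemma card_exterior_square:
  assumes fin: "finite V"
  shows "order (exterior_square G) = card {f \<in> antisymmetric_forms. \<forall>x\<in>V. f x x = 1}"
proof -
  interpret F: comm_group FA by (rule abelian_free_Abelian_group)
  interpret T: comm_group "tensor_square G" by (rule comm_group_tensor)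
  have Teq: "tensor_square G = FA Mod RT" by (simp add: tensor_square_def Let_def)
  let ?D = "{pure_tensor G v v | v. v \<in> V}" let ?N = "generate (tensor_square G) {pure_tensor G v v | v. v \<in> V}"
  have Dc: "?D \<subseteq> carrier (tensor_square G)"
    by (auto simp: pure_tensor_eq Teq carrier_FactGroup)
  have sN: "subgroup ?N (tensor_square G)" by (rule T.generate_is_subgroup[OF Dc])
  have Eeq: "exterior_square G = tensor_square G Mod ?N" by (simp add: exterior_square_def)
  interpret E: comm_group "exterior_square G" unfolding Eeq by (rule T.abelian_FactGroup[OF sN])
  have fE: "finite (carrier (exterior_square G))"
    unfolding Eeq carrier_FactGroup using finite_tensor[OF fin] by simp
  let ?P2 = "\<lambda>\<eta>. \<forall>v\<in>V. \<eta> (frag_of (v, v)) = 1"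
  (* Bicharacters with trivial diagonal, as functions on pairs. *)
  let ?bi = "\<lambda>\<phi>. (\<forall>x\<in>V. \<forall>y\<in>V. \<forall>z\<in>V. \<phi> (x \<otimes> y, z) = \<phi> (x, z) * \<phi> (y, z)) \<and>
     (\<forall>x\<in>V. \<forall>y\<in>V. \<forall>z\<in>V. \<phi> (x, y \<otimes> z) = \<phi> (x, y) * \<phi> (x, z)) \<and> (\<forall>v\<in>V. \<phi> (v, v) = (1::complex))"
  have "card (characters (exterior_square G)) = card {\<eta> \<in> characters (tensor_square G). \<forall>s\<in>?D. \<eta> s = 1}"
    unfolding Eeq by (rule bij_betw_same_card[OF T.quotient_characters[OF Dc refl]])
  also have "\<dots> = card {\<eta> \<in> {\<eta> \<in> characters FA. \<forall>s\<in>tensor_relations G. \<eta> s = 1}. ?P2 \<eta>}"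
    unfolding Teq
    by (rule bij_betw_same_card[OF bij_betw_Collect[OF F.quotient_characters[OF tensor_relations_subset refl]]])
      (auto simp: pure_tensor_eq)
  also have "{\<eta> \<in> {\<eta> \<in> characters FA. \<forall>s\<in>tensor_relations G. \<eta> s = 1}. ?P2 \<eta>} =
     {\<eta> \<in> characters FA. (\<forall>s\<in>tensor_relations G. \<eta> s = 1) \<and> ?P2 \<eta>}" by auto
  also have "card \<dots> = card {\<phi> \<in> PiE (V \<times> V) (\<lambda>_. carrier circle). ?bi \<phi>}"
  proof (rule bij_betw_same_card[OF bij_betw_Collect[OF free_characters]])
    fix \<eta> assume e: "\<eta> \<in> characters FA"
    have d: "\<eta> (frag_of a - frag_of b - frag_of c) = 1 \<longleftrightarrow> \<eta> (frag_of a) = \<eta> (frag_of b) * \<eta> (frag_of c)"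
      if "a \<in> V \<times> V" "b \<in> V \<times> V" "c \<in> V \<times> V" for a b c
    proof -
      have k: "Poly_Mapping.keys (frag_of a - frag_of b) \<subseteq> V \<times> V" using that keys_diff[of "frag_of a" "frag_of b"] by fastforce
      have n: "\<eta> (frag_of b) \<noteq> 0" "\<eta> (frag_of c) \<noteq> 0" using charactersD(4)[OF e] that by auto
      have k2: "Poly_Mapping.keys (frag_of a) \<subseteq> V \<times> V" "Poly_Mapping.keys (frag_of b) \<subseteq> V \<times> V" "Poly_Mapping.keys (frag_of c) \<subseteq> V \<times> V"
        using that by simp_all
      have r: "u / v / w = 1 \<longleftrightarrow> u = v * w" if "v \<noteq> 0" "w \<noteq> 0" for u v w :: complex using that by (simp add: field_simps)
      show ?thesis
        unfolding free_character_diff[OF e k k2(3)] free_character_diff[OF e k2(1,2)] by (rule r[OF n])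
    qed
    have "(\<forall>s\<in>tensor_relations G. \<eta> s = 1) \<longleftrightarrow>
      (\<forall>x\<in>V. \<forall>y\<in>V. \<forall>z\<in>V. \<eta> (frag_of (x \<otimes> y, z) - frag_of (x, z) - frag_of (y, z)) = 1) \<and>
      (\<forall>x\<in>V. \<forall>y\<in>V. \<forall>z\<in>V. \<eta> (frag_of (x, y \<otimes> z) - frag_of (x, y) - frag_of (x, z)) = 1)"
      unfolding tensor_relations_def by blast
    also have "\<dots> \<longleftrightarrow>
      (\<forall>x\<in>V. \<forall>y\<in>V. \<forall>z\<in>V. \<eta> (frag_of (x \<otimes> y, z)) = \<eta> (frag_of (x, z)) * \<eta> (frag_of (y, z))) \<and>
      (\<forall>x\<in>V. \<forall>y\<in>V. \<forall>z\<in>V. \<eta> (frag_of (x, y \<otimes> z)) = \<eta> (frag_of (x, y)) * \<eta> (frag_of (x, z)))"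
      by (intro arg_cong2[of _ _ _ _ "(\<and>)"] ball_cong refl d) auto
    finally show "(\<forall>s\<in>tensor_relations G. \<eta> s = 1) \<and> ?P2 \<eta> \<longleftrightarrow> ?bi (\<lambda>x\<in>V \<times> V. \<eta> (frag_of x))"
      by simp
  qed
  also have "\<dots> = card {f \<in> antisymmetric_forms. \<forall>x\<in>V. f x x = 1}"
  proof (rule bij_betw_same_card[OF bij_betwI[of "\<lambda>\<phi>. \<lambda>x\<in>V. \<lambda>y\<in>V. \<phi> (x, y)" _ _ "\<lambda>f. \<lambda>p\<in>V \<times> V. f (fst p) (snd p)"]], goal_cases)
    case 1
    have "(\<lambda>x\<in>V. \<lambda>y\<in>V. \<phi> (x, y)) \<in> {f \<in> antisymmetric_forms. \<forall>x\<in>V. f x x = 1}"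
      if p: "\<phi> \<in> PiE (V \<times> V) (\<lambda>_. carrier circle)" and bi: "?bi \<phi>" for \<phi>
    proof -
      (* Expand \<open>\<phi> (x \<otimes> y, x \<otimes> y) = 1\<close>. *)
      have anti: "\<phi> (x, y) * \<phi> (y, x) = 1" if xy: "x \<in> V" "y \<in> V" for x y
      proof -
        have "1 = \<phi> (x \<otimes> y, x \<otimes> y)" using bi xy by simp
        also have "\<dots> = \<phi> (x, x \<otimes> y) * \<phi> (y, x \<otimes> y)" using bi xy m_closed by blast
        also have "\<dots> = (\<phi> (x, x) * \<phi> (x, y)) * (\<phi> (y, x) * \<phi> (y, y))" using bi xy by metis
        finally show ?thesis using bi xy by simp
      qed
      have "norm (\<phi> (x, y)) = 1" if "x \<in> V" "y \<in> V" for x y using p that by (auto simp: circle_def)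
      then show ?thesis using bi anti unfolding antisymmetric_forms_def characters_def by auto
    qed
    note k = this
    show ?case by (rule funcsetI, elim CollectE conjE, rule k) (assumption | intro conjI)+
  next
    case 2
    have "(\<lambda>p\<in>V \<times> V. f (fst p) (snd p)) \<in> {\<phi> \<in> PiE (V \<times> V) (\<lambda>_. carrier circle). ?bi \<phi>}"
      if f: "f \<in> antisymmetric_forms" and d: "\<forall>x\<in>V. f x x = 1" for f
      using antisymmetric_formsD(3)[OF f] charactersD(2,3)[OF antisymmetric_formsD(1)[OF f]] d by (auto simp: circle_def)
    note k = this
    show ?case by (rule funcsetI, elim CollectE conjE, rule k) assumption+
  next
    case (3 \<phi>) then show ?case by (auto simp: fun_eq_iff PiE_def extensional_def)
  next
    case (4 f)
    then have f: "f \<in> antisymmetric_forms" by simp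
    show ?case
      using antisymmetric_formsD(2)[OF f] charactersD(1)[OF antisymmetric_formsD(1)[OF f]] by (auto simp: fun_eq_iff extensional_def)
  qed
  finally show ?thesis using E.card_characters[OF fE] by (simp add: order_def)
qed

end

section \<open>Antisymmetric forms and sign characters\<close>

definition signs :: "('a, 'm) monoid_scheme \<Rightarrow> ('a \<Rightarrow> complex) set" where
  "signs G = {s \<in> characters G. \<forall>x\<in>carrier G. (s x)\<^sup>2 = 1}"

lemma signsD:
  assumes "s \<in> signs G"
  shows "s \<in> characters G" "x \<in> carrier G \<Longrightarrow> s x = 1 \<or> s x = - 1"
  using assms by (auto simp: signs_def power2_eq_1_iff)

text \<open>The symmetric bicharacter \<open>s \<otimes> s\<close> when \<open>{1, - 1}\<close> is identified with the field of two elements.\<close>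

definition sign_form :: "('a \<Rightarrow> complex) \<Rightarrow> 'a \<Rightarrow> 'a \<Rightarrow> complex" where
  "sign_form s x y = (if s x = - 1 \<and> s y = - 1 then - 1 else 1)"

lemma sign_form_sq: "sign_form s x y * sign_form s x y = 1" "sign_form s x y * (sign_form s x y * z) = z"
  by (simp_all add: sign_form_def)

lemma sign_form_sym: "sign_form s x y = sign_form s y x"
  by (simp add: sign_form_def conj_commute)

lemma sign_form_mult:
  assumes "u \<in> {1, - 1}" "v \<in> {1, - 1 :: complex}" "s a = u" "s b = v" "s c = u * v" "s z \<in> {1, - 1}"
  shows "sign_form s c z = sign_form s a z * sign_form s b z"
  using assms by (auto simp: sign_form_def)

context comm_group begin

lemma sign_form_left:
  assumes s: "s \<in> signs G" and "x \<in> V" "y \<in> V" "z \<in> V"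
  shows "sign_form s (x \<otimes> y) z = sign_form s x z * sign_form s y z"
  using charactersD(2)[OF signsD(1)[OF s], of x y] signsD(2)[OF s] assms(2-)
  by (intro sign_form_mult[of "s x" "s y"]) auto

lemma sign_form_right:
  assumes s: "s \<in> signs G" and "x \<in> V" "y \<in> V" "z \<in> V"
  shows "sign_form s z (x \<otimes> y) = sign_form s z x * sign_form s z y"
  using sign_form_left[OF assms] by (simp add: sign_form_sym)

lemma sign_form_antisymmetric_forms:
  assumes s: "s \<in> signs G" and f: "f \<in> antisymmetric_forms"
  shows "(\<lambda>x\<in>V. \<lambda>y\<in>V. sign_form s x y * f x y) \<in> antisymmetric_forms"
proof -
  have n: "norm (sign_form s x y) = 1" for x y by (simp add: sign_form_def)
  have c: "(\<lambda>y\<in>V. sign_form s x y * f x y) \<in> characters G" if x: "x \<in> V" for x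
    using charactersD(2,3)[OF antisymmetric_formsD(1)[OF f x]] sign_form_right[OF s _ _ x]
    by (auto simp: characters_def norm_mult n)
  have "sign_form s x y * f x y * (sign_form s y x * f y x) = 1" if "x \<in> V" "y \<in> V" for x y
  proof -
    have "sign_form s x y * f x y * (sign_form s y x * f y x) = (sign_form s x y * sign_form s x y) * (f x y * f y x)"
      by (simp add: sign_form_sym[of s y x] mult_ac)
    then show ?thesis using antisymmetric_formsD(4)[OF f that] by (simp add: sign_form_sq)
  qed
  then show ?thesis unfolding antisymmetric_forms_def using c antisymmetric_formsD(3)[OF f] sign_form_left[OF s] by auto
qed

lemma diagonal_sign:
  assumes f: "f \<in> antisymmetric_forms" shows "(\<lambda>x\<in>V. f x x) \<in> signs G"
proof -
  have "(\<lambda>x\<in>V. cnj ((\<lambda>x\<in>V. cnj (f x x) ^ 1) x)) \<in> characters G"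
    by (rule cnj_character[OF diagonal_character[OF f]])
  then have "(\<lambda>x\<in>V. f x x) \<in> characters G" by (simp cong: restrict_cong)
  then show ?thesis using antisymmetric_formsD(4)[OF f] by (auto simp: signs_def power2_eq_square)
qed

text \<open>The diagonal of an antisymmetric form is a sign character \<open>s\<close>, and \<open>sign_form s\<close> is an antisymmetric
form with the same diagonal. So the forms with a given diagonal are as many as those with trivial
diagonal.\<close>

lemma card_antisymmetric_forms:
  "card antisymmetric_forms = card (signs G) * card {f \<in> antisymmetric_forms. \<forall>x\<in>V. f x x = 1}"
proof -
  let ?F = "{f \<in> antisymmetric_forms. \<forall>x\<in>V. f x x = 1}"
  let ?t = "\<lambda>s f. \<lambda>x\<in>V. \<lambda>y\<in>V. sign_form s x y * f x y"
  have diag: "sign_form s x x = s x" if "s \<in> signs G" "x \<in> V" for s x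
    using signsD(2)[OF that] by (auto simp: sign_form_def)
  have cong: "?t (\<lambda>x\<in>V. s x) f = ?t s f" for s f by (auto simp: sign_form_def fun_eq_iff)
  have invol: "?t s (?t s f) = f" if "f \<in> antisymmetric_forms" for s f
    using antisymmetric_formsD(2)[OF that] charactersD(1)[OF antisymmetric_formsD(1)[OF that]]
    by (auto simp: fun_eq_iff sign_form_sq extensional_def)
  (* Twist by the form of the sign character on the diagonal to make the diagonal trivial. *)
  have "bij_betw (\<lambda>(s, f). ?t s f) (signs G \<times> ?F) antisymmetric_forms"
  proof (rule bij_betwI[of _ _ _ "\<lambda>g. (\<lambda>x\<in>V. g x x, ?t (\<lambda>x\<in>V. g x x) g)"], goal_cases)
    case 1
    have k: "?t s f \<in> antisymmetric_forms" if "s \<in> signs G" "f \<in> ?F" for s f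
      using sign_form_antisymmetric_forms[OF that(1)] that(2) by simp
    show ?case
    proof (rule funcsetI)
      fix p assume p: "p \<in> signs G \<times> ?F"
      show "(case p of (s, f) \<Rightarrow> ?t s f) \<in> antisymmetric_forms"
        unfolding case_prod_beta by (rule k) (use p in auto)
    qed
  next
    case 2
    have k: "(?t (\<lambda>x\<in>V. g x x) g) x x = 1" if g: "g \<in> antisymmetric_forms" and x: "x \<in> V" for g x
      using diag[OF diagonal_sign[OF g] x] antisymmetric_formsD(4)[OF g x x] x by simp
    show ?case
    proof (rule funcsetI)
      fix g assume g: "g \<in> antisymmetric_forms"
      show "(\<lambda>x\<in>V. g x x, ?t (\<lambda>x\<in>V. g x x) g) \<in> signs G \<times> ?F"
        by (intro SigmaI CollectI conjI ballI diagonal_sign[OF g] sign_form_antisymmetric_forms[OF diagonal_sign[OF g] g] k[OF g])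
    qed
  next
    case (3 p)
    obtain s f where p: "p = (s, f)" by (cases p)
    then have s: "s \<in> signs G" and f: "f \<in> antisymmetric_forms" "\<And>x. x \<in> V \<Longrightarrow> f x x = 1" using 3 by auto
    have "(\<lambda>x\<in>V. (?t s f) x x) = s"
      by (rule extensionalityI[of _ V]) (use charactersD(1)[OF signsD(1)[OF s]] f(2) diag[OF s] in auto)
    then show ?case unfolding p case_prod_conv using invol[OF f(1)] by simp
  next
    case (4 g)
    then show ?case unfolding case_prod_conv by (rule invol)
  qed
  then have "card (signs G \<times> ?F) = card antisymmetric_forms" by (rule bij_betw_same_card)
  then show ?thesis by (simp add: card_cartesian_product)
qed

lemma characters_agree:
  assumes \<eta>: "\<eta> \<in> characters G" "\<psi> \<in> characters G" and S: "S \<subseteq> V" "generate G S = V"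
    and eq: "\<And>x. x \<in> S \<Longrightarrow> \<eta> x = \<psi> x"
  shows "\<eta> = \<psi>"
proof -
  let ?H = "{x \<in> V. \<eta> x = \<psi> x}"
  have "subgroup ?H G"
  proof (rule subgroupI)
    have "\<one> \<in> ?H" by (simp add: character_one[OF \<eta>(1)] character_one[OF \<eta>(2)])
    then show "?H \<noteq> {}" by blast
  qed (auto simp: character_inv(1)[OF \<eta>(1)] character_inv(1)[OF \<eta>(2)] charactersD(2)[OF \<eta>(1)] charactersD(2)[OF \<eta>(2)])
  then have "generate G S \<subseteq> ?H" using S eq by (intro generate_subgroup_incl) auto
  then show ?thesis using S by (intro characters_eqI[OF \<eta>]) auto
qed

lemma power_character: "\<eta> \<in> characters G \<Longrightarrow> (\<lambda>x\<in>V. \<eta> x ^ n) \<in> characters G"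
  by (auto simp: characters_def power_mult_distrib norm_power)

lemma prod_signs:
  assumes "\<And>i. i \<in> I \<Longrightarrow> \<sigma> i \<in> signs G"
  shows "(\<lambda>x\<in>V. \<Prod>i\<in>I. \<sigma> i x) \<in> signs G"
proof -
  have "(\<Prod>i\<in>I. \<sigma> i (x \<otimes> y)) = (\<Prod>i\<in>I. \<sigma> i x) * (\<Prod>i\<in>I. \<sigma> i y)" if "x \<in> V" "y \<in> V" for x y
    unfolding prod.distrib[symmetric] by (intro prod.cong refl charactersD(2)[OF signsD(1)[OF assms]] that)
  moreover have "norm (\<Prod>i\<in>I. \<sigma> i x) = 1" if "x \<in> V" for x
    unfolding prod_norm[symmetric] using charactersD(3)[OF signsD(1)[OF assms] that] by (intro prod.neutral) auto
  moreover have "(\<Prod>i\<in>I. \<sigma> i x)\<^sup>2 = 1" if "x \<in> V" for x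
    unfolding prod_power_distrib using assms that by (intro prod.neutral) (auto simp: signs_def)
  ultimately show ?thesis by (auto simp: signs_def characters_def)
qed

text \<open>In a minimal generating set no element lies in the subgroup generated by the others, so some character
is trivial on the others but not on it, and a power of this character takes the value -1 there. Hence a
sign character can be prescribed freely on the generators.\<close>

lemma card_signs_2group:
  assumes fin: "finite V" and ord: "order G = 2 ^ a"
  shows "card (signs G) = 2 ^ min_generators G"
proof -
  let ?P = "\<lambda>r. \<exists>S. S \<subseteq> V \<and> finite S \<and> card S = r \<and> generate G S = V"
  have genV: "generate G V = V"
    using generate_incl[of V] generate.incl[of _ V] by blast
  have ex: "?P (card V)" using fin genV by blast
  have "?P (min_generators G)" unfolding min_generators_def by (rule LeastI[of ?P, OF ex])
  then obtain S where S: "S \<subseteq> V" "finite S" "card S = min_generators G" "generate G S = V" by blast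
  have least: "card S \<le> card S'" if "S' \<subseteq> V" "finite S'" "generate G S' = V" for S'
    unfolding S(3) min_generators_def by (rule Least_le) (use that in blast)
  have "\<exists>s\<in>signs G. s x = - 1 \<and> (\<forall>y\<in>S - {x}. s y = 1)" if x: "x \<in> S" for x
  proof -
    let ?H = "generate G (S - {x})"
    have SxV: "S - {x} \<subseteq> V" using S by auto
    have H: "subgroup ?H G" by (rule generate_is_subgroup[OF SxV])
    have xV: "x \<in> V" using x S(1) by blast
    have nx: "x \<notin> ?H"
    proof
      assume "x \<in> ?H"
      then have "S \<subseteq> ?H" using generate.incl[of _ "S - {x}" G] by blast
      then have "V \<subseteq> ?H" using generate_subgroup_incl[OF _ H] S(4) by blast
      then have "?H = V" using subgroup.subset[OF H] by blast
      then have le: "card S \<le> card (S - {x})" using SxV S(2) by (intro least) auto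
      have pos: "card S > 0" unfolding card_gt_0_iff using x S(2) by blast
      from le pos show False unfolding card_Diff_singleton[OF x] by linarith
    qed
    obtain \<eta> where \<eta>: "\<eta> \<in> characters G" "\<And>y. y \<in> ?H \<Longrightarrow> \<eta> y = 1" "\<eta> x \<noteq> 1"
      by (rule separating_character[OF fin H xV nx]) (rule that; assumption)
    have "\<eta> x ^ (2 ^ a) = 1"
      using character_pow[OF \<eta>(1), of x "order G"] pow_order_eq_1[of x] character_one[OF \<eta>(1)] x S(1) ord by auto
    then have ex: "\<exists>j. \<eta> x ^ (2 ^ j) = 1" by blast
    (* The values of \<open>\<eta>\<close> are roots of unity of order a power of 2; the last power of \<open>\<eta>\<close> that does not
       yet send \<open>x\<close> to 1 sends it to -1. *)
    define j where "j = (LEAST j. \<eta> x ^ (2 ^ j) = 1)"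
    have j: "\<eta> x ^ (2 ^ j) = 1" unfolding j_def by (rule LeastI_ex[OF ex])
    have "j \<noteq> 0" using j \<eta>(3) by (cases "j = 0") auto
    then obtain i where i: "j = Suc i" by (cases j) auto
    have ni: "\<eta> x ^ (2 ^ i) \<noteq> 1"
      using not_less_Least[of i "\<lambda>j. \<eta> x ^ (2 ^ j) = 1"] i unfolding j_def by simp
    have "(\<eta> x ^ (2 ^ i))\<^sup>2 = 1" using j unfolding i by (simp add: power_mult[symmetric] mult.commute)
    then have m1: "\<eta> x ^ (2 ^ i) = - 1" using ni by (simp add: power2_eq_1_iff)
    define s where "s = (\<lambda>y\<in>V. \<eta> y ^ (2 ^ i))"
    have sc: "s \<in> characters G" unfolding s_def by (rule power_character[OF \<eta>(1)])
    have sx: "s x = - 1" using x S(1) m1 by (auto simp: s_def)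
    have sy: "s y = 1" if "y \<in> S - {x}" for y
      using \<eta>(2)[OF generate.incl[OF that]] that S(1) by (auto simp: s_def)
    have "(\<lambda>y\<in>V. s y ^ 2) = (\<lambda>y\<in>V. 1)"
    proof (rule characters_agree[OF power_character[OF sc] trivial_character S(1) S(4)])
      fix y assume y: "y \<in> S"
      then show "(\<lambda>y\<in>V. s y ^ 2) y = (\<lambda>y\<in>V. 1) y" using sx sy S(1) by (cases "y = x") auto
    qed
    then have "(s y)\<^sup>2 = 1" if "y \<in> V" for y using that by (metis restrict_apply')
    then show ?thesis using sc sx sy by (auto simp: signs_def)
  qed
  then have "\<forall>x\<in>S. \<exists>s. s \<in> signs G \<and> s x = - 1 \<and> (\<forall>y\<in>S - {x}. s y = 1)" by blast
  from bchoice[OF this] obtain \<sigma>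
    where "\<forall>x\<in>S. \<sigma> x \<in> signs G \<and> \<sigma> x x = - 1 \<and> (\<forall>y\<in>S - {x}. \<sigma> x y = 1)" by (elim exE)
  then have \<sigma>: "\<And>x. x \<in> S \<Longrightarrow> \<sigma> x \<in> signs G" "\<And>x. x \<in> S \<Longrightarrow> \<sigma> x x = - 1"
     "\<And>x y. x \<in> S \<Longrightarrow> y \<in> S \<Longrightarrow> y \<noteq> x \<Longrightarrow> \<sigma> x y = 1"
    by simp_all
  have "bij_betw (\<lambda>s. restrict s S) (signs G) (PiE S (\<lambda>_. {1, - 1}))"
  proof (rule bij_betw_imageI)
    show "inj_on (\<lambda>s. restrict s S) (signs G)"
    proof (rule inj_onI)
      fix s t assume st: "s \<in> signs G" "t \<in> signs G" "restrict s S = restrict t S"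
      show "s = t"
        by (rule characters_agree[OF signsD(1)[OF st(1)] signsD(1)[OF st(2)] S(1) S(4)]) (use fun_cong[OF st(3)] in \<open>metis restrict_apply'\<close>)
    qed
    show "(\<lambda>s. restrict s S) ` signs G = PiE S (\<lambda>_. {1, - 1})"
    proof (intro subset_antisym subsetI)
      fix t assume "t \<in> (\<lambda>s. restrict s S) ` signs G"
      then obtain s where s: "s \<in> signs G" "t = restrict s S" by blast
      show "t \<in> PiE S (\<lambda>_. {1, - 1})"
      proof (rule PiE_I)
        fix i assume i: "i \<in> S"
        then have "i \<in> V" using S(1) by blast
        then show "t i \<in> {1, - 1}" using signsD(2)[OF s(1), of i] i by (simp add: s(2))
      qed (simp add: s(2))
    next
      fix t assume t: "t \<in> PiE S (\<lambda>_. {1, - 1 :: complex})"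
      define s where "s = (\<lambda>y\<in>V. \<Prod>x\<in>{x \<in> S. t x = - 1}. \<sigma> x y)"
      have s: "s \<in> signs G" unfolding s_def by (rule prod_signs) (use \<sigma> in auto)
      have "restrict s S = t"
      proof (rule extensionalityI[of _ S])
        fix y assume y: "y \<in> S"
        have "(\<Prod>x\<in>{x \<in> S. t x = - 1}. \<sigma> x y) = (\<Prod>x\<in>{x \<in> S. t x = - 1}. if x = y then - 1 else 1)"
          by (intro prod.cong refl) (use \<sigma> y in auto)
        also have "\<dots> = (if t y = - 1 then - 1 else 1)" using S(2) y by (simp add: prod.delta)
        also have "\<dots> = t y" using PiE_mem[OF t y] by auto
        finally show "restrict s S y = t y" using y S(1) by (auto simp: s_def)
      qed (use t in \<open>auto simp: PiE_def\<close>)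
      then show "t \<in> (\<lambda>s. restrict s S) ` signs G" using s by (intro image_eqI[of _ _ s]) auto
    qed
  qed
  then have "card (signs G) = card (PiE S (\<lambda>_. {1, - 1 :: complex}))" by (rule bij_betw_same_card)
  also have "\<dots> = 2 ^ card S" using S(2) by (simp add: card_PiE numeral_2_eq_2)
  finally show ?thesis using S(3) by simp
qed

text \<open>Sign characters do not see elements of odd order, so they can be restricted to the Sylow 2-subgroup.\<close>

lemma card_signs:
  assumes fin: "finite V"
  shows "card (signs G) = 2 ^ rank_at 2 G"
proof -
  define a where "a = multiplicity (2::nat) (order G)"
  have o0: "order G > 0" using fin order_gt_0_iff_finite by blast
  obtain m where m: "order G = 2 ^ a * m" "\<not> 2 dvd m"
    using multiplicity_decompose'[of "order G" "2::nat"] o0 unfolding a_def by auto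
  have m0: "m \<noteq> 0" using m(2) by (cases m) auto
  have "gcd m (2 ^ a) = 1" using m(2) by (simp add: coprime_commute flip: coprime_iff_gcd_eq_1)
  then obtain u v where uv: "m * u = 2 ^ a * v + 1" using bezout_nat[OF m0, of "2 ^ a"] by metis
  (* The Sylow subgroup consists of the elements of order dividing \<open>2 ^ a\<close>, which also shows that it is
     unique. *)
  define P where "P = {x \<in> V. x [^] ((2::nat) ^ a) = \<one>}"
  have PH: "H = P" if H: "subgroup H G" "card H = 2 ^ a" for H
  proof (intro subset_antisym subsetI)
    have HV: "H \<subseteq> V" by (rule subgroup.subset[OF H(1)])
    fix x assume x: "x \<in> H"
    interpret HG: group "G\<lparr>carrier := H\<rparr>" by (rule subgroup.subgroup_is_group[OF H(1) is_group])
    have "x [^]\<^bsub>G\<lparr>carrier := H\<rparr>\<^esub> (order (G\<lparr>carrier := H\<rparr>)) = \<one>\<^bsub>G\<lparr>carrier := H\<rparr>\<^esub>"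
      by (rule HG.pow_order_eq_1) (use x in simp)
    then have "x [^] ((2::nat) ^ a) = \<one>" using H(2) by (simp add: order_def nat_pow_consistent[symmetric])
    then show "x \<in> P" using x HV by (auto simp: P_def)
  next
    fix x assume "x \<in> P"
    then have x: "x \<in> V" "x [^] ((2::nat) ^ a) = \<one>" by (auto simp: P_def)
    have nH: "H \<lhd> G" using normal_iff_subgroup H(1) by blast
    interpret Q: group "G Mod H" by (rule normal.factorgroup_is_group[OF nH])
    interpret h: group_hom G "G Mod H" "\<lambda>x. H #> x" by unfold_locales (rule normal.r_coset_hom_Mod[OF nH])
    have "order (G Mod H) * 2 ^ a = 2 ^ a * m"
      using lagrange[OF H(1)] H(2) m(1) by (simp add: order_def FactGroup_def)
    then have oQ: "order (G Mod H) = m" by simp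
    have "H #> (x [^] m) = (H #> x) [^]\<^bsub>G Mod H\<^esub> m" by (rule h.hom_nat_pow[OF x(1)])
    also have "\<dots> = \<one>\<^bsub>G Mod H\<^esub>" using Q.pow_order_eq_1[OF h.hom_closed[OF x(1)]] by (simp only: oQ)
    finally have "H #> (x [^] m) = H" by simp
    then have xm: "x [^] m \<in> H" using rcos_self[OF nat_pow_closed[OF x(1)] H(1)] by metis
    have "(x [^] m) [^] u = x [^] (2 ^ a * v + 1)" using x(1) by (simp only: nat_pow_pow uv)
    also have "\<dots> = (x [^] ((2::nat) ^ a)) [^] v \<otimes> x [^] (1::nat)" by (simp only: nat_pow_pow[OF x(1)] nat_pow_mult[OF x(1)])
    also have "\<dots> = x" unfolding x(2) using x(1) by simp
    finally have e: "(x [^] m) [^] u = x" .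
    have "y [^] n \<in> H" if "y \<in> H" for y and n :: nat
      by (induction n) (use that subgroup.m_closed[OF H(1)] subgroup.one_closed[OF H(1)] in auto)
    then show "x \<in> H" using xm e by metis
  qed
  obtain H where H: "subgroup H G" "card H = 2 ^ a"
    using sylow_thm[OF _ is_group m(1) fin] by auto
  then have P: "subgroup P G" "card P = 2 ^ a" using PH by auto
  have syl: "sylow_subgroup 2 G = P"
    unfolding sylow_subgroup_def a_def[symmetric]
  proof (rule the_equality)
    show "subgroup P G \<and> card P = 2 ^ a" using P by simp
    fix H assume "subgroup H G \<and> card H = 2 ^ a"
    then show "H = P" by (elim conjE) (rule PH)
  qed
  let ?P = "G\<lparr>carrier := P\<rparr>"
  have PV: "P \<subseteq> V" by (rule subgroup.subset[OF P(1)])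
  interpret PG: group ?P by (rule subgroup.subgroup_is_group[OF P(1) is_group])
  interpret PG: comm_group ?P by (rule PG.group_comm_groupI) (use PV in \<open>auto intro: m_comm\<close>)
  have fP: "finite P" using PV fin finite_subset by blast
  have "card (signs ?P) = 2 ^ min_generators ?P"
    by (rule PG.card_signs_2group) (use fP P(2) in \<open>simp_all add: order_def\<close>)
  (* As \<open>m\<close> is odd, a sign is unchanged by \<open>m\<close>-th powers, and \<open>x \<mapsto> x [^] m\<close> maps \<open>V\<close> into the Sylow
     subgroup; this inverts restriction. *)
  moreover have "card (signs G) = card (signs ?P)"
  proof (rule bij_betw_same_card[OF bij_betwI[of "\<lambda>s. restrict s P" _ _ "\<lambda>t. \<lambda>x\<in>V. t (x [^] m)"]], goal_cases)
    case 1 show ?case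
      using PV subgroup.m_closed[OF P(1)] by (auto simp: signs_def characters_def subset_iff)
  next
    case 2
    have xm: "x [^] m \<in> P" if "x \<in> V" for x
    proof -
      have "(x [^] m) [^] ((2::nat) ^ a) = x [^] (order G)" unfolding m(1) using that by (simp add: nat_pow_pow mult.commute)
      then show ?thesis using that pow_order_eq_1[OF that] by (simp add: P_def)
    qed
    have "(\<lambda>x\<in>V. t (x [^] m)) \<in> signs G" if t: "t \<in> signs ?P" for t
    proof -
      have tm: "t (p \<otimes> p') = t p * t p'" "norm (t p) = 1" "(t p)\<^sup>2 = 1" if "p \<in> P" "p' \<in> P" for p p'
        using t that by (auto simp: signs_def characters_def)
      have "t ((x \<otimes> y) [^] m) = t (x [^] m) * t (y [^] m)" if "x \<in> V" "y \<in> V" for x y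
        using tm(1)[OF xm[OF that(1)] xm[OF that(2)]] that by (simp add: pow_mult_distrib m_comm)
      then show ?thesis using tm(2,3)[OF xm xm] by (auto simp: signs_def characters_def)
    qed
    then show ?case by blast
  next
    case (3 s)
    have "s (x [^] m) = s x" if x: "x \<in> V" for x
    proof -
      have "s (x [^] m) = s x ^ m" using character_pow[OF signsD(1)[OF 3] x] .
      then show ?thesis using signsD(2)[OF 3 x] m(2) by auto
    qed
    moreover have "x [^] m \<in> P" if "x \<in> V" for x
    proof -
      have "(x [^] m) [^] ((2::nat) ^ a) = x [^] (order G)" unfolding m(1) using that by (simp add: nat_pow_pow mult.commute)
      then show ?thesis using that pow_order_eq_1[OF that] by (simp add: P_def)
    qed
    ultimately show ?case
      using charactersD(1)[OF signsD(1)[OF 3]] by (intro extensionalityI[of _ V]) auto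
  next
    case (4 t)
    have tc: "t \<in> characters ?P" by (rule signsD(1)[OF 4])
    have "t (x [^] m) = t x" if x: "x \<in> P" for x
    proof -
      have "t (x [^]\<^bsub>?P\<^esub> m) = t x ^ m" using PG.character_pow[OF tc] x by simp
      then have "t (x [^] m) = t x ^ m" by (simp add: nat_pow_consistent[symmetric])
      then show ?thesis using signsD(2)[OF 4, of x] x m(2) by auto
    qed
    then show ?case
      using charactersD(1)[OF tc] PV by (intro extensionalityI[of _ P]) (auto simp: subset_iff)
  qed
  ultimately show ?thesis by (simp add: rank_at_def syl)
qed

end

section \<open>The limiting moments\<close>

theorem theorem1p4:
  fixes V :: "('a, 'm) monoid_scheme" and d :: nat
  assumes "d \<ge> 3" and "comm_group V" and "finite (carrier V)"
  shows "(odd d \<longrightarrow>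
            (\<lambda>k. expected_sur d (2 * k) V) \<longlonglongrightarrow> real (order (exterior_square V))) \<and>
         (even d \<longrightarrow>
            (\<lambda>k. expected_sur d (2 * k) V)
              \<longlonglongrightarrow> 2 ^ rank_at 2 V * real (order (exterior_square V)))"
proof -
  interpret comm_group V by (rule assms(2))
  let ?F = "{f \<in> antisymmetric_forms. \<forall>x\<in>carrier V. f x x = 1}"
  let ?L = "real (card {f \<in> antisymmetric_forms. \<forall>x\<in>carrier V. f x x ^ d = 1})"
  have ev: "\<forall>\<^sub>F k in sequentially.
      (\<Sum>q\<in>full {0..<2 * k}. hit_prob {0..<2 * k} d q) / real (card (carrier V)) = expected_sur d (2 * k) V"
    using eventually_gt_at_top[of 0] by (rule eventually_mono) (simp add: expected_sur_eq[OF assms(3)])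
  have lim: "(\<lambda>k. expected_sur d (2 * k) V) \<longlonglongrightarrow> ?L"
    by (rule Lim_transform_eventually[OF sum_hit_prob_tendsto[OF assms(3,1)] ev])
  (* The diagonal of an antisymmetric form takes values 1 and -1, so its \<open>d\<close>-th power depends only on
     the parity of \<open>d\<close>. *)
  have sq: "(f x x)\<^sup>2 = 1" if "f \<in> antisymmetric_forms" "x \<in> carrier V" for f x
    using antisymmetric_formsD(4)[OF that(1) that(2) that(2)] by (simp add: power2_eq_square)
  have pow: "f x x ^ d = (if even d then 1 else f x x)" if "f \<in> antisymmetric_forms" "x \<in> carrier V" for f x
  proof (cases "even d")
    case True
    then show ?thesis using sq[OF that] by (auto elim!: evenE simp: power_mult)
  next
    case False
    then show ?thesis using sq[OF that] by (auto elim!: oddE simp: power_mult)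
  qed
  have "?L = real (order (exterior_square V))" if "odd d"
  proof -
    have "{f \<in> antisymmetric_forms. \<forall>x\<in>carrier V. f x x ^ d = 1} = ?F" using pow that by auto
    then show ?thesis using card_exterior_square[OF assms(3)] by simp
  qed
  moreover have "?L = 2 ^ rank_at 2 V * real (order (exterior_square V))" if "even d"
  proof -
    have "{f \<in> antisymmetric_forms. \<forall>x\<in>carrier V. f x x ^ d = 1} = antisymmetric_forms" using pow that by auto
    then show ?thesis
      using card_antisymmetric_forms card_signs[OF assms(3)] card_exterior_square[OF assms(3)] by simp
  qed
  ultimately show ?thesis using lim by auto
qed

end
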